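(* Consider the homotopy $H:\mathbb{R}^{mn}\times\mathbb{R}\times[0,1)\to\mathbb{R}^{mn}\times\mathbb{R}$, $$H(\varphi,\lambda,t)=\begin{pmatrix}(1-t)A(K)\varphi+D\varphi+t\beta\varphi^3-\lambda\varphi\\ \frac12\left(\frac1{h_1h_2}-\varphi^{\mathrm T}\varphi\right)\end{pmatrix},$$ where $A(K)$ is the block diagonal matrix with tridiagonal blocks determined by $K\in\mathbb{R}^{2nm-m}$. For all positive integers $m,n$ with $m\ge n\ge 6$ and for almost all $K\in\mathbb{R}^{2nm-m}\setminus(U_1\cup U_2)$: (i) $0$ is a regular value of $H$, and therefore the homotopy paths corresponding to different initial points do not intersect each other for $t\in[0,1)$; (ii) every homotopy path $(\varphi(s),\lambda(s),t(s))\subset H^{-1}(0)$ is bounded.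
   Context: For a vector $\varphi$, $\varphi^3$ denotes the vector of componentwise cubes. $\Omega=[a,b]\times[c,d]$, $h_1=\frac{b-a}{m+1}$, $h_2=\frac{d-c}{n+1}$, $x_i=a+ih_1$, $y_j=c+jh_2$, $V(x,y)=\frac12(x^2+y^2)$, $v_{ij}=V(x_i,y_j)$; $\beta\in\mathbb{R}$ is a constant. Vectors are ordered $\varphi=(\varphi_{11},\dots,\varphi_{1n},\dots,\varphi_{m1},\dots,\varphi_{mn})^{\mathrm T}$. The matrix $D\in\mathbb{R}^{mn\times mn}$ is block tridiagonal with $m\times m$ blocks of size $n\times n$: the $i$-th diagonal block is $\frac12D_{ii}+\mathrm{diag}(v_{i1},\dots,v_{in})$, where $D_{ii}$ is tridiagonal with diagonal entries $\frac2{h_1^2}+\frac2{h_2^2}$ and sub- and superdiagonal entries $-\frac1{h_2^2}$; the blocks immediately above and below the block diagonal are $-\frac1{2h_1^2}I_n$; all other blocks are zero. $A(K)=\mathrm{diag}(A_1,\dots,A_m)\in\mathbb{R}^{mn\times mn}$ is block diagonal, where $A_i\in\mathbb{R}^{n\times n}$ is the symmetric tridiagonal matrix with diagonal entries $a^{(i)}_{11},\dots,a^{(i)}_{nn}$ and sub-/superdiagonal entries $a^{(i)}_{12},a^{(i)}_{23},\dots,a^{(i)}_{n-1,n}$; $K=(K_1,\dots,K_m)^{\mathrm T}\in\mathbb{R}^{2nm-m}$ with $K_i=(a^{(i)}_{11},a^{(i)}_{12},a^{(i)}_{22},a^{(i)}_{23},\dots,a^{(i)}_{n-1,n-1},a^{(i)}_{n-1,n},a^{(i)}_{nn})$.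 $U_1=\{K: R(K)=0\}$, where $R(K)$ is the discriminant of the polynomial $\lambda\mapsto\det(A(K)+D-\lambda I)$, and $U_2=(\mathbb{R}^+)^{2nm-m}$, with $\mathbb{R}^+$ the positive reals. The initial points are $(\varphi_0,\lambda_0,0)$ with $(\varphi_0,\lambda_0)$ an eigenpair of $H(\varphi,\lambda,0)=0$, i.e. $(A(K)+D)\varphi_0=\lambda_0\varphi_0$ and $\varphi_0^{\mathrm T}\varphi_0=\frac1{h_1h_2}$. The homotopy path corresponding to an initial point is the solution curve in $H^{-1}(0)$ starting from that point at $t=0$.
   Formalization: "Do not intersect each other" is proved as: homotopy paths from different initial points are disjoint or are the same curve; a path may turn in t and return to t=0 at another initial point, and then the two paths coincide, so the literal claim fails for an open set of K. *)

theory Defs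
  imports "HOL-Analysis.Analysis" "Subresultants.Resultant_Prelim"
begin

no_notation Matrix.vec_index (infixl "$" 100)

text \<open>
  The grid has CARD('m) times CARD('n) interior points, where \<open>'m\<close> and \<open>'n\<close> are finite linearly
  ordered types; the linear order is only used to number the indices \<open>1, 2, \<dots>\<close>.
  A vector of \<open>\<real>\<^sup>m\<^sup>n\<close> is an element of \<open>real ^ ('m \<times> 'n)\<close>, with component \<open>(i, j)\<close> standing
  for \<open>\<phi>\<^sub>i\<^sub>j\<close>; the matrix block in position \<open>(i, k)\<close> consists of the entries \<open>((i, j), (k, l))\<close>.
\<close>

definition pos :: "'a::{finite,linorder} \<Rightarrow> nat" where
  "pos i = card {k. k \<le> i}"

definition mesh :: "nat \<Rightarrow> real \<Rightarrow> real \<Rightarrow> real" where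
  "mesh N lo hi = (hi - lo) / (real N + 1)"

definition V :: "real \<Rightarrow> real \<Rightarrow> real" where
  "V x y = (x\<^sup>2 + y\<^sup>2) / 2"

definition v_grid :: "real \<Rightarrow> real \<Rightarrow> real \<Rightarrow> real \<Rightarrow>
    'm::{finite,linorder} \<Rightarrow> 'n::{finite,linorder} \<Rightarrow> real" where
  "v_grid a b c d i j =
     V (a + real (pos i) * mesh CARD('m) a b) (c + real (pos j) * mesh CARD('n) c d)"

definition D_matrix :: "real \<Rightarrow> real \<Rightarrow> real \<Rightarrow> real \<Rightarrow>
    real ^ ('m::{finite,linorder} \<times> 'n::{finite,linorder}) ^ ('m \<times> 'n)" where
  "D_matrix a b c d =
     (let h1 = mesh CARD('m) a b; h2 = mesh CARD('n) c d in
      \<chi> p q. case (p, q) of ((i, j), (k, l)) \<Rightarrow>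
        if k = i then
          1/2 * (if l = j then 2 / h1\<^sup>2 + 2 / h2\<^sup>2
                 else if pos l = pos j + 1 \<or> pos j = pos l + 1 then - 1 / h2\<^sup>2
                 else 0)
          + (if l = j then v_grid a b c d i j else 0)
        else if (pos k = pos i + 1 \<or> pos i = pos k + 1) \<and> l = j then - 1 / (2 * h1\<^sup>2)
        else 0)"

text \<open>
  The parameter space \<open>\<real>\<^bsup>2nm-m\<^esup>\<close> is \<open>real ^ 'k ^ 'm\<close> with \<open>CARD('k) = 2 * CARD('n) - 1\<close>; the
  row \<open>K $ i\<close> is \<open>K\<^sub>i\<close>.  In \<open>K\<^sub>i\<close> the diagonal entry \<open>a\<^sub>j\<^sub>j\<close> occupies place \<open>2j - 1\<close> and the
  off-diagonal entry in row \<open>j\<close>, column \<open>j + 1\<close> occupies place \<open>2j\<close>.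
\<close>

definition K_entry :: "real ^ 'k::{finite,linorder} ^ 'm::finite \<Rightarrow> 'm \<Rightarrow> nat \<Rightarrow> real" where
  "K_entry K i r = K $ i $ (THE p. pos p = r)"

definition A_matrix :: "real ^ 'k::{finite,linorder} ^ 'm::{finite,linorder} \<Rightarrow>
    real ^ ('m::{finite,linorder} \<times> 'n::{finite,linorder}) ^ ('m \<times> 'n)" where
  "A_matrix K =
     (\<chi> p q. case (p, q) of ((i, j), (k, l)) \<Rightarrow>
        if k = i then
          (if l = j then K_entry K i (2 * pos j - 1)
           else if pos l = pos j + 1 then K_entry K i (2 * pos j)
           else if pos j = pos l + 1 then K_entry K i (2 * pos l)
           else 0)
        else 0)"

definition cube :: "real ^ 'a::finite \<Rightarrow> real ^ 'a" where
  "cube \<phi> = (\<chi> p. (\<phi> $ p) ^ 3)"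

definition homotopy :: "real \<Rightarrow> real \<Rightarrow> real \<Rightarrow> real \<Rightarrow> real \<Rightarrow> real ^ 'k::{finite,linorder} ^ 'm::{finite,linorder} \<Rightarrow>
    (real ^ ('m::{finite,linorder} \<times> 'n::{finite,linorder})) \<times> real \<times> real \<Rightarrow>
    (real ^ ('m \<times> 'n)) \<times> real" where
  "homotopy a b c d \<beta> K = (\<lambda>(\<phi>, \<mu>, t).
     ((1 - t) *\<^sub>R (A_matrix K *v \<phi>) + D_matrix a b c d *v \<phi> + (t * \<beta>) *\<^sub>R cube \<phi> - \<mu> *\<^sub>R \<phi>,
      1/2 * (1 / (mesh CARD('m) a b * mesh CARD('n) c d) - \<phi> \<bullet> \<phi>)))"

definition homotopy_dom :: "((real ^ 'a::finite) \<times> real \<times> real) set" where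
  "homotopy_dom = UNIV \<times> UNIV \<times> {0..<1}"

definition zero_set :: "real \<Rightarrow> real \<Rightarrow> real \<Rightarrow> real \<Rightarrow> real \<Rightarrow> real ^ 'k::{finite,linorder} ^ 'm::{finite,linorder} \<Rightarrow>
    ((real ^ ('m::{finite,linorder} \<times> 'n::{finite,linorder})) \<times> real \<times> real) set" where
  "zero_set a b c d \<beta> K = {u \<in> homotopy_dom. homotopy a b c d \<beta> K u = 0}"

definition initial_point :: "real \<Rightarrow> real \<Rightarrow> real \<Rightarrow> real \<Rightarrow> real ^ 'k::{finite,linorder} ^ 'm::{finite,linorder} \<Rightarrow>
    (real ^ ('m::{finite,linorder} \<times> 'n::{finite,linorder})) \<times> real \<times> real \<Rightarrow> bool" where
  "initial_point a b c d K u \<longleftrightarrow>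
     (\<exists>\<phi>0 \<mu>0. u = (\<phi>0, \<mu>0, 0) \<and>
        (A_matrix K + D_matrix a b c d) *v \<phi>0 = \<mu>0 *\<^sub>R \<phi>0 \<and>
        \<phi>0 \<bullet> \<phi>0 = 1 / (mesh CARD('m) a b * mesh CARD('n) c d))"

definition det_poly :: "real ^ 'a::finite ^ 'a::finite \<Rightarrow> real poly" where
  "det_poly M = Determinants.det (\<chi> p q. [:M $ p $ q:] - (if p = q then [:0, 1:] else 0))"

definition discriminant :: "real poly \<Rightarrow> real" where
  "discriminant p =
     (-1) ^ (degree p * (degree p - 1) div 2) * resultant p (pderiv p) / lead_coeff p"

text \<open>The type \<open>'n\<close> does not occur in the type of \<open>K\<close>, hence the \<open>itself\<close> argument.\<close>

definition U1 :: "'n::{finite,linorder} itself \<Rightarrow> real \<Rightarrow> real \<Rightarrow> real \<Rightarrow> real \<Rightarrow>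
    (real ^ 'k::{finite,linorder} ^ 'm::{finite,linorder}) set" where
  "U1 _ a b c d =
     {K. discriminant
           (det_poly (A_matrix K + D_matrix a b c d :: real ^ ('m \<times> 'n) ^ ('m \<times> 'n))) = 0}"

definition U2 :: "(real ^ 'k::finite ^ 'm::finite) set" where
  "U2 = {K. \<forall>i p. K $ i $ p > 0}"

text \<open>
  For the domain used here (\<open>homotopy_dom\<close>) the derivative within \<open>S\<close> is unique also at the
  boundary points \<open>t = 0\<close>, where it is the usual Jacobian with a one-sided \<open>t\<close>-derivative.
\<close>

definition regular_value ::
    "('a::real_normed_vector \<Rightarrow> 'b::real_normed_vector) \<Rightarrow> 'a set \<Rightarrow> 'b \<Rightarrow> bool" where
  "regular_value f S y \<longleftrightarrow>
     (\<forall>x\<in>S. f x = y \<longrightarrow> (\<exists>f'. (f has_derivative f') (at x within S) \<and> surj f'))"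

text \<open>
  A solution curve is a regular \<open>C\<^sup>1\<close> curve in \<open>Z\<close>, parametrized by arc length \<open>s\<close> over a
  nondegenerate interval \<open>I\<close> with left end point \<open>0 \<in> I\<close>; \<open>I\<close> may be bounded or unbounded, and
  open or closed on the right.  Because the parameter is arc length, maximality with respect to
  extension of \<open>I\<close> does not depend on a choice of parametrization.  The path starting at \<open>p\<close> is
  the maximal solution curve with \<open>\<gamma> 0 = p\<close>.  A path may turn in \<open>t\<close> and return to the level
  \<open>t = 0\<close> at a second initial point; the paths from these two points are then the same curve,
  traversed in opposite directions, so their images coincide.
\<close>

definition solution_curve :: "'a::real_normed_vector set \<Rightarrow> real set \<Rightarrow> (real \<Rightarrow> 'a) \<Rightarrow> bool" where
  "solution_curve Z I \<gamma> \<longleftrightarrow>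
     is_interval I \<and> 0 \<in> I \<and> I \<subseteq> {0..} \<and> I \<noteq> {0} \<and> \<gamma> ` I \<subseteq> Z \<and>
     (\<exists>\<gamma>'. continuous_on I \<gamma>' \<and>
       (\<forall>s\<in>I. (\<gamma> has_vector_derivative \<gamma>' s) (at s within I) \<and> norm (\<gamma>' s) = 1))"

definition path_from :: "'a::real_normed_vector set \<Rightarrow> 'a \<Rightarrow> real set \<Rightarrow> (real \<Rightarrow> 'a) \<Rightarrow> bool" where
  "path_from Z p I \<gamma> \<longleftrightarrow>
     solution_curve Z I \<gamma> \<and> \<gamma> 0 = p \<and>
     (\<forall>J \<delta>. solution_curve Z J \<delta> \<and> I \<subseteq> J \<and> (\<forall>s\<in>I. \<delta> s = \<gamma> s) \<longrightarrow> J = I)"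

end

theory Submission
  imports Defs
begin

no_notation scalar_prod (infix "\<bullet>" 70)

text \<open>
  Consider the zeros of \<open>H\<close> as a set in the space of all \<open>(\<phi>, \<lambda>, t, K)\<close>, and its projection to the
  parameters \<open>K\<close>.  Wherever extra equations cut the set of critical zeros down to a submanifold of
  dimension at most that of the parameter space, its projection is negligible by the equidimensional
  case of Sard's theorem; this avoids Sard's theorem for maps that lower the dimension.  Three
  cases arise.  If \<open>K \<mapsto> A(K) \<phi>\<close> is not surjective, then \<open>\<phi>\<close> has long runs of zeros in some block, and
  the rows of the discrete Laplacian there yield two independent linear equations for \<open>\<phi>\<close>.  If it is
  surjective but some component of \<open>\<phi>\<close> is zero, this vanishing is the extra equation.  If no component
  vanishes, the diagonal of \<open>A(K)\<close> can be eliminated, and criticality becomes a polynomial equation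
  in the other parameters; the polynomial is nontrivial because for \<open>t = 0\<close> and suitable \<open>K\<close> the
  reduced Jacobian is the weighted Laplacian of a spanning tree of the grid.  The zero set of a nontrivial
  polynomial is covered by finitely many smooth hypersurfaces.

  At \<open>t = 0\<close> the same argument shows that the zeros are transversal to the time slice.  Two paths through
  a common point then coincide up to direction: with equal directions one of them would pass
  through the level \<open>t = 0\<close> at an interior parameter, and with opposite directions they are the same
  curve traversed from its two ends.  The zero set is bounded because \<open>\<phi>\<close> lies on a sphere and determines
  \<open>\<lambda>\<close> together with \<open>t\<close>.
\<close>

subsection \<open>Negligible sets of parameters\<close>

text \<open>For fixed \<open>K\<close> there is one unknown more than there are equations, so the
  zeros over all parameters would have dimension one above the parameter space; this is why a
  critical set has to be confined by an extra equation. Such an equation helps only if the enlarged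
  system is still submersive in all variables together, which decides the choice: the parameter
  directions used to correct the rows must leave the extra equation fixed. The equations for a zero
  component and for \<open>t = 0\<close> do not contain \<open>K\<close>. The criticality
  determinant does, but after the elimination it is free of the diagonal of \<open>A K\<close>, and
  the diagonal alone moves every row when no component of \<phi> is zero. The value t = 1 has to
  stay excluded because \<open>A K\<close> drops out there. The weights of the reduced Jacobian
  contain products of components of \<phi> and can have either sign, so a definiteness argument for
  the Laplacian is out of reach; on a tree, leaves can be stripped one by one and only nonzero
  weights matter.\<close>

typedef (overloaded) ('a::euclidean_space) basis_index = "Basis :: 'a set"
  by (rule nonempty_Basis[unfolded ex_in_conv[symmetric]])

text \<open>Any numbering will do: it only serves to pull back a well-order.\<close>

definition basis_num :: "'a::euclidean_space basis_index \<Rightarrow> nat" where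
  "basis_num = (SOME f. inj f)"

lemma finite_UNIV_basis_index: "finite (UNIV :: 'a::euclidean_space basis_index set)"
  by (simp add: type_definition.univ[OF type_definition_basis_index])

lemma inj_basis_num: "inj (basis_num :: 'a::euclidean_space basis_index \<Rightarrow> nat)"
proof -
  obtain f :: "'a basis_index \<Rightarrow> nat" where "inj f"
    using finite_imp_inj_to_nat_seg[OF finite_UNIV_basis_index] by auto
  then show ?thesis
    unfolding basis_num_def by (rule someI[of inj])
qed

instantiation basis_index :: (euclidean_space) "{finite, wellorder}"
begin

definition "i \<le> j \<longleftrightarrow> basis_num i \<le> basis_num j"
definition "i < j \<longleftrightarrow> basis_num i < basis_num j"

instance
proof
  fix P :: "'a basis_index \<Rightarrow> bool" and a :: "'a basis_index"
  assume *: "\<And>x. (\<And>y. y < x \<Longrightarrow> P y) \<Longrightarrow> P x"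
  show "P a"
    by (induction a rule: measure_induct_rule[where f = basis_num])
       (use * less_basis_index_def in blast)
qed (auto simp: less_eq_basis_index_def less_basis_index_def finite_UNIV_basis_index
          intro: injD[OF inj_basis_num])

end

lemma CARD_basis_index: "CARD('a::euclidean_space basis_index) = DIM('a::euclidean_space)"
  by (rule type_definition.card[OF type_definition_basis_index])

text \<open>The library states the equidimensional case of Sard's theorem for \<open>real ^ 'n\<close> with a
  wellordered index type; the type of basis vectors provides such an index type.\<close>

lemma negligible_critical_values:
  fixes f :: "'a::euclidean_space \<Rightarrow> 'a"
  assumes der: "\<And>x. x \<in> S \<Longrightarrow> (f has_derivative f' x) (at x within S)"
    and crit: "\<And>x. x \<in> S \<Longrightarrow> \<not> surj (f' x)"
  shows "negligible (f ` S)"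
proof -
  have dim: "DIM('a) = DIM(real ^ 'a basis_index)"
    by (simp add: CARD_basis_index)
  obtain J :: "'a \<Rightarrow> real ^ 'a basis_index" and J' where "linear J \<and> linear J' \<and> (\<forall>x. J' (J x) = x) \<and> (\<forall>y. J (J' y) = y)"
    by (rule isomorphisms_UNIV_UNIV[OF dim]) blast
  then have J: "linear J" "linear J'" "\<And>x. J' (J x) = x" "\<And>y. J (J' y) = y"
    by auto
  have "negligible ((\<lambda>y. J (f (J' y))) ` (J ` S))"
  proof (rule baby_Sard)
    fix y assume "y \<in> J ` S"
    then have y: "J' y \<in> S" using J by auto
    have fd: "(f has_derivative f' (J' y)) (at (J' y) within J' ` J ` S)"
      using der[OF y] J by (simp add: image_image)
    show "((\<lambda>y. J (f (J' y))) has_derivative (\<lambda>v. J (f' (J' y) (J' v)))) (at y within J ` S)"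
      by (rule diff_chain_within[OF diff_chain_within[OF linear_imp_has_derivative[OF J(2)] fd]
          linear_imp_has_derivative[OF J(1)], unfolded o_def])
    have lin: "linear (\<lambda>v. J (f' (J' y) (J' v)))"
      using linear_compose[OF linear_compose[OF J(2) has_derivative_linear[OF fd]] J(1)]
      by (simp add: o_def)
    have "\<not> surj (\<lambda>v. J (f' (J' y) (J' v)))"
    proof
      assume s: "surj (\<lambda>v. J (f' (J' y) (J' v)))"
      have "surj (f' (J' y))"
        unfolding surj_def
      proof
        fix z
        obtain v where "J z = J (f' (J' y) (J' v))" using surjD[OF s] by blast
        then show "\<exists>x. z = f' (J' y) x" using J(3) by metis
      qed
      then show False using crit[OF y] by simp
    qed
    then have "rank (matrix (\<lambda>v. J (f' (J' y) (J' v)))) \<noteq> CARD('a basis_index)"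
      using lin full_rank_surjective[of "matrix (\<lambda>v. J (f' (J' y) (J' v)))"]
      by (simp add: matrix_works)
    then show "rank (matrix (\<lambda>v. J (f' (J' y) (J' v)))) < CARD('a basis_index)"
      using rank_bound[of "matrix (\<lambda>v. J (f' (J' y) (J' v)))"] by simp
  qed simp
  then have "negligible (J' ` (\<lambda>y. J (f (J' y))) ` (J ` S))"
    by (rule negligible_differentiable_image_negligible[rotated])
       (use J dim in \<open>auto intro: linear_imp_differentiable_on\<close>)
  then show ?thesis
    using J by (simp add: image_image)
qed

section \<open>Straightening of level sets and parametric transversality\<close>

text \<open>With a right inverse \<open>T\<close> of \<open>q' x0\<close>, the map
  \<open>x + T (q x - q' x0 x)\<close> has the identity as derivative at \<open>x0\<close> and turns
  \<open>q\<close> into the linear map \<open>q' x0\<close>. The inverse function theorem makes it a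
  chart in which the zeros of \<open>q\<close> lie in the kernel of \<open>q' x0\<close>.\<close>

lemma level_set_chart:
  fixes q :: "'a::euclidean_space \<Rightarrow> 'b::euclidean_space"
  assumes der: "\<And>x. (q has_derivative q' x) (at x)"
    and cont: "\<And>v. continuous_on UNIV (\<lambda>x. q' x v)"
    and surj: "surj (q' x0)"
  obtains \<Phi> \<Phi>' N M g g' where "open N" "x0 \<in> N" "open M" "homeomorphism N M \<Phi> g"
     "\<And>x. (\<Phi> has_derivative \<Phi>' x) (at x)" "\<And>v. continuous_on UNIV (\<lambda>x. \<Phi>' x v)"
     "\<And>v. \<Phi>' x0 v = v"
     "\<And>x. q' x0 (\<Phi> x) = q x" "\<And>x v. q' x0 (\<Phi>' x v) = q' x v"
     "\<And>y. y \<in> M \<Longrightarrow> (g has_derivative g' y) (at y)"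
     "\<And>y v. y \<in> M \<Longrightarrow> \<Phi>' (g y) (g' y v) = v"
     "\<And>v. continuous_on M (\<lambda>y. g' y v)"
proof -
  have lin: "linear (q' x)" for x
    using der has_derivative_linear by blast
  obtain T where T: "linear T" "\<And>y. q' x0 (T y) = y"
    using linear_surjective_right_inverse[OF lin surj] by (auto simp: o_def id_def fun_eq_iff)
  define \<Phi> where "\<Phi> x = x - T (q' x0 x) + T (q x)" for x
  define \<Phi>' where "\<Phi>' x v = v - T (q' x0 v) + T (q' x v)" for x v
  have T_der: "(T has_derivative T) F" for F
    using T(1) linear_imp_has_derivative by blast
  have der_\<Phi>: "(\<Phi> has_derivative \<Phi>' x) (at x)" for x
    unfolding \<Phi>_def[abs_def] \<Phi>'_def[abs_def]
    by (intro has_derivative_add has_derivative_diff has_derivative_ident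
        has_derivative_compose[OF der T_der] has_derivative_compose[OF linear_imp_has_derivative[OF lin] T_der])
  have T_cont: "continuous_on UNIV T"
    using T(1) linear_continuous_on linear_conv_bounded_linear by blast
  have cont_\<Phi>: "continuous_on UNIV (\<lambda>x. \<Phi>' x v)" for v
    unfolding \<Phi>'_def by (intro continuous_intros cont continuous_on_compose2[OF T_cont]) auto
  have bl: "bounded_linear (\<Phi>' x)" for x
    using der_\<Phi> has_derivative_bounded_linear by blast
  define B where "B x = Blinfun (\<Phi>' x)" for x
  have B: "blinfun_apply (B x) = \<Phi>' x" for x
    unfolding B_def using bl by (simp add: bounded_linear_Blinfun_apply)
  have contB: "continuous_on UNIV B"
    by (rule continuous_on_blinfun_componentwise) (simp add: B cont_\<Phi>)
  \<comment> \<open>The radius 1/2 gives the uniform bound \<open>lower\<close> on the inverse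
    derivatives, from which the continuity of \<open>g'\<close> follows.\<close>
  define U where "U = {x. norm (B x - id_blinfun) < 1/2}"
  have openU: "open U"
    unfolding U_def by (intro open_Collect_less continuous_intros contB)
  have id: "\<Phi>' x0 v = v" for v by (simp add: \<Phi>'_def)
  have Bx0: "B x0 = id_blinfun" by (rule blinfun_eqI) (simp add: B id)
  have x0U: "x0 \<in> U" by (simp add: U_def Bx0)
  have idc: "id_blinfun o\<^sub>L B x0 = id_blinfun"
    by (rule blinfun_eqI) (simp add: Bx0)
  have derB: "\<And>x. x \<in> U \<Longrightarrow> (\<Phi> has_derivative blinfun_apply (B x)) (at x)"
    by (simp add: B der_\<Phi>)
  show ?thesis
  proof (rule inverse_function_theorem[OF openU derB continuous_on_subset[OF contB subset_UNIV] x0U idc])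
    fix N M g g'
    assume *: "open N" "N \<subseteq> U" "x0 \<in> N" "open M" "\<Phi> x0 \<in> M" "homeomorphism N M \<Phi> g"
      "\<And>y. y \<in> M \<Longrightarrow> (g has_derivative (g' y)) (at y)"
      "\<And>y. y \<in> M \<Longrightarrow> g' y = inv_into UNIV (blinfun_apply (B (g y)))"
      "\<And>y. y \<in> M \<Longrightarrow> bij (blinfun_apply (B (g y)))"
    have inv: "\<Phi>' (g y) (g' y v) = v" if "y \<in> M" for y v
      using *(8,9)[OF that] by (simp add: B bij_is_surj surj_f_inv_f)
    have gN: "g y \<in> N" if "y \<in> M" for y
      using *(6) that by (auto simp: homeomorphism_def)
    have lower: "norm v \<le> 2 * norm (\<Phi>' x v)" if "x \<in> U" for x v
    proof -
      have "norm (\<Phi>' x v - v) \<le> norm (B x - id_blinfun) * norm v"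
        using norm_blinfun[of "B x - id_blinfun" v] by (simp add: blinfun.diff_left B)
      also have "\<dots> \<le> 1/2 * norm v"
        using that by (intro mult_right_mono) (auto simp: U_def)
      finally show ?thesis using norm_triangle_ineq2[of v "v - \<Phi>' x v"]
        by (simp add: norm_minus_commute)
    qed
    have cont_g: "continuous_on M g"
      using *(6) by (simp add: homeomorphism_def)
    have "continuous_on M (\<lambda>y. g' y v)" for v
      unfolding continuous_on_def
    proof
      fix y0 assume y0: "y0 \<in> M"
      define w where "w y = v - \<Phi>' (g y) (g' y0 v)" for y
      have "continuous_on M w"
        unfolding w_def by (intro continuous_intros continuous_on_compose2[OF cont_\<Phi> cont_g]) auto
      then have "(w \<longlongrightarrow> w y0) (at y0 within M)"
        using y0 by (simp add: continuous_on_def)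
      then have "(w \<longlongrightarrow> 0) (at y0 within M)"
        using inv[OF y0] by (simp add: w_def)
      then have w0: "((\<lambda>y. 2 * norm (w y)) \<longlongrightarrow> 0) (at y0 within M)"
        by (intro tendsto_mult_right_zero tendsto_norm_zero)
      have "((\<lambda>y. g' y v - g' y0 v) \<longlongrightarrow> 0) (at y0 within M)"
      proof (rule Lim_null_comparison[OF _ w0])
        show "\<forall>\<^sub>F y in at y0 within M. norm (g' y v - g' y0 v) \<le> 2 * norm (w y)"
          unfolding eventually_at_filter
        proof (rule always_eventually, safe)
          fix y assume "y \<in> M"
          then have "\<Phi>' (g y) (g' y v - g' y0 v) = w y"
            using inv linear_diff[OF bounded_linear.linear[OF bl]] by (simp add: w_def)
          then show "norm (g' y v - g' y0 v) \<le> 2 * norm (w y)"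
            using lower[of "g y"] gN[OF \<open>y \<in> M\<close>] *(2) by (metis subsetD)
        qed
      qed
      then show "((\<lambda>y. g' y v) \<longlongrightarrow> g' y0 v) (at y0 within M)"
        by (simp add: LIM_zero_iff)
    qed
    note cont_g' = this
    have 1: "q' x0 (\<Phi> x) = q x" for x
      using T(2) by (simp add: \<Phi>_def linear_add[OF lin] linear_diff[OF lin])
    have 2: "q' x0 (\<Phi>' x v) = q' x v" for x v
      using T(2) by (simp add: \<Phi>'_def linear_add[OF lin] linear_diff[OF lin])
    show ?thesis
      by (rule that[OF *(1,3,4,6) der_\<Phi> cont_\<Phi> id 1 2 *(7) inv cont_g'])
  qed auto
qed

lemma dim_kernel_surj:
  fixes f :: "'a::euclidean_space \<Rightarrow> 'b::euclidean_space"
  assumes "linear f" "surj f"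
  shows "dim {x. f x = 0} + DIM('b) \<le> DIM('a)"
proof -
  obtain T where T: "linear T" "\<And>y. f (T y) = y"
    using linear_surjective_right_inverse[OF assms] by (auto simp: o_def id_def fun_eq_iff)
  have inj: "inj T" by (metis T(2) injI)
  have S: "subspace {x. f x = 0}" "subspace (range T)"
    using assms T by (auto simp: linear_subspace_kernel linear_subspace_image)
  have "{x. f x = 0} \<inter> range T = {0}"
    using T linear_0[OF T(1)] linear_0[OF assms(1)] by fastforce
  then have "dim {x. f x = 0} + dim (range T) = dim {x + y |x y. x \<in> {x. f x = 0} \<and> y \<in> range T}"
    using dim_sums_Int[OF S] by simp
  also have "\<dots> \<le> DIM('a)" by (rule dim_subset_UNIV)
  finally show ?thesis
    using dim_image_eq[OF T(1)] inj by (simp add: inj_on_subset)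
qed

text \<open>A kernel of too small dimension is parametrized non-injectively by the whole parameter
  space, so that \<open>parametric_transversality\<close> always ends with a map between spaces of
  equal dimension.\<close>

lemma linear_with_range:
  fixes K :: "'a::euclidean_space set"
  assumes "subspace K" "dim K \<le> DIM('b)"
  obtains L :: "'b::euclidean_space \<Rightarrow> 'a" where "linear L" "range L = K"
proof -
  obtain B where B: "B \<subseteq> K" "independent B" "K \<subseteq> span B" "card B = dim K"
    using basis_exists by blast
  have fin: "finite B" using B(2) finiteI_independent by blast
  obtain f where f: "f ` B \<subseteq> (Basis :: 'b set)" "inj_on f B"
    using card_le_inj[OF fin, of "Basis :: 'b set"] B(4) assms(2) by auto
  define L where "L x = (\<Sum>b\<in>B. (x \<bullet> f b) *\<^sub>R b)" for x :: 'b
  have "linear L"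
    unfolding L_def
    by (auto intro!: linearI simp: inner_add_left scaleR_add_left sum.distrib scaleR_sum_right)
  moreover have "range L \<subseteq> K"
    using B(1) assms(1) by (auto simp: L_def intro!: subspace_sum subspace_scale)
  moreover have "b \<in> range L" if "b \<in> B" for b
  proof -
    have "f b \<bullet> f c = (if c = b then 1 else 0)" if "c \<in> B" for c
      using f \<open>b \<in> B\<close> that inner_Basis[of "f b" "f c"] by (auto simp: image_subset_iff inj_on_def)
    then have "L (f b) = (\<Sum>c\<in>B. (if c = b then 1 else 0) *\<^sub>R c)"
      unfolding L_def by (intro sum.cong) auto
    also have "\<dots> = b" using fin that by (simp add: if_distrib[of "\<lambda>r. r *\<^sub>R _"] cong: if_cong)
    finally show ?thesis by (metis rangeI)
  qed
  then have "K \<subseteq> range L"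
    using B(3) span_minimal[of B "range L"] \<open>linear L\<close> linear_subspace_image[OF _ subspace_UNIV]
    by blast
  ultimately show ?thesis using that by blast
qed

text \<open>By Lindelof's theorem countably many of the neighbourhoods cover
  \<open>S\<close>.\<close>

lemma negligible_image_locally:
  fixes f :: "'a::second_countable_topology \<Rightarrow> 'b::euclidean_space"
  assumes "\<And>x. x \<in> S \<Longrightarrow> \<exists>N. open N \<and> x \<in> N \<and> negligible (f ` (S \<inter> N))"
  shows "negligible (f ` S)"
proof -
  define F where "F = {N. open N \<and> negligible (f ` (S \<inter> N))}"
  obtain F' where F': "F' \<subseteq> F" "countable F'" "\<Union>F' = \<Union>F"
    using Lindelof_openin[of F UNIV] by (auto simp: F_def)
  have "f ` S \<subseteq> (\<Union>N\<in>F'. f ` (S \<inter> N))"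
  proof
    fix y assume "y \<in> f ` S"
    then obtain x where x: "x \<in> S" "y = f x" by blast
    then have "x \<in> \<Union>F" using assms by (auto simp: F_def)
    then show "y \<in> (\<Union>N\<in>F'. f ` (S \<inter> N))" using F'(3) x by blast
  qed
  moreover have "negligible (\<Union>N\<in>F'. f ` (S \<inter> N))"
    using F'(1,2) by (intro negligible_countable_Union) (auto simp: F_def)
  ultimately show ?thesis using negligible_subset by blast
qed

text \<open>At a point of \<open>S\<close> the zeros of \<open>q\<close> are charted by a kernel
  whose dimension, by \<open>dim\<close>, is at most that of the parameters. The projection to the
  parameters, read in this chart, is an equidimensional map, and partial non-surjectivity of
  \<open>q'\<close> makes it critical.\<close>

theorem parametric_transversality:
  fixes q :: "'x::euclidean_space \<times> 'e::euclidean_space \<Rightarrow> 'w::euclidean_space"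
  assumes der: "\<And>y. (q has_derivative q' y) (at y)"
    and cont: "\<And>v. continuous_on UNIV (\<lambda>y. q' y v)"
    and zero: "\<And>y. y \<in> S \<Longrightarrow> q y = 0"
    and surj: "\<And>y. y \<in> S \<Longrightarrow> surj (q' y)"
    and crit: "\<And>y. y \<in> S \<Longrightarrow> \<not> surj (\<lambda>v. q' y (v, 0))"
    and dim: "DIM('x) \<le> DIM('w)"
  shows "negligible (snd ` S)"
proof (rule negligible_image_locally)
  have lin: "linear (q' y)" for y
    using der has_derivative_linear by blast
  fix y0 assume y0: "y0 \<in> S"
  define K where "K = {v. q' y0 v = 0}"
  have "subspace K" "dim K \<le> DIM('e)"
    using dim_kernel_surj[OF lin surj[OF y0]] dim linear_subspace_kernel[OF lin]
    by (auto simp: K_def)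
  then obtain L :: "'e \<Rightarrow> 'x \<times> 'e" where L: "linear L" "range L = K"
    by (rule linear_with_range)
  show "\<exists>N. open N \<and> y0 \<in> N \<and> negligible (snd ` (S \<inter> N))"
  proof (rule level_set_chart[OF der cont surj[OF y0]])
    fix \<Phi> \<Phi>' N M g g'
    assume c: "open N" "y0 \<in> N" "open M" "homeomorphism N M \<Phi> g"
       "\<And>x. (\<Phi> has_derivative \<Phi>' x) (at x)" "\<And>v. continuous_on UNIV (\<lambda>x. \<Phi>' x v)"
       "\<And>v. \<Phi>' y0 v = v"
       "\<And>x. q' y0 (\<Phi> x) = q x" "\<And>x v. q' y0 (\<Phi>' x v) = q' x v"
       "\<And>y. y \<in> M \<Longrightarrow> (g has_derivative g' y) (at y)"
       "\<And>y v. y \<in> M \<Longrightarrow> \<Phi>' (g y) (g' y v) = v"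
       "\<And>v. continuous_on M (\<lambda>y. g' y v)"
    define T where "T = {e. L e \<in> M \<and> g (L e) \<in> S}"
    have "snd ` (S \<inter> N) \<subseteq> (\<lambda>e. snd (g (L e))) ` T"
    proof (safe)
      fix x e assume xe: "(x, e) \<in> S" "(x, e) \<in> N"
      then have "\<Phi> (x, e) \<in> K" using c(8) zero by (simp add: K_def)
      then obtain e' where e': "L e' = \<Phi> (x, e)" using L(2) by (metis rangeE)
      have "g (L e') = (x, e)" "L e' \<in> M"
        using c(4) xe e' by (auto simp: homeomorphism_def)
      then show "snd (x, e) \<in> (\<lambda>e. snd (g (L e))) ` T"
        using xe by (intro image_eqI[of _ _ e']) (auto simp: T_def)
    qed
    moreover have "negligible ((\<lambda>e. snd (g (L e))) ` T)"
    proof (rule negligible_critical_values)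
      fix e assume "e \<in> T"
      then have e: "L e \<in> M" "g (L e) \<in> S" by (auto simp: T_def)
      have "((\<lambda>e. g (L e)) has_derivative (\<lambda>v. g' (L e) (L v))) (at e)"
        by (rule has_derivative_compose[OF linear_imp_has_derivative[OF L(1)] c(10)[OF e(1)]])
      then show "((\<lambda>e. snd (g (L e))) has_derivative (\<lambda>v. snd (g' (L e) (L v)))) (at e within T)"
        using has_derivative_snd has_derivative_at_withinI by blast
      show "\<not> surj (\<lambda>v. snd (g' (L e) (L v)))"
      proof
        assume s: "surj (\<lambda>v. snd (g' (L e) (L v)))"
        let ?y = "g (L e)"
        \<comment> \<open>A preimage \<open>xe\<close> of \<open>w\<close> may be changed by vectors
          tangent to the zero set. If these project onto all parameter directions, one of them
          removes the parameter component of \<open>xe\<close>.\<close>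
        have "surj (\<lambda>v. q' ?y (v, 0))"
          unfolding surj_def
        proof
          fix w
          obtain xe where xe: "q' ?y xe = w" using surj[OF e(2)] by (metis surjD)
          obtain v where v: "snd xe = snd (g' (L e) (L v))" using surjD[OF s] by blast
          have "q' ?y (g' (L e) (L v)) = q' y0 (L v)"
            using c(9)[of ?y] c(11)[OF e(1)] by metis
          also have "L v \<in> K" using L(2) by blast
          then have "q' y0 (L v) = 0" by (simp add: K_def)
          finally have "q' ?y (xe - g' (L e) (L v)) = w"
            using xe by (simp add: linear_diff[OF lin])
          moreover have "xe - g' (L e) (L v) = (fst (xe - g' (L e) (L v)), 0)"
            using v by (simp add: prod_eq_iff)
          ultimately show "\<exists>u. w = q' ?y (u, 0)" by metis
        qed
        then show False using crit[OF e(2)] by simp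
      qed
    qed
    ultimately have "negligible (snd ` (S \<inter> N))" using negligible_subset by blast
    then show "\<exists>N. open N \<and> y0 \<in> N \<and> negligible (snd ` (S \<inter> N))" using c by blast
  qed
qed

lemma AE_lborel_not_in_negligible:
  assumes "negligible (N :: 'a::euclidean_space set)"
  shows "AE x in lborel. x \<notin> N"
  using AE_not_in[of N lebesgue] assms AE_completion_iff[of "\<lambda>x. x \<notin> N" lborel]
  by (simp add: negligible_iff_null_sets)

subsection \<open>Unit speed curves in level sets\<close>

text \<open>Appending \<open>x \<bullet> v\<close> to \<open>f\<close> gives a surjection between
  spaces of equal dimension, hence one with trivial kernel, and
  \<open>w - (w \<bullet> v) *\<^sub>R v\<close> lies in that kernel.\<close>

lemma surj_kernel_line:
  fixes f :: "'a::euclidean_space \<Rightarrow> 'b::euclidean_space"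
  assumes f: "linear f" "surj f" and dim: "DIM('a) = DIM('b) + 1"
    and v: "f v = 0" "norm v = 1" and w: "f w = 0"
  shows "w = (w \<bullet> v) *\<^sub>R v"
proof -
  define F where "F x = (f x, x \<bullet> v)" for x
  have vv: "v \<bullet> v = 1" using v(2) by (simp add: dot_square_norm)
  have "linear F"
    unfolding F_def using f(1)
    by (auto intro!: linearI simp: linear_add linear_scale inner_add_left)
  moreover have "surj F"
    unfolding surj_def
  proof (safe)
    fix y and r :: real
    obtain x where x: "f x = y" using f(2) by (metis surjD)
    have "F (x + (r - x \<bullet> v) *\<^sub>R v) = (y, r)"
      using v(1) x by (simp add: F_def linear_add[OF f(1)] linear_scale[OF f(1)] inner_add_left vv)
    then show "\<exists>x. (y, r) = F x" by metis
  qed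
  ultimately have "dim {x. F x = 0} = 0"
    using dim_kernel_surj[of F] dim by simp
  then have "{x. F x = 0} \<subseteq> {0}" by simp
  moreover have "F (w - (w \<bullet> v) *\<^sub>R v) = 0"
    using v(1) w by (simp add: F_def linear_diff[OF f(1)] linear_scale[OF f(1)] inner_diff_left vv prod_eq_iff)
  ultimately show ?thesis by force
qed

lemma continuous_on_near:
  assumes "continuous_on I f" "s0 \<in> I" "open W" "f s0 \<in> W"
  obtains e where "e > 0" "\<And>s::real. s \<in> I \<Longrightarrow> \<bar>s - s0\<bar> < e \<Longrightarrow> f s \<in> W"
proof -
  obtain A where A: "open A" "A \<inter> I = f -` W \<inter> I"
    using assms(1,3) unfolding continuous_on_open_invariant by blast
  then obtain e where "e > 0" "ball s0 e \<subseteq> A"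
    using assms(2,4) openE[of A s0] by blast
  then show ?thesis
    using A by (intro that[of e]) (auto simp: dist_real_def abs_minus_commute subset_iff)
qed

text \<open>Unlike \<open>solution_curve\<close> this prescribes neither the starting parameter nor
  a nondegenerate interval, so restrictions, shifts and reversals stay in the class. The velocity is
  an argument because uniqueness refers to its value at a point.\<close>

definition unit_speed_curve :: "'a::real_normed_vector set \<Rightarrow> real set \<Rightarrow> (real \<Rightarrow> 'a) \<Rightarrow> (real \<Rightarrow> 'a) \<Rightarrow> bool" where
  "unit_speed_curve Z I \<gamma> \<gamma>' \<longleftrightarrow> is_interval I \<and> \<gamma> ` I \<subseteq> Z \<and> continuous_on I \<gamma>' \<and>
     (\<forall>s\<in>I. (\<gamma> has_vector_derivative \<gamma>' s) (at s within I) \<and> norm (\<gamma>' s) = 1)"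

lemma unit_speed_curve_continuous:
  assumes "unit_speed_curve Z I \<gamma> \<gamma>'"
  shows "continuous_on I \<gamma>" "continuous_on I \<gamma>'"
  using assms continuous_on_vector_derivative[of I \<gamma> \<gamma>'] by (auto simp: unit_speed_curve_def)

lemma at_within_interval_nontrivial:
  fixes I :: "real set"
  assumes "is_interval I" "s \<in> I" "I \<noteq> {s0}" "s0 \<in> I"
  shows "at s within I \<noteq> bot"
proof -
  have "\<not> (\<exists>a. I = {a})" using assms(3,4) by auto
  then have "s islimpt I"
    using assms(1,2) connected_imp_perfect is_interval_connected by blast
  then show ?thesis by (simp add: trivial_limit_within)
qed

text \<open>The composite of \<open>q\<close> and \<gamma> is constant. The condition
  \<open>I \<noteq> {s}\<close> excludes the one-point interval, on which a derivative within
  \<open>I\<close> is arbitrary.\<close>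

lemma unit_speed_curve_kernel:
  fixes q :: "'a::real_normed_vector \<Rightarrow> 'b::real_normed_vector"
  assumes der: "\<And>x. (q has_derivative q' x) (at x)"
    and zero: "\<And>x. x \<in> Z \<Longrightarrow> q x = 0"
    and \<gamma>: "unit_speed_curve Z I \<gamma> \<gamma>'" "s \<in> I" "I \<noteq> {s}"
  shows "q' (\<gamma> s) (\<gamma>' s) = 0"
proof -
  have "(q \<circ> \<gamma> has_vector_derivative q' (\<gamma> s) (\<gamma>' s)) (at s within I)"
    using \<gamma> unfolding unit_speed_curve_def
    by (intro vector_derivative_diff_chain_within has_derivative_at_withinI[OF der]) auto
  moreover have "(q \<circ> \<gamma> has_vector_derivative 0) (at s within I)"
    by (rule has_vector_derivative_transform[OF \<gamma>(2), of _ "\<lambda>_. 0"])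
       (use \<gamma>(1) zero in \<open>auto simp: unit_speed_curve_def image_subset_iff\<close>)
  moreover have "at s within I \<noteq> bot"
    using \<gamma> by (intro at_within_interval_nontrivial) (auto simp: unit_speed_curve_def)
  ultimately show ?thesis
    using vector_derivative_unique_within by blast
qed

text \<open>In the chart the level set becomes part of a line, so a curve in it is given by one real
  coordinate. Unit speed and the direction at \<open>s0\<close> fix arc length as a function of this
  coordinate, and arc length is strictly monotone, so the coordinate is determined by the
  parameter.\<close>

lemma unit_speed_curve_locally_unique:
  fixes q :: "'a::euclidean_space \<Rightarrow> 'b::euclidean_space"
  assumes der: "\<And>x. (q has_derivative q' x) (at x)"
    and cont: "\<And>v. continuous_on UNIV (\<lambda>x. q' x v)"
    and Z: "\<And>x. x \<in> Z \<Longrightarrow> q x = 0" "\<And>x. x \<in> Z \<Longrightarrow> surj (q' x)"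
    and dim: "DIM('a) = DIM('b) + 1"
    and \<gamma>: "unit_speed_curve Z I \<gamma> \<gamma>'" and \<delta>: "unit_speed_curve Z I \<delta> \<delta>'"
    and s0: "s0 \<in> I" "I \<noteq> {s0}" and eq: "\<gamma> s0 = \<delta> s0" "\<gamma>' s0 = \<delta>' s0"
  shows "\<exists>e>0. \<forall>s\<in>I. \<bar>s - s0\<bar> < e \<longrightarrow> \<gamma> s = \<delta> s"
proof -
  define x0 v where "x0 = \<gamma> s0" and "v = \<gamma>' s0"
  have lin: "linear (q' x)" for x
    using der has_derivative_linear by blast
  have x0: "x0 \<in> Z" and v1: "norm v = 1"
    using \<gamma> s0 by (auto simp: unit_speed_curve_def x0_def v_def)
  have vv: "v \<bullet> v = 1" using v1 by (simp add: dot_square_norm)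
  have int: "is_interval I" using \<gamma> by (simp add: unit_speed_curve_def)
  have nb: "at s within I \<noteq> bot" if "s \<in> I" for s
    using at_within_interval_nontrivial[OF int that s0(2,1)] .
  have qv: "q' x0 v = 0"
    unfolding x0_def v_def by (rule unit_speed_curve_kernel[OF der Z(1) \<gamma> s0])
  have ker: "w = (w \<bullet> v) *\<^sub>R v" if "q' x0 w = 0" for w
    using surj_kernel_line[OF lin Z(2)[OF x0] dim qv v1 that] .
  show ?thesis
  proof (rule level_set_chart[OF der cont Z(2)[OF x0]])
    fix \<Phi> \<Phi>' N M g g'
    assume c: "open N" "x0 \<in> N" "open M" "homeomorphism N M \<Phi> g"
     "\<And>x. (\<Phi> has_derivative \<Phi>' x) (at x)" "\<And>v. continuous_on UNIV (\<lambda>x. \<Phi>' x v)"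
     "\<And>v. \<Phi>' x0 v = v"
     "\<And>x. q' x0 (\<Phi> x) = q x" "\<And>x v. q' x0 (\<Phi>' x v) = q' x v"
     "\<And>y. y \<in> M \<Longrightarrow> (g has_derivative g' y) (at y)"
     "\<And>y v. y \<in> M \<Longrightarrow> \<Phi>' (g y) (g' y v) = v"
     "\<And>v. continuous_on M (\<lambda>y. g' y v)"
    define u0 where "u0 = \<Phi> x0 \<bullet> v"
    have line: "\<Phi> x = (\<Phi> x \<bullet> v) *\<^sub>R v" if "x \<in> Z" for x
      using ker[of "\<Phi> x"] Z(1)[OF that] c(8) by simp
    have "u0 *\<^sub>R v \<in> M"
      using line[OF x0] c(2,4) by (auto simp: u0_def homeomorphism_def)
    moreover have "open ((\<lambda>u. u *\<^sub>R v) -` M)"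
      using c(3) by (intro open_vimage continuous_intros)
    ultimately obtain r where r: "r > 0" "cball u0 r \<subseteq> (\<lambda>u. u *\<^sub>R v) -` M"
      by (metis open_contains_cball vimageI)
    define R where "R = {u0 - r..u0 + r}"
    have RM: "u *\<^sub>R v \<in> M" if "u \<in> R" for u
      using r(2) that by (auto simp: R_def subset_iff dist_real_def)
    define k where "k u = norm (g' (u *\<^sub>R v) v)" for u
    have kpos: "k u > 0" if "u \<in> R" for u
    proof -
      have "\<Phi>' (g (u *\<^sub>R v)) 0 = 0"
        using has_derivative_linear[OF c(5)] linear_0 by blast
      then have "g' (u *\<^sub>R v) v \<noteq> 0"
        using c(11)[OF RM[OF that], of v] v1 by auto
      then show ?thesis by (simp add: k_def)
    qed
    have "continuous_on R k"
      unfolding k_def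
      by (intro continuous_intros continuous_on_compose2[OF c(12)]) (use RM in auto)
    \<comment> \<open>\<open>L\<close> is arc length along the level set as a function of the
      coordinate on the line.\<close>
    then obtain L where L: "\<And>u. u \<in> R \<Longrightarrow> (L has_vector_derivative k u) (at u within R)"
      unfolding R_def using antiderivative_continuous by blast
    have L_less: "L u1 < L u2" if "u1 \<in> R" "u2 \<in> R" "u1 < u2" for u1 u2
    proof -
      have sub: "{u1..u2} \<subseteq> R" using that by (auto simp: R_def)
      have "\<exists>x\<in>{u1..u2}. L u2 - L u1 = (u2 - u1) *\<^sub>R k x"
        using that(3) sub
        by (intro mvt_very_simple has_vector_derivative_within_subset[OF L, unfolded has_vector_derivative_def]) auto
      then show ?thesis using kpos sub that(3) by (smt (verit) mult_pos_pos real_scaleR_def subsetD)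
    qed
    have key: "\<exists>e>0. \<forall>s\<in>I. \<bar>s - s0\<bar> < e \<longrightarrow>
        (\<exists>u\<in>R. \<alpha> s = g (u *\<^sub>R v) \<and> L u - s = L u0 - s0)"
      if \<alpha>: "unit_speed_curve Z I \<alpha> \<alpha>'" "\<alpha> s0 = x0" "\<alpha>' s0 = v" for \<alpha> \<alpha>'
    proof -
      define a where "a s = \<Phi> (\<alpha> s) \<bullet> v" for s
      define a' where "a' s = \<Phi>' (\<alpha> s) (\<alpha>' s) \<bullet> v" for s
      have d\<alpha>: "(\<alpha> has_vector_derivative \<alpha>' s) (at s within I)" "norm (\<alpha>' s) = 1" "\<alpha> s \<in> Z"
        if "s \<in> I" for s
        using \<alpha>(1) that by (auto simp: unit_speed_curve_def)
      have cont\<alpha>: "continuous_on I \<alpha>" "continuous_on I \<alpha>'"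
        using unit_speed_curve_continuous[OF \<alpha>(1)] .
      have da: "(a has_vector_derivative a' s) (at s within I)" if "s \<in> I" for s
        unfolding a_def a'_def
        using vector_derivative_diff_chain_within[OF d\<alpha>(1)[OF that]
            has_derivative_inner_left[OF has_derivative_at_withinI[OF c(5)], of v]]
        by (simp add: o_def)
      \<comment> \<open>Only the continuity of \<open>\<Phi>' x b\<close> for fixed \<open>b\<close>
        is available; expanding in the basis handles the case where the point and the vector both
        vary.\<close>
      have expand: "\<Phi>' x w = (\<Sum>b\<in>Basis. (w \<bullet> b) *\<^sub>R \<Phi>' x b)" for x w
      proof -
        have l: "linear (\<Phi>' x)" using has_derivative_linear[OF c(5)] .
        have "\<Phi>' x w = \<Phi>' x (\<Sum>b\<in>Basis. (w \<bullet> b) *\<^sub>R b)"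
          by (simp only: euclidean_representation)
        then show ?thesis by (simp only: linear_sum[OF l] linear_scale[OF l])
      qed
      have "a' s = (\<Sum>b\<in>Basis. (\<alpha>' s \<bullet> b) *\<^sub>R \<Phi>' (\<alpha> s) b) \<bullet> v" for s
        unfolding a'_def by (subst expand) (rule refl)
      moreover have "continuous_on I (\<lambda>s. (\<Sum>b\<in>Basis. (\<alpha>' s \<bullet> b) *\<^sub>R \<Phi>' (\<alpha> s) b) \<bullet> v)"
        by (intro continuous_intros cont\<alpha> continuous_on_compose2[OF c(6) cont\<alpha>(1)]) auto
      ultimately have conta': "continuous_on I a'" by simp
      have conta: "continuous_on I a"
        using da continuous_on_vector_derivative by blast
      \<comment> \<open>At \<open>s0\<close> the coordinate has speed
        \<open>v \<bullet> v = 1\<close>; its positive sign nearby allows the norm to be removed in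
        \<open>speed\<close>.\<close>
      obtain e1 where e1: "e1 > 0" "\<And>s. s \<in> I \<Longrightarrow> \<bar>s - s0\<bar> < e1 \<Longrightarrow> a' s \<in> {0<..}"
        by (rule continuous_on_near[OF conta' s0(1) open_greaterThan[of 0]])
           (use \<alpha> c(7) vv in \<open>auto simp: a'_def\<close>)
      obtain e2 where e2: "e2 > 0" "\<And>s. s \<in> I \<Longrightarrow> \<bar>s - s0\<bar> < e2 \<Longrightarrow> a s \<in> {u0 - r<..<u0 + r}"
        by (rule continuous_on_near[OF conta s0(1) open_greaterThanLessThan[of "u0 - r" "u0 + r"]])
           (use \<alpha> r in \<open>auto simp: a_def u0_def\<close>)
      obtain e3 where e3: "e3 > 0" "\<And>s. s \<in> I \<Longrightarrow> \<bar>s - s0\<bar> < e3 \<Longrightarrow> \<alpha> s \<in> N"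
        by (rule continuous_on_near[OF cont\<alpha>(1) s0(1) c(1)]) (use \<alpha> c in auto)
      define e where "e = min e1 (min e2 e3)"
      define J where "J = I \<inter> ball s0 e"
      have J: "s \<in> I" "a' s > 0" "a s \<in> R" "\<alpha> s \<in> N" if "s \<in> J" for s
        using that e1(2)[of s] e2(2)[of s] e3(2)[of s]
        by (auto simp: J_def e_def dist_real_def R_def abs_minus_commute)
      have atJ: "at s within J = at s within I" if "s \<in> J" for s
        using that by (intro at_within_nhd[of s "ball s0 e"]) (auto simp: J_def)
      have \<alpha>g: "\<alpha> s = g (a s *\<^sub>R v)" if "s \<in> J" for s
      proof -
        have "\<alpha> s = g (\<Phi> (\<alpha> s))" using c(4) J(4)[OF that] by (simp add: homeomorphism_def)
        then show ?thesis using line[OF d\<alpha>(3)[OF J(1)[OF that]]] by (simp add: a_def)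
      qed
      have speed: "a' s * k (a s) = 1" if s: "s \<in> J" for s
      proof -
        have 1: "((\<lambda>s. a s *\<^sub>R v) has_vector_derivative a' s *\<^sub>R v) (at s within J)"
          using has_vector_derivative_scaleR[OF da[OF J(1)[OF s],
              folded has_real_derivative_iff_has_vector_derivative] has_vector_derivative_const[of v]]
            atJ[OF s] by simp
        have "(g \<circ> (\<lambda>s. a s *\<^sub>R v) has_vector_derivative g' (a s *\<^sub>R v) (a' s *\<^sub>R v)) (at s within J)"
          by (rule vector_derivative_diff_chain_within[OF 1 has_derivative_at_withinI[OF c(10)[OF RM[OF J(3)[OF s]]]]])
        then have "(\<alpha> has_vector_derivative g' (a s *\<^sub>R v) (a' s *\<^sub>R v)) (at s within J)"
          by (rule has_vector_derivative_transform[OF s, rotated]) (simp add: \<alpha>g)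
        then have "\<alpha>' s = g' (a s *\<^sub>R v) (a' s *\<^sub>R v)"
          using vector_derivative_unique_within[OF nb d\<alpha>(1)] J(1)[OF s] atJ[OF s] by metis
        also have "\<dots> = a' s *\<^sub>R g' (a s *\<^sub>R v) v"
          using linear_scale[OF has_derivative_linear[OF c(10)[OF RM[OF J(3)[OF s]]]]] by blast
        finally have "norm (\<alpha>' s) = a' s * k (a s)" using J(2)[OF s] by (simp add: k_def)
        then show ?thesis using d\<alpha>(2) J(1)[OF s] by simp
      qed
      have dL: "((\<lambda>s. L (a s) - s) has_vector_derivative 0) (at s within J)" if s: "s \<in> J" for s
      proof -
        have "(L has_vector_derivative k (a s)) (at (a s) within a ` J)"
          using has_vector_derivative_within_subset[OF L[OF J(3)[OF s]]] J(3) by blast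
        then have "(L \<circ> a has_vector_derivative a' s *\<^sub>R k (a s)) (at s within J)"
          using da[OF J(1)[OF s]] atJ[OF s] by (intro vector_diff_chain_within) auto
        then have "(L \<circ> a has_vector_derivative 1) (at s within J)"
          using speed[OF s] by simp
        from has_vector_derivative_diff[OF this has_vector_derivative_id]
        show ?thesis by (simp add: o_def)
      qed
      have "convex J" unfolding J_def by (rule convex_Int[OF is_interval_convex[OF int] convex_ball])
      then obtain C where C: "\<And>s. s \<in> J \<Longrightarrow> L (a s) - s = C"
        using has_vector_derivative_zero_constant[OF _ dL] by blast
      have s0J: "s0 \<in> J" using s0 e1 e2 e3 by (simp add: J_def e_def)
      have "a s0 = u0" using \<alpha>(2) by (simp add: a_def u0_def)
      then have "L (a s) - s = L u0 - s0" if "s \<in> J" for s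
        using C[OF that] C[OF s0J] by simp
      then show ?thesis
        using \<alpha>g J(3) e1(1) e2(1) e3(1)
        by (intro exI[of _ e]) (auto simp: J_def e_def dist_real_def abs_minus_commute)
    qed
    obtain e1 where e1: "e1 > 0" "\<And>s. s \<in> I \<Longrightarrow> \<bar>s - s0\<bar> < e1 \<Longrightarrow>
        (\<exists>u\<in>R. \<gamma> s = g (u *\<^sub>R v) \<and> L u - s = L u0 - s0)"
      using key[OF \<gamma>] by (auto simp: x0_def v_def)
    obtain e2 where e2: "e2 > 0" "\<And>s. s \<in> I \<Longrightarrow> \<bar>s - s0\<bar> < e2 \<Longrightarrow>
        (\<exists>u\<in>R. \<delta> s = g (u *\<^sub>R v) \<and> L u - s = L u0 - s0)"
      using key[OF \<delta>] eq by (auto simp: x0_def v_def)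
    have "\<gamma> s = \<delta> s" if s: "s \<in> I" "\<bar>s - s0\<bar> < min e1 e2" for s
    proof -
      obtain u1 u2 where "u1 \<in> R" "\<gamma> s = g (u1 *\<^sub>R v)" "u2 \<in> R" "\<delta> s = g (u2 *\<^sub>R v)" "L u1 = L u2"
        using e1(2)[OF s(1)] e2(2)[OF s(1)] s(2) by force
      then show ?thesis using L_less by (metis less_irrefl linorder_neqE_linordered_idom)
    qed
    then show ?thesis using e1(1) e2(1) by (intro exI[of _ "min e1 e2"]) auto
  qed
qed

text \<open>The parameters where both position and velocity agree form a clopen subset of the
  interval. The velocity has to be included for \<open>unit_speed_curve_locally_unique\<close> to
  apply again at each such parameter.\<close>

lemma unit_speed_curve_unique:
  fixes q :: "'a::euclidean_space \<Rightarrow> 'b::euclidean_space"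
  assumes der: "\<And>x. (q has_derivative q' x) (at x)"
    and cont: "\<And>v. continuous_on UNIV (\<lambda>x. q' x v)"
    and Z: "\<And>x. x \<in> Z \<Longrightarrow> q x = 0" "\<And>x. x \<in> Z \<Longrightarrow> surj (q' x)"
    and dim: "DIM('a) = DIM('b) + 1"
    and \<gamma>: "unit_speed_curve Z I \<gamma> \<gamma>'" and \<delta>: "unit_speed_curve Z I \<delta> \<delta>'"
    and s0: "s0 \<in> I" and eq: "\<gamma> s0 = \<delta> s0" "\<gamma>' s0 = \<delta>' s0" and s: "s \<in> I"
  shows "\<gamma> s = \<delta> s"
proof (cases "I = {s0}")
  case True
  then show ?thesis using s eq by simp
next
  case False
  have int: "is_interval I" using \<gamma> by (simp add: unit_speed_curve_def)
  define A where "A = {s \<in> I. (\<gamma> s - \<delta> s, \<gamma>' s - \<delta>' s) = 0}"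
  have cg: "continuous_on I \<gamma>" "continuous_on I \<gamma>'" "continuous_on I \<delta>" "continuous_on I \<delta>'"
    using unit_speed_curve_continuous[OF \<gamma>] unit_speed_curve_continuous[OF \<delta>] .
  have "closedin (top_of_set I) A"
    unfolding A_def by (intro continuous_closedin_preimage_constant continuous_intros cg)
  moreover have "openin (top_of_set I) A"
    unfolding openin_contains_ball
  proof (intro conjI ballI)
    show "A \<subseteq> I" by (auto simp: A_def)
    fix t assume "t \<in> A"
    then have t: "t \<in> I" "\<gamma> t = \<delta> t" "\<gamma>' t = \<delta>' t" by (auto simp: A_def zero_prod_def)
    have "I \<noteq> {t}" using False s0 by auto
    then obtain e where e: "e > 0" "\<And>s. s \<in> I \<Longrightarrow> \<bar>s - t\<bar> < e \<Longrightarrow> \<gamma> s = \<delta> s"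
      using unit_speed_curve_locally_unique[OF der cont Z dim \<gamma> \<delta> t(1) _ t(2,3)] by blast
    have "\<gamma>' s = \<delta>' s" if s: "s \<in> I" "\<bar>s - t\<bar> < e" for s
    proof -
      have "(\<gamma> has_vector_derivative \<gamma>' s) (at s within I)"
        using \<gamma> s by (simp add: unit_speed_curve_def)
      then have "(\<delta> has_vector_derivative \<gamma>' s) (at s within I)"
      proof (rule has_vector_derivative_transform_within)
        show "0 < e - \<bar>s - t\<bar>" using s by simp
        show "\<gamma> r = \<delta> r" if "r \<in> I" "dist r s < e - \<bar>s - t\<bar>" for r
          using that by (intro e(2)) (auto simp: dist_real_def)
      qed (use s in auto)
      moreover have "(\<delta> has_vector_derivative \<delta>' s) (at s within I)"
        using \<delta> s by (simp add: unit_speed_curve_def)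
      ultimately show ?thesis
        using vector_derivative_unique_within at_within_interval_nontrivial[OF int s(1) False s0] by blast
    qed
    then show "\<exists>e>0. ball t e \<inter> I \<subseteq> A"
      using e by (intro exI[of _ e]) (auto simp: A_def dist_real_def abs_minus_commute zero_prod_def)
  qed
  moreover have "s0 \<in> A" using s0 eq by (simp add: A_def zero_prod_def)
  moreover have "connected I" using int by (simp add: is_interval_connected)
  ultimately have "A = I"
    unfolding connected_clopen by blast
  then show ?thesis using s by (auto simp: A_def zero_prod_def)
qed

section \<open>One-sided derivatives, reparametrization and joining of curves\<close>

lemma deriv_nonneg_right:
  fixes f :: "real \<Rightarrow> real"
  assumes "(f has_real_derivative D) (at s within {s..t})" "s < t" "\<And>y. y \<in> {s..t} \<Longrightarrow> f s \<le> f y"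
  shows "D \<ge> 0"
proof (rule tendsto_lowerbound)
  show "((\<lambda>y. (f y - f s) / (y - s)) \<longlongrightarrow> D) (at s within {s..t})"
    using assms(1) by (simp add: has_field_derivative_iff)
  show "\<forall>\<^sub>F y in at s within {s..t}. 0 \<le> (f y - f s) / (y - s)"
    unfolding eventually_at_filter using assms(3) by (intro always_eventually) auto
  show "at s within {s..t} \<noteq> bot"
    using assms(2) by (intro at_within_interval_nontrivial[of _ _ s]) (auto simp: is_interval_cc)
qed

lemma deriv_nonpos_left:
  fixes f :: "real \<Rightarrow> real"
  assumes "(f has_real_derivative D) (at s within {t..s})" "t < s" "\<And>y. y \<in> {t..s} \<Longrightarrow> f s \<le> f y"
  shows "D \<le> 0"
proof (rule tendsto_upperbound)
  show "((\<lambda>y. (f y - f s) / (y - s)) \<longlongrightarrow> D) (at s within {t..s})"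
    using assms(1) by (simp add: has_field_derivative_iff)
  show "\<forall>\<^sub>F y in at s within {t..s}. (f y - f s) / (y - s) \<le> 0"
    unfolding eventually_at_filter using assms(3)
    by (intro always_eventually) (auto intro!: divide_nonneg_nonpos)
  show "at s within {t..s} \<noteq> bot"
    using assms(2) by (intro at_within_interval_nontrivial[of _ _ s]) (auto simp: is_interval_cc)
qed

lemma unit_speed_curve_affine:
  assumes \<gamma>: "unit_speed_curve Z I \<gamma> \<gamma>'" and e: "\<bar>e\<bar> = 1" and J: "is_interval J" "\<And>s. s \<in> J \<Longrightarrow> c + e * s \<in> I"
  shows "unit_speed_curve Z J (\<lambda>s. \<gamma> (c + e * s)) (\<lambda>s. e *\<^sub>R \<gamma>' (c + e * s))"
  unfolding unit_speed_curve_def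
proof (intro conjI ballI)
  show "(\<lambda>s. \<gamma> (c + e * s)) ` J \<subseteq> Z" using \<gamma> J by (auto simp: unit_speed_curve_def)
  show "continuous_on J (\<lambda>s. e *\<^sub>R \<gamma>' (c + e * s))"
    by (intro continuous_intros continuous_on_compose2[OF unit_speed_curve_continuous(2)[OF \<gamma>]]) (use J in auto)
  fix s assume s: "s \<in> J"
  have 1: "((\<lambda>s. c + e * s) has_vector_derivative e) (at s within J)"
    by (auto intro!: derivative_eq_intros simp: has_real_derivative_iff_has_vector_derivative[symmetric])
  have "(\<gamma> has_vector_derivative \<gamma>' (c + e * s)) (at (c + e * s) within (\<lambda>s. c + e * s) ` J)"
    by (rule has_vector_derivative_within_subset[of _ _ _ I]) (use \<gamma> J s in \<open>auto simp: unit_speed_curve_def\<close>)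
  from vector_diff_chain_within[OF 1 this]
  show "((\<lambda>s. \<gamma> (c + e * s)) has_vector_derivative e *\<^sub>R \<gamma>' (c + e * s)) (at s within J)"
    by (simp add: o_def)
  show "norm (e *\<^sub>R \<gamma>' (c + e * s)) = 1"
    using \<gamma> J(2)[OF s] e by (auto simp: unit_speed_curve_def)
qed (rule J)

lemma unit_speed_curve_subset:
  assumes "unit_speed_curve Z I \<gamma> \<gamma>'" "is_interval J" "J \<subseteq> I"
  shows "unit_speed_curve Z J \<gamma> \<gamma>'"
  using unit_speed_curve_affine[OF assms(1), of 1 J 0] assms(2,3) by auto

lemma unit_speed_curve_join:
  fixes l :: real
  assumes \<gamma>: "unit_speed_curve Z {0..s0} \<gamma> \<gamma>'" and \<delta>: "unit_speed_curve Z {s0..l} \<delta> \<delta>'"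
    and eq: "\<gamma> s0 = \<delta> s0" "\<gamma>' s0 = \<delta>' s0" and s0: "0 \<le> s0" "s0 \<le> l"
  shows "unit_speed_curve Z {0..l} (\<lambda>s. if s \<in> {0..s0} then \<gamma> s else \<delta> s)
    (\<lambda>s. if s \<in> {0..s0} then \<gamma>' s else \<delta>' s)"
  unfolding unit_speed_curve_def
proof (intro conjI ballI)
  have un: "{0..l} = {0..s0} \<union> {s0..l}" using s0 by auto
  have cl: "closure {0..s0} \<inter> closure {s0..l} = {s0}" using s0 by auto
  show "(\<lambda>s. if s \<in> {0..s0} then \<gamma> s else \<delta> s) ` {0..l} \<subseteq> Z"
    using \<gamma> \<delta> un by (auto simp: unit_speed_curve_def)
  show "continuous_on {0..l} (\<lambda>s. if s \<in> {0..s0} then \<gamma>' s else \<delta>' s)"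
    unfolding un
    by (rule continuous_on_cases) (use eq unit_speed_curve_continuous[OF \<gamma>] unit_speed_curve_continuous[OF \<delta>] in auto)
  fix s assume s: "s \<in> {0..l}"
  have un': "{0..s0} \<union> {s0} = {0..s0}" "{s0..l} \<union> {s0} = {s0..l}" using s0 by auto
  show "((\<lambda>s. if s \<in> {0..s0} then \<gamma> s else \<delta> s) has_vector_derivative
      (if s \<in> {0..s0} then \<gamma>' s else \<delta>' s)) (at s within {0..l})"
  proof (rule has_vector_derivative_If_within_closures[OF _ un])
    show "s \<in> {0..s0} \<union> {s0..l}" using s un by blast
    show "s \<in> {0..s0} \<union> closure {0..s0} \<inter> closure {s0..l} \<Longrightarrow>
        (\<gamma> has_vector_derivative \<gamma>' s) (at s within {0..s0} \<union> closure {0..s0} \<inter> closure {s0..l})"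
      unfolding cl un' using \<gamma> by (simp add: unit_speed_curve_def)
    show "s \<in> {s0..l} \<union> closure {0..s0} \<inter> closure {s0..l} \<Longrightarrow>
        (\<delta> has_vector_derivative \<delta>' s) (at s within {s0..l} \<union> closure {0..s0} \<inter> closure {s0..l})"
      unfolding cl un' using \<delta> by (simp add: unit_speed_curve_def)
    show "s \<in> closure {0..s0} \<Longrightarrow> s \<in> closure {s0..l} \<Longrightarrow> \<gamma> s = \<delta> s"
      "s \<in> closure {0..s0} \<Longrightarrow> s \<in> closure {s0..l} \<Longrightarrow> \<gamma>' s = \<delta>' s"
      using eq by (auto simp: order_antisym)
  qed
  show "norm (if s \<in> {0..s0} then \<gamma>' s else \<delta>' s) = 1"
    using \<gamma> \<delta> s by (auto simp: unit_speed_curve_def)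
qed (simp add: is_interval_cc)

lemma solution_curve_iff:
  "solution_curve Z I \<gamma> \<longleftrightarrow> 0 \<in> I \<and> I \<subseteq> {0..} \<and> I \<noteq> {0} \<and> (\<exists>\<gamma>'. unit_speed_curve Z I \<gamma> \<gamma>')"
  by (auto simp: solution_curve_def unit_speed_curve_def)

section \<open>Curves in a level set bounded by a transversal time slice\<close>

text \<open>\<open>Z\<close> may be only a part of the zero set. The bound
  \<open>0 \<le> \<tau> x\<close> makes the level 0 a boundary of \<open>Z\<close>, while
  \<open>q\<close> itself is differentiable across it; \<open>transversal\<close> says that no
  tangent direction at the boundary lies in it.\<close>

locale transversal_level_set =
  fixes q :: "'a::euclidean_space \<Rightarrow> 'b::euclidean_space" and q' Z and \<tau> :: "'a \<Rightarrow> real"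
  assumes der: "\<And>x. (q has_derivative q' x) (at x)"
    and cont: "\<And>v. continuous_on UNIV (\<lambda>x. q' x v)"
    and zero: "\<And>x. x \<in> Z \<Longrightarrow> q x = 0" and surj: "\<And>x. x \<in> Z \<Longrightarrow> surj (q' x)"
    and dim: "DIM('a) = DIM('b) + 1"
    and linear_\<tau>: "linear \<tau>" and \<tau>_nonneg: "\<And>x. x \<in> Z \<Longrightarrow> 0 \<le> \<tau> x"
    and transversal: "\<And>x v. x \<in> Z \<Longrightarrow> \<tau> x = 0 \<Longrightarrow> q' x v = 0 \<Longrightarrow> \<tau> v = 0 \<Longrightarrow> v = 0"
begin

lemmas curve_unique = unit_speed_curve_unique[OF der cont zero surj dim]

lemma curve_kernel:
  assumes "unit_speed_curve Z I \<gamma> \<gamma>'" "s \<in> I" "I \<noteq> {s}"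
  shows "q' (\<gamma> s) (\<gamma>' s) = 0"
  by (rule unit_speed_curve_kernel[OF der zero assms])

lemma curve_time_derivative:
  assumes "unit_speed_curve Z I \<gamma> \<gamma>'" "s \<in> I" "J \<subseteq> I"
  shows "((\<lambda>s. \<tau> (\<gamma> s)) has_real_derivative \<tau> (\<gamma>' s)) (at s within J)"
proof -
  have "(\<gamma> has_vector_derivative \<gamma>' s) (at s within J)"
    using assms has_vector_derivative_within_subset unfolding unit_speed_curve_def by blast
  from vector_derivative_diff_chain_within[OF this linear_imp_has_derivative[OF linear_\<tau>]]
  show ?thesis by (simp add: has_real_derivative_iff_has_vector_derivative o_def)
qed

lemma curve_time_nonzero:
  assumes \<gamma>: "unit_speed_curve Z I \<gamma> \<gamma>'" "s \<in> I" "I \<noteq> {s}" and t: "\<tau> (\<gamma> s) = 0"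
  shows "\<tau> (\<gamma>' s) \<noteq> 0"
proof
  assume "\<tau> (\<gamma>' s) = 0"
  then have "\<gamma>' s = 0"
    using transversal[of "\<gamma> s" "\<gamma>' s"] curve_kernel[OF \<gamma>] \<gamma> t by (auto simp: unit_speed_curve_def)
  then show False using \<gamma> by (auto simp: unit_speed_curve_def)
qed

text \<open>Time is minimal where it is 0, so the presence of larger parameters makes its derivative
  nonnegative, and transversality excludes zero. Together with \<open>curve_time_left\<close> this
  confines the level 0 to end points of the parameter interval.\<close>

lemma curve_time_right:
  assumes \<gamma>: "unit_speed_curve Z I \<gamma> \<gamma>'" "s \<in> I" and t: "\<tau> (\<gamma> s) = 0" and r: "r \<in> I" "s < r"
  shows "\<tau> (\<gamma>' s) > 0"
proof -
  have sub: "{s..r} \<subseteq> I"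
    using \<gamma> r unfolding unit_speed_curve_def by (meson atLeastAtMost_iff mem_is_interval_1_I subsetI)
  have "\<tau> (\<gamma>' s) \<ge> 0"
    using curve_time_derivative[OF \<gamma> sub] r(2)
    by (rule deriv_nonneg_right) (use \<gamma> sub t \<tau>_nonneg in \<open>auto simp: unit_speed_curve_def image_subset_iff subset_iff\<close>)
  moreover have "I \<noteq> {s}" using r by auto
  ultimately show ?thesis using curve_time_nonzero[OF \<gamma> _ t] by fastforce
qed

lemma curve_time_left:
  assumes \<gamma>: "unit_speed_curve Z I \<gamma> \<gamma>'" "s \<in> I" and t: "\<tau> (\<gamma> s) = 0" and r: "r \<in> I" "r < s"
  shows "\<tau> (\<gamma>' s) < 0"
proof -
  have sub: "{r..s} \<subseteq> I"
    using \<gamma> r unfolding unit_speed_curve_def by (meson atLeastAtMost_iff mem_is_interval_1_I subsetI)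
  have "\<tau> (\<gamma>' s) \<le> 0"
    using curve_time_derivative[OF \<gamma> sub] r(2)
    by (rule deriv_nonpos_left) (use \<gamma> sub t \<tau>_nonneg in \<open>auto simp: unit_speed_curve_def image_subset_iff subset_iff\<close>)
  moreover have "I \<noteq> {s}" using r by auto
  ultimately show ?thesis using curve_time_nonzero[OF \<gamma> _ t] by fastforce
qed

text \<open>Following two curves backwards from a common point with common direction, the shorter one
  arrives at time level \<open>0\<close> while the other one is still at an interior parameter.\<close>

lemma same_direction_aux:
  assumes \<gamma>: "unit_speed_curve Z I \<gamma> \<gamma>'" "0 \<in> I" "I \<noteq> {0}" "I \<subseteq> {0..}"
    and \<delta>: "unit_speed_curve Z J \<delta> \<delta>'" "0 \<in> J"
    and t: "\<tau> (\<gamma> 0) = 0" and ne: "\<gamma> 0 \<noteq> \<delta> 0"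
    and s0: "s0 \<in> I" and r0: "r0 \<in> J" and le: "0 \<le> s0" "s0 \<le> r0"
    and eq: "\<gamma> s0 = \<delta> r0" "\<gamma>' s0 = \<delta>' r0"
  shows False
proof -
  \<comment> \<open>The shift \<open>e\<close> is the parameter at which \<delta> reaches the start
    of \<gamma>.\<close>
  define e where "e = r0 - s0"
  have intI: "{0..s0} \<subseteq> I" and intJ: "{0..r0} \<subseteq> J"
    using \<gamma>(1,2) \<delta>(1,2) s0 r0 unfolding unit_speed_curve_def
    by (meson atLeastAtMost_iff mem_is_interval_1_I subsetI)+
  have 1: "unit_speed_curve Z {0..s0} \<gamma> \<gamma>'"
    by (rule unit_speed_curve_subset[OF \<gamma>(1) is_interval_cc intI])
  have 2: "unit_speed_curve Z {0..s0} (\<lambda>s. \<delta> (e + 1 * s)) (\<lambda>s. 1 *\<^sub>R \<delta>' (e + 1 * s))"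
    using intJ le by (intro unit_speed_curve_affine[OF \<delta>(1)]) (auto simp: is_interval_cc e_def)
  have agree: "\<gamma> 0 = \<delta> (e + 1 * 0)"
    by (rule curve_unique[OF _ _ 1 2, of s0]) (use eq le in \<open>auto simp: e_def\<close>)
  then have "e \<noteq> 0" using ne by auto
  then have e: "0 < e" "e \<in> J" using le intJ by (auto simp: e_def)
  have te: "\<tau> (\<delta> e) = 0" using agree t by simp
  have left: "\<tau> (\<delta>' e) < 0" by (rule curve_time_left[OF \<delta>(1) e(2) te \<delta>(2) e(1)])
  show False
  proof (cases "s0 = 0")
    \<comment> \<open>Here \<open>e = r0\<close> may be the right end of \<open>J\<close>; the
      positive time derivative is supplied by the start of \<gamma> instead.\<close>
    case True
    obtain r where "r \<in> I" "0 < r" using \<gamma>(2-4) by force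
    then have "\<tau> (\<gamma>' 0) > 0" using curve_time_right[OF \<gamma>(1,2) t] by blast
    then show False using left eq(2) True by (simp add: e_def)
  next
    case False
    then have "\<tau> (\<delta>' e) > 0"
      using le by (intro curve_time_right[OF \<delta>(1) e(2) te r0]) (auto simp: e_def)
    then show False using left by simp
  qed
qed

text \<open>If the directions at the common point are opposite, one path is the other one reversed: the
  two pieces join to a curve between the end points, which maximality identifies with each path.\<close>

lemma opposite_direction_aux:
  assumes \<gamma>: "unit_speed_curve Z I \<gamma> \<gamma>'" "0 \<in> I" "I \<noteq> {0}" "I \<subseteq> {0..}"
    and \<delta>: "unit_speed_curve Z J \<delta> \<delta>'" "0 \<in> J"
    and max: "\<And>L \<zeta>. solution_curve Z L \<zeta> \<Longrightarrow> I \<subseteq> L \<Longrightarrow> (\<And>s. s \<in> I \<Longrightarrow> \<zeta> s = \<gamma> s) \<Longrightarrow> L = I"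
    and t: "\<tau> (\<delta> 0) = 0" and ne: "\<gamma> 0 \<noteq> \<delta> 0"
    and s0: "s0 \<in> I" and r0: "r0 \<in> J" and le: "0 \<le> s0" "0 \<le> r0"
    and eq: "\<gamma> s0 = \<delta> r0" "\<gamma>' s0 = - \<delta>' r0"
  shows "\<gamma> ` I = \<gamma> ` {0..s0} \<union> \<delta> ` {0..r0}"
proof -
  define l where "l = s0 + r0"
  define \<zeta> where "\<zeta> s = (if s \<in> {0..s0} then \<gamma> s else \<delta> (l + (-1) * s))" for s
  define \<zeta>' where "\<zeta>' s = (if s \<in> {0..s0} then \<gamma>' s else (-1) *\<^sub>R \<delta>' (l + (-1) * s))" for s
  have "l \<noteq> 0" using le eq(1) ne by (auto simp: l_def add_nonneg_eq_0_iff)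
  then have l: "0 < l" using le by (simp add: l_def)
  have intI: "{0..s0} \<subseteq> I" and intJ: "{0..r0} \<subseteq> J"
    using \<gamma>(1,2) \<delta>(1,2) s0 r0 unfolding unit_speed_curve_def
    by (meson atLeastAtMost_iff mem_is_interval_1_I subsetI)+
  have "unit_speed_curve Z {0..s0} \<gamma> \<gamma>'"
    by (rule unit_speed_curve_subset[OF \<gamma>(1) is_interval_cc intI])
  moreover have "unit_speed_curve Z {s0..l} (\<lambda>s. \<delta> (l + (-1) * s)) (\<lambda>s. (-1) *\<^sub>R \<delta>' (l + (-1) * s))"
    using intJ by (intro unit_speed_curve_affine[OF \<delta>(1)]) (auto simp: is_interval_cc l_def)
  ultimately have \<zeta>: "unit_speed_curve Z {0..l} \<zeta> \<zeta>'"
    unfolding \<zeta>_def[abs_def] \<zeta>'_def[abs_def]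
    by (rule unit_speed_curve_join) (use eq le in \<open>auto simp: l_def\<close>)
  have sol: "solution_curve Z {0..l} \<zeta>"
  proof -
    have "l \<in> {0..l}" "0 \<in> {0..l}" using l by auto
    then show ?thesis using \<zeta> l by (auto simp: solution_curve_iff)
  qed
  have int: "is_interval I" using \<gamma>(1) by (simp add: unit_speed_curve_def)
  have agree: "\<gamma> s = \<zeta> s" if "s \<in> I" "s \<in> {0..l}" for s
  proof (rule curve_unique[of Z])
    have i: "is_interval (I \<inter> {0..l})" using int by (intro is_interval_Int) (simp_all add: is_interval_cc)
    show "unit_speed_curve Z (I \<inter> {0..l}) \<gamma> \<gamma>'" by (rule unit_speed_curve_subset[OF \<gamma>(1) i]) auto
    show "unit_speed_curve Z (I \<inter> {0..l}) \<zeta> \<zeta>'" by (rule unit_speed_curve_subset[OF \<zeta> i]) auto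
    show "0 \<in> I \<inter> {0..l}" using \<gamma>(2) l by simp
  qed (use that le in \<open>auto simp: \<zeta>_def \<zeta>'_def\<close>)
  \<comment> \<open>If \<gamma> went on beyond \<open>l\<close>, then at the interior parameter
    \<open>l\<close> it would be at the start of \<delta>, which is on time level 0.\<close>
  have "I \<subseteq> {0..l}"
  proof
    fix s assume s: "s \<in> I"
    show "s \<in> {0..l}"
    proof (rule ccontr)
      assume "s \<notin> {0..l}"
      then have "l < s" using s \<gamma>(4) by auto
      then have lI: "l \<in> I" using int \<gamma>(2) s l by (meson less_imp_le mem_is_interval_1_I)
      have "\<zeta> l = \<delta> 0"
      proof (cases "r0 = 0")
        case True
        then show ?thesis using l eq(1) by (simp add: \<zeta>_def l_def)
      next
        case False
        then show ?thesis using le by (simp add: \<zeta>_def l_def)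
      qed
      then have "\<gamma> l = \<delta> 0" using agree[OF lI] l by simp
      then have tl: "\<tau> (\<gamma> l) = 0" using t by simp
      show False
        using curve_time_right[OF \<gamma>(1) lI tl s \<open>l < s\<close>] curve_time_left[OF \<gamma>(1) lI tl \<gamma>(2) l] by simp
    qed
  qed
  have I: "{0..l} = I"
  proof (rule max[OF sol \<open>I \<subseteq> {0..l}\<close>])
    fix s assume s: "s \<in> I"
    then show "\<zeta> s = \<gamma> s" using agree[OF s] \<open>I \<subseteq> {0..l}\<close> by auto
  qed
  have "\<gamma> ` I = \<zeta> ` {0..l}"
    unfolding I using agree \<open>I \<subseteq> {0..l}\<close> by (intro image_cong) auto
  also have "{0..l} = {0..s0} \<union> {s0..l}" using le by (auto simp: l_def)
  also have "\<zeta> ` ({0..s0} \<union> {s0..l}) = \<zeta> ` {0..s0} \<union> \<zeta> ` {s0..l}" by (rule image_Un)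
  also have "\<zeta> ` {0..s0} = \<gamma> ` {0..s0}" by (intro image_cong) (auto simp: \<zeta>_def)
  also have "\<zeta> ` {s0..l} = (\<lambda>s. \<delta> (l - s)) ` {s0..l}"
    using eq(1) by (intro image_cong) (auto simp: \<zeta>_def l_def)
  also have "\<dots> = \<delta> ` (\<lambda>s. l - s) ` {s0..l}" by (simp only: image_image)
  also have "(\<lambda>s. l - s) ` {s0..l} = {0..r0}" by (simp add: l_def)
  finally show ?thesis .
qed

text \<open>At a common point the kernel of \<open>q'\<close> is a line, so the two unit velocities
  agree up to sign. In the opposite case the helper is applied twice, each time with the maximality
  of one of the paths, and both images come out as the same union.\<close>

theorem paths_disjoint_or_equal:
  assumes p: "path_from Z x I \<gamma>" "\<tau> x = 0" and r: "path_from Z y J \<delta>" "\<tau> y = 0" and ne: "x \<noteq> y"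
  shows "\<gamma> ` I \<inter> \<delta> ` J = {} \<or> \<gamma> ` I = \<delta> ` J"
proof (rule disjCI)
  assume "\<gamma> ` I \<noteq> \<delta> ` J"
  show "\<gamma> ` I \<inter> \<delta> ` J = {}"
  proof (rule ccontr)
    assume "\<gamma> ` I \<inter> \<delta> ` J \<noteq> {}"
    then obtain s0 r0 where s0: "s0 \<in> I" and r0: "r0 \<in> J" and eq: "\<gamma> s0 = \<delta> r0" by blast
    obtain \<gamma>' where \<gamma>: "unit_speed_curve Z I \<gamma> \<gamma>'" "0 \<in> I" "I \<noteq> {0}" "I \<subseteq> {0..}"
      using p(1) by (auto simp: path_from_def solution_curve_iff)
    obtain \<delta>' where \<delta>: "unit_speed_curve Z J \<delta> \<delta>'" "0 \<in> J" "J \<noteq> {0}" "J \<subseteq> {0..}"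
      using r(1) by (auto simp: path_from_def solution_curve_iff)
    have start: "\<gamma> 0 = x" "\<delta> 0 = y" using p(1) r(1) by (auto simp: path_from_def)
    have nn: "0 \<le> s0" "0 \<le> r0" using s0 r0 \<gamma>(4) \<delta>(4) by auto
    have I: "I \<noteq> {s0}" "J \<noteq> {r0}" using \<gamma>(2,3) \<delta>(2,3) by auto
    have x0: "\<gamma> s0 \<in> Z" "norm (\<gamma>' s0) = 1" "norm (\<delta>' r0) = 1"
      using \<gamma>(1) \<delta>(1) s0 r0 by (auto simp: unit_speed_curve_def)
    have "q' (\<gamma> s0) (\<gamma>' s0) = 0" "q' (\<gamma> s0) (\<delta>' r0) = 0"
      using curve_kernel[OF \<gamma>(1) s0 I(1)] curve_kernel[OF \<delta>(1) r0 I(2)] eq by simp_all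
    then have col: "\<delta>' r0 = (\<delta>' r0 \<bullet> \<gamma>' s0) *\<^sub>R \<gamma>' s0"
      using surj_kernel_line[OF has_derivative_linear[OF der] surj[OF x0(1)] dim] x0(2) by blast
    then have "\<bar>\<delta>' r0 \<bullet> \<gamma>' s0\<bar> = 1" using x0(2,3) by (metis mult.right_neutral norm_scaleR)
    then consider "\<delta>' r0 \<bullet> \<gamma>' s0 = 1" | "\<delta>' r0 \<bullet> \<gamma>' s0 = -1" by linarith
    then show False
    proof cases
      case 1
      then have d: "\<gamma>' s0 = \<delta>' r0" using col by simp
      show False
      proof (cases "s0 \<le> r0")
        case True
        then show False
          using same_direction_aux[OF \<gamma> \<delta>(1,2) _ _ s0 r0 nn(1) _ eq d] p(2) ne start by simp
      next
        case False
        then show False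
          using same_direction_aux[OF \<delta> \<gamma>(1,2) _ _ r0 s0 nn(2) _ eq[symmetric] d[symmetric]] r(2) ne start by simp
      qed
    next
      case 2
      then have d: "\<gamma>' s0 = - \<delta>' r0" "\<delta>' r0 = - \<gamma>' s0" using col by simp_all
      have "\<gamma> ` I = \<gamma> ` {0..s0} \<union> \<delta> ` {0..r0}"
      proof (rule opposite_direction_aux[OF \<gamma> \<delta>(1,2) _ _ _ s0 r0 nn eq d(1)])
        show "L = I" if "solution_curve Z L \<zeta>" "I \<subseteq> L" "\<And>s. s \<in> I \<Longrightarrow> \<zeta> s = \<gamma> s" for L \<zeta>
          using p(1) that unfolding path_from_def by blast
      qed (use r(2) ne start in simp_all)
      moreover have "\<delta> ` J = \<delta> ` {0..r0} \<union> \<gamma> ` {0..s0}"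
      proof (rule opposite_direction_aux[OF \<delta> \<gamma>(1,2) _ _ _ r0 s0 nn(2,1) eq[symmetric] d(2)])
        show "L = J" if "solution_curve Z L \<zeta>" "J \<subseteq> L" "\<And>s. s \<in> J \<Longrightarrow> \<zeta> s = \<delta> s" for L \<zeta>
          using r(1) that unfolding path_from_def by blast
      qed (use p(2) ne start in simp_all)
      ultimately show False using \<open>\<gamma> ` I \<noteq> \<delta> ` J\<close> by blast
    qed
  qed
qed

end

subsection \<open>Zero sets of polynomials\<close>

text \<open>Polynomials of degree at most \<open>d\<close>, described by derivatives instead of
  coefficients: closure under partial derivatives and descent in the degree, on which
  \<open>polynomial_zero_set_cover\<close> rests, are built in.\<close>

primrec poly_fun :: "nat \<Rightarrow> ('a::euclidean_space \<Rightarrow> real) \<Rightarrow> bool" where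
  "poly_fun 0 f \<longleftrightarrow> (\<exists>c. f = (\<lambda>x. c))"
| "poly_fun (Suc d) f \<longleftrightarrow>
     (\<exists>f'. (\<forall>x. (f has_derivative f' x) (at x)) \<and> (\<forall>b\<in>Basis. poly_fun d (\<lambda>x. f' x b)))"

lemma poly_fun_SucE:
  assumes "poly_fun (Suc d) f"
  obtains f' where "\<forall>x. (f has_derivative f' x) (at x)" "\<forall>b\<in>Basis. poly_fun d (\<lambda>x. f' x b)"
  using assms by auto

lemma poly_fun_const: "poly_fun d (\<lambda>x. c)"
proof (induction d arbitrary: c)
  case (Suc d)
  show ?case using Suc by (auto intro!: exI[of _ "\<lambda>x v. 0"])
qed auto

lemma poly_fun_Suc: "poly_fun d f \<Longrightarrow> poly_fun (Suc d) f"
proof (induction d arbitrary: f)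
  case 0
  then show ?case using poly_fun_const[of "Suc 0"] by auto
next
  case (Suc d)
  then obtain f' where "\<forall>x. (f has_derivative f' x) (at x)" "\<forall>b\<in>Basis. poly_fun d (\<lambda>x. f' x b)"
    by auto
  then show ?case using Suc.IH by (subst poly_fun.simps(2)) blast
qed

lemma poly_fun_mono: "poly_fun d f \<Longrightarrow> d \<le> e \<Longrightarrow> poly_fun e f"
  by (induction e) (auto simp: le_Suc_eq intro: poly_fun_Suc simp del: poly_fun.simps)

lemma poly_fun_add: "poly_fun d f \<Longrightarrow> poly_fun d g \<Longrightarrow> poly_fun d (\<lambda>x. f x + g x)"
proof (induction d arbitrary: f g)
  case (Suc d)
  obtain f' where "\<forall>x. (f has_derivative f' x) (at x)" "\<forall>b\<in>Basis. poly_fun d (\<lambda>x. f' x b)"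
    by (rule poly_fun_SucE[OF Suc.prems(1)])
  note f' = this[rule_format]
  obtain g' where "\<forall>x. (g has_derivative g' x) (at x)" "\<forall>b\<in>Basis. poly_fun d (\<lambda>x. g' x b)"
    by (rule poly_fun_SucE[OF Suc.prems(2)])
  note g' = this[rule_format]
  show ?case
    using Suc.IH f' g' by (auto intro!: exI[of _ "\<lambda>x v. f' x v + g' x v"] has_derivative_add)
qed auto

lemma poly_fun_mult: "poly_fun d f \<Longrightarrow> poly_fun e g \<Longrightarrow> poly_fun (d + e) (\<lambda>x. f x * g x)"
proof (induction "d + e" arbitrary: d e f g)
  case 0
  then show ?case by auto
next
  case (Suc n)
  \<comment> \<open>For \<open>d = 0\<close> the truncated \<open>d - 1\<close> would count the
    degree of the product rule one too high, so the vanishing of the derivative is recorded as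
    well.\<close>
  have "\<exists>f'. (\<forall>x. (f has_derivative f' x) (at x)) \<and> (\<forall>b\<in>Basis. poly_fun (d - 1) (\<lambda>x. f' x b) \<and> (d = 0 \<longrightarrow> (\<forall>x. f' x b = 0)))"
    using Suc.prems(1) by (cases d) (auto intro: exI[of _ "\<lambda>x v. 0"])
  then obtain f' where f': "\<And>x. (f has_derivative f' x) (at x)" "\<And>b. b \<in> Basis \<Longrightarrow> poly_fun (d - 1) (\<lambda>x. f' x b)"
    "\<And>b x. b \<in> Basis \<Longrightarrow> d = 0 \<Longrightarrow> f' x b = 0" by blast
  have "\<exists>g'. (\<forall>x. (g has_derivative g' x) (at x)) \<and> (\<forall>b\<in>Basis. poly_fun (e - 1) (\<lambda>x. g' x b) \<and> (e = 0 \<longrightarrow> (\<forall>x. g' x b = 0)))"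
    using Suc.prems(2) by (cases e) (auto intro: exI[of _ "\<lambda>x v. 0"])
  then obtain g' where g': "\<And>x. (g has_derivative g' x) (at x)" "\<And>b. b \<in> Basis \<Longrightarrow> poly_fun (e - 1) (\<lambda>x. g' x b)"
    "\<And>b x. b \<in> Basis \<Longrightarrow> e = 0 \<Longrightarrow> g' x b = 0" by blast
  have "poly_fun n (\<lambda>x. f x * g' x b + f' x b * g x)" if b: "b \<in> Basis" for b
  proof (rule poly_fun_add)
    show "poly_fun n (\<lambda>x. f x * g' x b)"
    proof (cases e)
      case 0
      then show ?thesis using g'(3)[OF b] poly_fun_const by simp
    next
      case (Suc e')
      then have "n = d + (e - 1)" using Suc.hyps(2) by simp
      then show ?thesis using Suc.hyps(1)[of d "e - 1"] Suc.prems(1) g'(2)[OF b] by simp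
    qed
    show "poly_fun n (\<lambda>x. f' x b * g x)"
    proof (cases d)
      case 0
      then show ?thesis using f'(3)[OF b] poly_fun_const by simp
    next
      case (Suc d')
      then have "n = (d - 1) + e" using Suc.hyps(2) by simp
      then show ?thesis using Suc.hyps(1)[of "d - 1" e] Suc.prems(2) f'(2)[OF b] by simp
    qed
  qed
  then have "poly_fun (Suc n) (\<lambda>x. f x * g x)"
    using f'(1) g'(1)
    by (auto intro!: exI[of _ "\<lambda>x v. f x * g' x v + f' x v * g x"] has_derivative_mult)
  then show ?case using Suc.hyps(2) by (simp del: poly_fun.simps)
qed

lemma poly_fun_linear: "linear f \<Longrightarrow> poly_fun 1 f"
  by (auto intro!: exI[of _ "\<lambda>x. f"] linear_imp_has_derivative)

definition polynomial_map :: "('a::euclidean_space \<Rightarrow> real) \<Rightarrow> bool" where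
  "polynomial_map f \<longleftrightarrow> (\<exists>d. poly_fun d f)"

lemma polynomial_map_const: "polynomial_map (\<lambda>x. c)"
  using poly_fun_const by (auto simp: polynomial_map_def)

lemma polynomial_map_linear: "linear f \<Longrightarrow> polynomial_map f"
  using poly_fun_linear by (auto simp: polynomial_map_def simp del: poly_fun.simps)

lemma polynomial_map_add:
  assumes "polynomial_map f" "polynomial_map g"
  shows "polynomial_map (\<lambda>x. f x + g x)"
proof -
  obtain d e where "poly_fun d f" "poly_fun e g" using assms by (auto simp: polynomial_map_def)
  then have "poly_fun (max d e) (\<lambda>x. f x + g x)"
    by (intro poly_fun_add) (auto elim: poly_fun_mono)
  then show ?thesis by (auto simp: polynomial_map_def)
qed

lemma polynomial_map_mult:
  assumes "polynomial_map f" "polynomial_map g"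
  shows "polynomial_map (\<lambda>x. f x * g x)"
proof -
  obtain d e where "poly_fun d f" "poly_fun e g" using assms by (auto simp: polynomial_map_def)
  then have "poly_fun (d + e) (\<lambda>x. f x * g x)" by (rule poly_fun_mult)
  then show ?thesis by (auto simp: polynomial_map_def)
qed

lemma polynomial_map_diff: "polynomial_map f \<Longrightarrow> polynomial_map g \<Longrightarrow> polynomial_map (\<lambda>x. f x - g x)"
  using polynomial_map_add[of f "\<lambda>x. -1 * g x"] polynomial_map_mult[OF polynomial_map_const[of "-1"], of g] by simp

lemma polynomial_map_uminus: "polynomial_map f \<Longrightarrow> polynomial_map (\<lambda>x. - f x)"
  using polynomial_map_diff[OF polynomial_map_const[of 0]] by simp

lemma polynomial_map_power: "polynomial_map f \<Longrightarrow> polynomial_map (\<lambda>x. f x ^ n)"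
  by (induction n) (auto intro: polynomial_map_const polynomial_map_mult)

lemma polynomial_map_sum:
  "(\<And>i. i \<in> I \<Longrightarrow> polynomial_map (f i)) \<Longrightarrow> polynomial_map (\<lambda>x. \<Sum>i\<in>I. f i x)"
  by (induction I rule: infinite_finite_induct) (auto intro: polynomial_map_const polynomial_map_add)

lemma polynomial_map_prod:
  "(\<And>i. i \<in> I \<Longrightarrow> polynomial_map (f i)) \<Longrightarrow> polynomial_map (\<lambda>x. \<Prod>i\<in>I. f i x)"
  by (induction I rule: infinite_finite_induct) (auto intro: polynomial_map_const polynomial_map_mult)

lemma polynomial_map_det:
  fixes M :: "'a::euclidean_space \<Rightarrow> real ^ 'n ^ 'n"
  assumes "\<And>i j. polynomial_map (\<lambda>x. M x $ i $ j)"
  shows "polynomial_map (\<lambda>x. Determinants.det (M x))"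
  unfolding Determinants.det_def
  by (intro polynomial_map_sum polynomial_map_mult polynomial_map_prod polynomial_map_const assms)

lemmas polynomial_map_intros = polynomial_map_const polynomial_map_add polynomial_map_mult
  polynomial_map_diff polynomial_map_uminus polynomial_map_power polynomial_map_sum

lemma polynomial_map_C1:
  assumes "polynomial_map f"
  shows "(f has_derivative frechet_derivative f (at x)) (at x)"
    and "continuous_on UNIV (\<lambda>x. frechet_derivative f (at x) v)"
proof -
  have d: "\<And>x. f differentiable (at x)" if f: "poly_fun d f" for d and f :: "'a \<Rightarrow> real"
  proof (cases d)
    case 0
    then show "f differentiable (at x)" for x using f by auto
  next
    case (Suc d')
    then show "f differentiable (at x)" for x using f by (auto simp: differentiable_def)
  qed
  obtain d where "poly_fun d f" using assms by (auto simp: polynomial_map_def)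
  \<comment> \<open>Raising the bound makes the derivative clause available for constants
    too.\<close>
  then have "poly_fun (Suc d) f" by (rule poly_fun_Suc)
  then obtain f' where "\<forall>x. (f has_derivative f' x) (at x)" "\<forall>b\<in>Basis. poly_fun d (\<lambda>x. f' x b)"
    by (rule poly_fun_SucE)
  note f' = this[rule_format]
  have eq: "frechet_derivative f (at x) = f' x" for x
    using frechet_derivative_at[OF f'(1)] by simp
  show "(f has_derivative frechet_derivative f (at x)) (at x)"
    using f'(1) by (simp add: eq)
  have expand: "f' x v = (\<Sum>b\<in>Basis. (v \<bullet> b) *\<^sub>R f' x b)" for x
  proof -
    have l: "linear (f' x)" using has_derivative_linear[OF f'(1)] .
    have "f' x v = f' x (\<Sum>b\<in>Basis. (v \<bullet> b) *\<^sub>R b)"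
      by (simp only: euclidean_representation)
    then show ?thesis by (simp only: linear_sum[OF l] linear_scale[OF l])
  qed
  have "continuous_on UNIV (\<lambda>x. f' x b)" if "b \<in> Basis" for b
    using d[OF f'(2)[OF that]]
    by (intro differentiable_imp_continuous_on) (simp add: differentiable_on_def)
  then show "continuous_on UNIV (\<lambda>x. frechet_derivative f (at x) v)"
    unfolding eq by (subst expand) (intro continuous_intros, auto)
qed

text \<open>The members of \<open>G\<close> are iterated derivatives of \<open>f\<close> in the directions \<open>D\<close>; one of those that vanish
  at \<open>y\<close> has a derivative that does not, since \<open>f\<close> is not identically zero on \<open>y + span D\<close>.\<close>

lemma polynomial_zero_set_cover:
  fixes f :: "'a::euclidean_space \<Rightarrow> real"
  assumes f: "polynomial_map f" and inv: "\<And>y w. w \<in> W \<Longrightarrow> f (y + w) = f y" and D: "D \<subseteq> Basis"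
  shows "\<exists>G. finite G \<and> (\<forall>g\<in>G. polynomial_map g \<and> (\<forall>w\<in>W. \<forall>y. g (y + w) = g y)) \<and>
    (\<forall>y z. f y = 0 \<and> f z \<noteq> 0 \<and> z - y \<in> span D \<longrightarrow>
       (\<exists>g\<in>G. g y = 0 \<and> (\<exists>b\<in>D. frechet_derivative g (at y) b \<noteq> 0)))"
proof -
  have finD: "finite D" using D finite_Basis finite_subset by blast
  obtain d where "poly_fun d f" using f by (auto simp: polynomial_map_def)
  then show ?thesis using inv
  proof (induction d arbitrary: f)
    case 0
    then show ?case by (intro exI[of _ "{}"]) auto
  next
    case (Suc d)
    obtain f' where "\<forall>x. (f has_derivative f' x) (at x)" "\<forall>b\<in>Basis. poly_fun d (\<lambda>x. f' x b)"
      by (rule poly_fun_SucE[OF Suc.prems(1)])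
    note f' = this[rule_format]
    have eq: "frechet_derivative f (at x) = f' x" for x
      using frechet_derivative_at[OF f'(1)] by simp
    have inv': "f' (y + w) = f' y" if "w \<in> W" for y w
    proof -
      have "((\<lambda>x. f (x + w)) has_derivative f' (y + w)) (at y)"
        using has_derivative_compose[OF has_derivative_add[OF has_derivative_ident has_derivative_const] f'(1)]
        by simp
      then have "(f has_derivative f' (y + w)) (at y)"
        using Suc.prems(2)[OF that] by simp
      then show ?thesis using f'(1) has_derivative_unique by blast
    qed
    have "\<forall>b\<in>D. \<exists>Gb. finite Gb \<and> (\<forall>g\<in>Gb. polynomial_map g \<and> (\<forall>w\<in>W. \<forall>y. g (y + w) = g y)) \<and>
       (\<forall>y z. f' y b = 0 \<and> f' z b \<noteq> 0 \<and> z - y \<in> span D \<longrightarrow>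
         (\<exists>g\<in>Gb. g y = 0 \<and> (\<exists>b\<in>D. frechet_derivative g (at y) b \<noteq> 0)))"
    proof
      fix b assume "b \<in> D"
      then have "b \<in> Basis" using D by blast
      show "\<exists>Gb. finite Gb \<and> (\<forall>g\<in>Gb. polynomial_map g \<and> (\<forall>w\<in>W. \<forall>y. g (y + w) = g y)) \<and>
       (\<forall>y z. f' y b = 0 \<and> f' z b \<noteq> 0 \<and> z - y \<in> span D \<longrightarrow>
         (\<exists>g\<in>Gb. g y = 0 \<and> (\<exists>b\<in>D. frechet_derivative g (at y) b \<noteq> 0)))"
        by (rule Suc.IH[OF f'(2)[OF \<open>b \<in> Basis\<close>]]) (simp add: inv')
    qed
    from bchoice[OF this] obtain G where G: "\<forall>b\<in>D. finite (G b) \<and> (\<forall>g\<in>G b. polynomial_map g \<and> (\<forall>w\<in>W. \<forall>y. g (y + w) = g y)) \<and>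
       (\<forall>y z. f' y b = 0 \<and> f' z b \<noteq> 0 \<and> z - y \<in> span D \<longrightarrow>
         (\<exists>g\<in>G b. g y = 0 \<and> (\<exists>b\<in>D. frechet_derivative g (at y) b \<noteq> 0)))" ..
    have "\<exists>g\<in>insert f (\<Union>b\<in>D. G b). g y = 0 \<and> (\<exists>b\<in>D. frechet_derivative g (at y) b \<noteq> 0)"
      if yz: "f y = 0" "f z \<noteq> 0" "z - y \<in> span D" for y z
    proof -
      have "((\<lambda>t. f (y + t *\<^sub>R (z - y))) has_derivative (\<lambda>s. f' (y + t *\<^sub>R (z - y)) (s *\<^sub>R (z - y)))) (at t within {0..1})"
        for t :: real
        by (rule has_derivative_compose[OF _ f'(1)]) (auto intro!: derivative_eq_intros)
      \<comment> \<open>By the mean value theorem on the segment from \<open>y\<close> to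
        \<open>z\<close>, some derivative in a direction of \<open>D\<close> is nonzero at an
        intermediate point. If that derivative vanishes at \<open>y\<close>, the intermediate point
        plays the part of \<open>z\<close> for it.\<close>
      then obtain t where "f (y + 1 *\<^sub>R (z - y)) - f (y + 0 *\<^sub>R (z - y)) =
          f' (y + t *\<^sub>R (z - y)) ((1 - 0) *\<^sub>R (z - y))"
        using mvt_very_simple[of 0 1 "\<lambda>t. f (y + t *\<^sub>R (z - y))" "\<lambda>t s. f' (y + t *\<^sub>R (z - y)) (s *\<^sub>R (z - y))"]
        by auto
      then have "f' (y + t *\<^sub>R (z - y)) (z - y) \<noteq> 0" using yz by simp
      then obtain b where b: "b \<in> D" "f' (y + t *\<^sub>R (z - y)) b \<noteq> 0"
        using linear_eq_0_on_span[OF has_derivative_linear[OF f'(1)]] yz(3) by blast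
      show ?thesis
      proof (cases "f' y b = 0")
        case True
        have "(y + t *\<^sub>R (z - y)) - y \<in> span D" using yz(3) by (simp add: span_scale)
        then show ?thesis using bspec[OF G b(1), THEN conjunct2, THEN conjunct2, rule_format, of y "y + t *\<^sub>R (z - y)"] b True
          by auto
      next
        case False
        then show ?thesis using b(1) yz(1) eq by auto
      qed
    qed
    moreover have "polynomial_map f" using Suc.prems(1) unfolding polynomial_map_def by blast
    ultimately show ?case
      using G finD Suc.prems(2) by (intro exI[of _ "insert f (\<Union>b\<in>D. G b)"]) auto
  qed
qed

subsection \<open>Homotopies of eigenvalue problems\<close>

lemma has_derivative_vec_componentwise:
  fixes f :: "'a::real_normed_vector \<Rightarrow> real ^ 'n"
  assumes "\<And>i. ((\<lambda>x. f x $ i) has_derivative (\<lambda>v. f' v $ i)) (at x within S)"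
  shows "(f has_derivative f') (at x within S)"
  using assms by (subst has_derivative_componentwise_within) (auto simp: Basis_vec_def inner_axis)

definition cube_deriv :: "real ^ 'a::finite \<Rightarrow> real ^ 'a \<Rightarrow> real ^ 'a" where
  "cube_deriv \<phi> v = (\<chi> p. 3 * (\<phi> $ p)\<^sup>2 * v $ p)"

lemma cube_deriv_0 [simp]: "cube_deriv \<phi> 0 = 0"
  by (simp add: cube_deriv_def Finite_Cartesian_Product.vec_eq_iff)

lemma has_derivative_cube: "(cube has_derivative cube_deriv \<phi>) (at \<phi> within S)"
  unfolding cube_def[abs_def] cube_deriv_def[abs_def]
  by (rule has_derivative_vec_componentwise)
     (auto intro!: derivative_eq_intros bounded_linear.has_derivative[OF bounded_linear_vec_nth])

lemma continuous_on_cube [continuous_intros]: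
  "continuous_on S f \<Longrightarrow> continuous_on S (\<lambda>x. cube (f x))"
  unfolding cube_def by (intro continuous_intros)

lemma continuous_on_cube_deriv [continuous_intros]:
  "continuous_on S f \<Longrightarrow> continuous_on S (\<lambda>x. cube_deriv (f x) v)"
  unfolding cube_deriv_def by (intro continuous_intros)

text \<open>By \<open>unit_A\<close> the diagonal of \<open>A K\<close> can be prescribed freely;
  the tridiagonal structure enters only with the grid. The constant \<rho> stands for
  \<open>1 / (h1 * h2)\<close>.\<close>

locale eigen_homotopy =
  fixes A :: "'e::euclidean_space \<Rightarrow> real ^ 'p ^ 'p" and D :: "real ^ 'p ^ 'p" and \<beta> \<rho> :: real
  assumes linear_A: "linear A"
    and \<rho>_pos: "0 < \<rho>"
    and unit_A: "\<And>p. \<exists>K. \<forall>i j. A K $ i $ j = (if i = p \<and> j = p then 1 else 0)"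
begin

abbreviation vec_part :: "((real ^ 'p) \<times> real \<times> real) \<times> 'e \<Rightarrow> real ^ 'p" where
  "vec_part y \<equiv> fst (fst y)"
abbreviation eig_part :: "((real ^ 'p) \<times> real \<times> real) \<times> 'e \<Rightarrow> real" where
  "eig_part y \<equiv> fst (snd (fst y))"
abbreviation time_part :: "((real ^ 'p) \<times> real \<times> real) \<times> 'e \<Rightarrow> real" where
  "time_part y \<equiv> snd (snd (fst y))"

text \<open>The variable t is unrestricted here, so that the zeros at t = 0 are interior points of
  the space in which charts are taken.\<close>

definition F :: "((real ^ 'p) \<times> real \<times> real) \<times> 'e \<Rightarrow> (real ^ 'p) \<times> real" where
  "F y = ((1 - time_part y) *\<^sub>R (A (snd y) *v vec_part y) + D *v vec_part y
       + (time_part y * \<beta>) *\<^sub>R cube (vec_part y) - eig_part y *\<^sub>R vec_part y,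
     1/2 * (\<rho> - vec_part y \<bullet> vec_part y))"

definition F' :: "((real ^ 'p) \<times> real \<times> real) \<times> 'e \<Rightarrow> ((real ^ 'p) \<times> real \<times> real) \<times> 'e \<Rightarrow> (real ^ 'p) \<times> real" where
  "F' y v = ((1 - time_part y) *\<^sub>R (A (snd y) *v vec_part v + A (snd v) *v vec_part y)
       - time_part v *\<^sub>R (A (snd y) *v vec_part y) + D *v vec_part v
       + (time_part y * \<beta>) *\<^sub>R cube_deriv (vec_part y) (vec_part v)
       + (time_part v * \<beta>) *\<^sub>R cube (vec_part y)
       - eig_part y *\<^sub>R vec_part v - eig_part v *\<^sub>R vec_part y,
     - (vec_part y \<bullet> vec_part v))"

sublocale AB: bounded_bilinear "\<lambda>K \<phi>. A K *v \<phi>"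
proof -
  have "bilinear (\<lambda>K \<phi>. A K *v \<phi>)"
    unfolding bilinear_def
    by (auto intro!: linearI simp: linear_add[OF linear_A] linear_scale[OF linear_A]
        matrix_vector_right_distrib matrix_vector_mult_add_rdistrib matrix_vector_mult_scaleR
        scaleR_matrix_vector_assoc)
  then show "bounded_bilinear (\<lambda>K \<phi>. A K *v \<phi>)"
    by (simp add: bilinear_conv_bounded_bilinear)
qed

lemma has_derivative_F: "(F has_derivative F' y) (at y)"
  unfolding F_def[abs_def] F'_def[abs_def]
  apply (rule has_derivative_Pair)
   apply (rule derivative_eq_intros AB.FDERIV has_derivative_compose[OF _ has_derivative_cube]
     bounded_linear.has_derivative[OF matrix_vector_mul_bounded_linear] refl)+
   apply (simp add: algebra_simps)
  apply (rule derivative_eq_intros refl)+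
  apply (simp add: algebra_simps inner_commute)
  done

lemma continuous_on_F': "continuous_on UNIV (\<lambda>y. F' y v)"
  unfolding F'_def
  by (intro continuous_intros AB.continuous_on
      continuous_on_compose2[OF linear_continuous_on[OF matrix_vector_mul_bounded_linear]])
     auto

lemma linear_F': "linear (F' y)"
  using has_derivative_linear[OF has_derivative_F] .

lemma zero_norm: "F y = 0 \<Longrightarrow> vec_part y \<bullet> vec_part y = \<rho>"
  by (simp add: F_def zero_prod_def)

lemma vec_nonzero: "F y = 0 \<Longrightarrow> vec_part y \<noteq> 0"
  using zero_norm[of y] \<rho>_pos by auto

text \<open>Superposition. The subspace \<open>Ks\<close> later consists of the parameter directions
  that do not change an extra equation.\<close>

lemma A_combination:
  assumes "\<And>p. p \<in> T \<Longrightarrow> \<exists>K\<in>Ks. A K *v \<phi> = axis p 1" and "subspace Ks"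
  shows "\<exists>K\<in>Ks. \<forall>p. (A K *v \<phi>) $ p = (if p \<in> T then c p else 0)"
proof -
  obtain k where k: "\<And>p. p \<in> T \<Longrightarrow> k p \<in> Ks" "\<And>p. p \<in> T \<Longrightarrow> A (k p) *v \<phi> = axis p 1"
    using assms(1) by metis
  define K where "K = (\<Sum>p\<in>T. c p *\<^sub>R k p)"
  have "A K *v \<phi> = (\<Sum>p\<in>T. c p *\<^sub>R axis p 1)"
    by (simp add: K_def AB.sum_left AB.scaleR_left k(2))
  then have "(A K *v \<phi>) $ p = (\<Sum>q\<in>T. if p = q then c q else 0)" for p
    by (simp add: axis_def if_distrib cong: if_cong)
  then have "(A K *v \<phi>) $ p = (if p \<in> T then c p else 0)" for p by simp
  moreover have "K \<in> Ks" unfolding K_def using assms(2) k(1) by (intro subspace_sum subspace_scale)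
  ultimately show ?thesis by blast
qed

section \<open>Critical zeros confined by one extra equation\<close>

text \<open>The joint system has as many equations as there are unknowns besides \<open>K\<close>.
  It is submersive because its components can be adjusted in turn: the norm by a multiple of \<phi>,
  then \<open>l\<close> by a direction tangent to the sphere, then the rows by parameters that
  affect neither; the last step divides by 1 - t.\<close>

lemma negligible_piece:
  fixes l :: "((real ^ 'p) \<times> real \<times> real) \<times> 'e \<Rightarrow> real"
  assumes l: "\<And>y. (l has_derivative l' y) (at y)" "\<And>v. continuous_on UNIV (\<lambda>y. l' y v)"
    and S: "\<And>y. y \<in> S \<Longrightarrow> F y = 0 \<and> l y = 0 \<and> time_part y \<noteq> 1"
    and crit: "\<And>y. y \<in> S \<Longrightarrow> \<not> surj (\<lambda>v. (F' y (v, 0), l' y (v, 0)))"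
    and transv: "\<And>y. y \<in> S \<Longrightarrow> \<exists>v. vec_part y \<bullet> vec_part v = 0 \<and> l' y v \<noteq> 0"
    and K: "\<And>y p. y \<in> S \<Longrightarrow> \<exists>K. A K *v vec_part y = axis p 1 \<and> l' y (0, K) = 0"
  shows "negligible (snd ` S)"
proof (rule parametric_transversality[of "\<lambda>y. (F y, l y)" "\<lambda>y v. (F' y v, l' y v)"])
  show "((\<lambda>y. (F y, l y)) has_derivative (\<lambda>v. (F' y v, l' y v))) (at y)" for y
    by (intro has_derivative_Pair has_derivative_F l)
  show "continuous_on UNIV (\<lambda>y. (F' y v, l' y v))" for v
    by (intro continuous_intros continuous_on_F' l)
  show "(F y, l y) = 0" if "y \<in> S" for y using S[OF that] by (simp add: zero_prod_def)
  show "\<not> surj (\<lambda>v. (F' y (v, 0), l' y (v, 0)))" if "y \<in> S" for y using crit that .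
  show "DIM((real ^ 'p) \<times> real \<times> real) \<le> DIM(((real ^ 'p) \<times> real) \<times> real)" by simp
  show "surj (\<lambda>v. (F' y v, l' y v))" if y: "y \<in> S" for y
    unfolding surj_def
  proof safe
    fix \<eta> :: "real ^ 'p" and \<sigma> r :: real
    let ?\<phi> = "vec_part y"
    have lin_l: "linear (l' y)" using has_derivative_linear[OF l(1)] .
    obtain v where v: "?\<phi> \<bullet> vec_part v = 0" "l' y v \<noteq> 0" using transv[OF y] by blast
    define u :: "((real ^ 'p) \<times> real \<times> real) \<times> 'e"
      where "u = (((- \<sigma> / \<rho>) *\<^sub>R ?\<phi>, 0, 0), 0)"
    define w where "w = u + ((r - l' y u) / l' y v) *\<^sub>R v"
    have lw: "l' y w = r" using v(2) by (simp add: w_def linear_add[OF lin_l] linear_scale[OF lin_l])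
    have sw: "snd (F' y w) = \<sigma>"
      using v(1) zero_norm[of y] S[OF y] \<rho>_pos by (simp add: F'_def w_def u_def inner_add_right inner_diff_right)
    define Ks where "Ks = {K. l' y (0, K) = 0}"
    have Ks: "subspace Ks"
      using linear_subspace_kernel[OF linear_compose[of "\<lambda>K. (0, K)" "l' y"]] lin_l
      by (auto simp: Ks_def o_def linear_iff)
    have "\<exists>K\<in>Ks. A K *v ?\<phi> = axis p 1" for p
      using K[OF y, of p] by (auto simp: Ks_def)
    from A_combination[OF this Ks, of UNIV "\<lambda>p. (\<eta> - fst (F' y w)) $ p / (1 - time_part y)"]
    obtain K where K: "K \<in> Ks" "\<And>p. (A K *v ?\<phi>) $ p = (\<eta> - fst (F' y w)) $ p / (1 - time_part y)"
      by auto
    have FK: "F' y (0, K) = ((1 - time_part y) *\<^sub>R (A K *v ?\<phi>), 0)"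
      by (simp add: F'_def)
    have "(1 - time_part y) *\<^sub>R (A K *v ?\<phi>) = \<eta> - fst (F' y w)"
      using K(2) S[OF y] by (simp add: Finite_Cartesian_Product.vec_eq_iff)
    then have "F' y (w + (0, K)) = (\<eta>, \<sigma>)"
      using sw by (simp add: linear_add[OF linear_F'] FK prod_eq_iff)
    moreover have "l' y (w + (0, K)) = r"
      using lw K(1) by (simp add: Ks_def linear_add[OF lin_l])
    ultimately show "\<exists>x. ((\<eta>, \<sigma>), r) = (F' y x, l' y x)" by metis
  qed
qed

text \<open>All rows being touched amounts to surjectivity of
  \<open>K \<mapsto> A K *v \<phi>\<close>.\<close>

definition touched :: "real ^ 'p \<Rightarrow> 'p \<Rightarrow> bool" where
  "touched \<phi> p \<longleftrightarrow> (\<exists>K. A K *v \<phi> = axis p 1)"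

text \<open>That \<open>A K\<close> is diagonal matters later: such directions do not change
  \<open>critical_poly\<close>.\<close>

lemma unit_diag:
  assumes "\<phi> $ p \<noteq> 0"
  obtains K where "A K *v \<phi> = axis p 1" "\<And>i j. i \<noteq> j \<Longrightarrow> A K $ i $ j = 0"
proof -
  obtain K where K: "\<And>i j. A K $ i $ j = (if i = p \<and> j = p then 1 else 0)"
    using unit_A by metis
  have "(A ((1 / \<phi> $ p) *\<^sub>R K) *v \<phi>) $ i = axis p 1 $ i" for i
  proof -
    have "A ((1 / \<phi> $ p) *\<^sub>R K) $ i $ j * \<phi> $ j = (if j = p then (if i = p then 1 else 0) else 0)" for j
      using assms by (simp add: linear_scale[OF linear_A] K)
    then have "(A ((1 / \<phi> $ p) *\<^sub>R K) *v \<phi>) $ i = (\<Sum>j\<in>UNIV. if j = p then (if i = p then 1 else 0) else 0)"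
      by (simp only: matrix_vector_mult_def vec_lambda_beta)
    then show ?thesis by (simp add: axis_def)
  qed
  then have "A ((1 / \<phi> $ p) *\<^sub>R K) *v \<phi> = axis p 1" unfolding Finite_Cartesian_Product.vec_eq_iff by blast
  then show ?thesis
    by (rule that) (auto simp: linear_scale[OF linear_A] K)
qed

lemma untouched_zero: "\<not> touched \<phi> p \<Longrightarrow> \<phi> $ p = 0"
  using unit_diag unfolding touched_def by metis

text \<open>The extra equation is \<open>t = 0\<close> itself, which no parameter direction changes.
  A regular zero in this set is one whose tangent line lies in the time slice.\<close>

lemma negligible_time_critical:
  "negligible (snd ` {y. F y = 0 \<and> time_part y = 0 \<and> (\<forall>p. touched (vec_part y) p) \<and>
     \<not> surj (\<lambda>v. (F' y (v, 0), snd (snd v)))})"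
proof (rule negligible_piece[of "\<lambda>y. time_part y" "\<lambda>y v. time_part v"])
  show "((\<lambda>y. time_part y) has_derivative (\<lambda>v. time_part v)) (at y)" for y :: "((real ^ 'p) \<times> real \<times> real) \<times> 'e"
    by (rule linear_imp_has_derivative) (auto intro!: linearI)
  show "\<exists>v :: ((real ^ 'p) \<times> real \<times> real) \<times> 'e. vec_part y \<bullet> vec_part v = 0 \<and> time_part v \<noteq> 0" for y
    by (intro exI[of _ "((0, 0, 1), 0)"]) auto
qed (auto simp: touched_def)

text \<open>The extra equation is the vanishing of component \<open>p\<close>; exactly because of
  it, \<open>axis p 1\<close> is tangent to the sphere at \<phi>.\<close>

lemma negligible_vanishing_component:
  "negligible (snd ` {y. F y = 0 \<and> time_part y \<noteq> 1 \<and> (\<forall>p. touched (vec_part y) p) \<and>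
     vec_part y $ p = 0 \<and> \<not> surj (\<lambda>v. F' y (v, 0))})"
proof (rule negligible_piece[of "\<lambda>y. vec_part y $ p" "\<lambda>y v. vec_part v $ p"])
  show "((\<lambda>y. vec_part y $ p) has_derivative (\<lambda>v. vec_part v $ p)) (at y)" for y :: "((real ^ 'p) \<times> real \<times> real) \<times> 'e"
    by (rule linear_imp_has_derivative) (auto intro!: linearI)
  fix y assume y: "y \<in> {y. F y = 0 \<and> time_part y \<noteq> 1 \<and> (\<forall>p. touched (vec_part y) p) \<and>
     vec_part y $ p = 0 \<and> \<not> surj (\<lambda>v. F' y (v, 0))}"
  show "\<not> surj (\<lambda>v. (F' y (v, 0), vec_part (v, 0 :: 'e) $ p))"
  proof
    assume "surj (\<lambda>v. (F' y (v, 0), vec_part (v, 0 :: 'e) $ p))"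
    then have "\<exists>v. F' y (v, 0) = w" for w
      by (metis (no_types, lifting) fst_conv surjD)
    then show False using y by (auto simp: surj_def) metis
  qed
  show "\<exists>v :: ((real ^ 'p) \<times> real \<times> real) \<times> 'e. vec_part y \<bullet> vec_part v = 0 \<and> vec_part v $ p \<noteq> 0"
    using y by (intro exI[of _ "((axis p 1, 0, 0), 0)"]) (auto simp: inner_axis)
qed (auto simp: touched_def intro!: continuous_intros)

section \<open>Zeros with untouched rows\<close>

text \<open>The parameters cannot correct the rows of \<open>F\<close> in \<open>T\<close>, so these
  rows are replaced by the equations \<open>\<phi> $ p = 0\<close>, which hold there by
  \<open>untouched_zero\<close>. The sums over \<open>B\<close> and \<open>C\<close> are the two
  further conditions.\<close>

definition degenerate_system :: "'p set \<Rightarrow> 'p set \<Rightarrow> 'p set \<Rightarrow>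
    ((real ^ 'p) \<times> real \<times> real) \<times> 'e \<Rightarrow> (real ^ 'p) \<times> real \<times> real \<times> real" where
  "degenerate_system T B C y = ((\<chi> p. if p \<in> T then vec_part y $ p else fst (F y) $ p), snd (F y),
     \<Sum>p\<in>B. vec_part y $ p, \<Sum>p\<in>C. vec_part y $ p)"

definition degenerate_system' :: "'p set \<Rightarrow> 'p set \<Rightarrow> 'p set \<Rightarrow>
    ((real ^ 'p) \<times> real \<times> real) \<times> 'e \<Rightarrow> ((real ^ 'p) \<times> real \<times> real) \<times> 'e \<Rightarrow> (real ^ 'p) \<times> real \<times> real \<times> real" where
  "degenerate_system' T B C y v = ((\<chi> p. if p \<in> T then vec_part v $ p else fst (F' y v) $ p), snd (F' y v),
     \<Sum>p\<in>B. vec_part v $ p, \<Sum>p\<in>C. vec_part v $ p)"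

lemma has_derivative_degenerate_system:
  "(degenerate_system T B C has_derivative degenerate_system' T B C y) (at y)"
proof -
  have F: "((\<lambda>y. fst (F y) $ p) has_derivative (\<lambda>v. fst (F' y v) $ p)) (at y)" for p
    by (intro bounded_linear.has_derivative[OF bounded_linear_vec_nth] has_derivative_fst has_derivative_F)
  have v: "((\<lambda>y. vec_part y $ p) has_derivative (\<lambda>v. vec_part v $ p)) (at y)" for p
    by (rule linear_imp_has_derivative) (auto intro!: linearI)
  have "((\<lambda>y. if p \<in> T then vec_part y $ p else fst (F y) $ p) has_derivative
        (\<lambda>v. if p \<in> T then vec_part v $ p else fst (F' y v) $ p)) (at y)" for p
    by (cases "p \<in> T") (simp_all add: F v)
  then have "((\<lambda>y. \<chi> p. if p \<in> T then vec_part y $ p else fst (F y) $ p) has_derivative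
        (\<lambda>v. \<chi> p. if p \<in> T then vec_part v $ p else fst (F' y v) $ p)) (at y)"
    by (intro has_derivative_vec_componentwise) simp
  then show ?thesis
    unfolding degenerate_system_def[abs_def] degenerate_system'_def[abs_def]
    by (intro has_derivative_Pair has_derivative_snd has_derivative_F has_derivative_sum v)
qed

lemma continuous_on_degenerate_system':
  "continuous_on UNIV (\<lambda>y. degenerate_system' T B C y v)"
proof -
  have "continuous_on UNIV (\<lambda>y. if p \<in> T then vec_part v $ p else fst (F' y v) $ p)" for p
    by (cases "p \<in> T") (auto intro!: continuous_intros continuous_on_F')
  then show ?thesis
    unfolding degenerate_system'_def by (intro continuous_intros continuous_on_F')
qed

lemma surj_degenerate_system':
  assumes F: "F y = 0" and t: "time_part y \<noteq> 1"
    and T: "\<And>p. p \<in> T \<Longrightarrow> vec_part y $ p = 0" "\<And>p. p \<notin> T \<Longrightarrow> touched (vec_part y) p"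
    and BC: "(\<Sum>p\<in>B. vec_part y $ p) = 0" "(\<Sum>p\<in>C. vec_part y $ p) = 0"
    and u: "u \<in> B - C - T" "w \<in> C - B - T"
  shows "surj (degenerate_system' T B C y)"
  unfolding surj_def
proof safe
  fix \<eta> :: "real ^ 'p" and \<sigma> r s :: real
  let ?\<phi> = "vec_part y"
  have uw: "u \<noteq> w" using u by auto
  \<comment> \<open>The private elements \<open>u\<close> and \<open>w\<close> correct the two sums
    independently. Adding a multiple of \<phi> afterwards adjusts the norm equation only, since
    \<phi> vanishes on \<open>T\<close> and both of its sums are zero.\<close>
  define z :: "real ^ 'p" where "z = (\<chi> p. if p \<in> T then \<eta> $ p
    else if p = u then r - (\<Sum>p\<in>B \<inter> T. \<eta> $ p) else if p = w then s - (\<Sum>p\<in>C \<inter> T. \<eta> $ p) else 0)"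
  have sum: "(\<Sum>p\<in>X. z $ p) = (\<Sum>p\<in>X \<inter> T. \<eta> $ p) + z $ x"
    if "x \<in> X - T" "\<And>p. p \<in> X - T \<Longrightarrow> p \<noteq> x \<Longrightarrow> z $ p = 0" for X x
  proof -
    have "(\<Sum>p\<in>X. z $ p) = (\<Sum>p\<in>X \<inter> T. z $ p) + (\<Sum>p\<in>X - T. z $ p)"
      by (subst sum.Int_Diff[of X _ T]) auto
    also have "(\<Sum>p\<in>X \<inter> T. z $ p) = (\<Sum>p\<in>X \<inter> T. \<eta> $ p)"
      by (intro sum.cong) (auto simp: z_def)
    also have "(\<Sum>p\<in>X - T. z $ p) = (\<Sum>p\<in>X - T. if p = x then z $ x else 0)"
      using that(2) by (intro sum.cong) auto
    also have "\<dots> = z $ x" using that(1) by (simp add: sum.delta)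
    finally show ?thesis .
  qed
  have sumB: "(\<Sum>p\<in>B. z $ p) = r" and sumC: "(\<Sum>p\<in>C. z $ p) = s"
  proof -
    have "z $ u = r - (\<Sum>p\<in>B \<inter> T. \<eta> $ p)" "z $ w = s - (\<Sum>p\<in>C \<inter> T. \<eta> $ p)"
      using u uw by (auto simp: z_def)
    moreover have "z $ p = 0" if "p \<in> B - T" "p \<noteq> u" for p
      using that u by (auto simp: z_def)
    moreover have "z $ p = 0" if "p \<in> C - T" "p \<noteq> w" for p
      using that u by (auto simp: z_def)
    ultimately show "(\<Sum>p\<in>B. z $ p) = r" "(\<Sum>p\<in>C. z $ p) = s"
      using sum[of u B] sum[of w C] u by auto
  qed
  define \<kappa> where "\<kappa> = - (\<sigma> + ?\<phi> \<bullet> z) / \<rho>"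
  define v :: "((real ^ 'p) \<times> real \<times> real) \<times> 'e"
    where "v = ((z + \<kappa> *\<^sub>R ?\<phi>, 0, 0), 0)"
  have sw: "snd (F' y v) = \<sigma>"
    using zero_norm[OF F] \<rho>_pos by (simp add: F'_def v_def \<kappa>_def inner_add_right inner_diff_right)
  have vT: "vec_part v $ p = \<eta> $ p" if "p \<in> T" for p
    using that T(1) by (simp add: v_def z_def)
  have vB: "(\<Sum>p\<in>B. vec_part v $ p) = r" "(\<Sum>p\<in>C. vec_part v $ p) = s"
    using sumB sumC BC by (simp_all add: v_def sum.distrib sum_distrib_left[symmetric])
  have "\<exists>K\<in>UNIV. A K *v ?\<phi> = axis p 1" if "p \<in> - T" for p
    using T(2)[of p] that by (auto simp: touched_def)
  from A_combination[OF this subspace_UNIV, of "- T" "\<lambda>p. (\<eta> - fst (F' y v)) $ p / (1 - time_part y)"]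
  obtain K where "\<forall>p. (A K *v ?\<phi>) $ p =
      (if p \<in> - T then (\<eta> - fst (F' y v)) $ p / (1 - time_part y) else 0)" by blast
  then have K: "(A K *v ?\<phi>) $ p = (\<eta> - fst (F' y v)) $ p / (1 - time_part y)" if "p \<notin> T" for p
    using that by simp
  have FK: "F' y (0, K) = ((1 - time_part y) *\<^sub>R (A K *v ?\<phi>), 0)"
    by (simp add: F'_def)
  have "fst (F' y (v + (0, K))) $ p = \<eta> $ p" if "p \<notin> T" for p
    using K[OF that] t by (simp add: linear_add[OF linear_F'] FK)
  moreover have "snd (F' y (v + (0, K))) = \<sigma>"
    using sw by (simp add: linear_add[OF linear_F'] FK)
  ultimately have "degenerate_system' T B C y (v + (0, K)) = (\<eta>, \<sigma>, r, s)"
    using vT vB by (simp add: degenerate_system'_def Finite_Cartesian_Product.vec_eq_iff)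
  then show "\<exists>x. (\<eta>, \<sigma>, r, s) = degenerate_system' T B C y x" by metis
qed

text \<open>Two independent linear conditions beyond the untouched rows push the dimension of the
  solution set below that of the parameter space.\<close>

lemma negligible_degenerate:
  "negligible (snd ` {y. F y = 0 \<and> time_part y \<noteq> 1 \<and>
     (\<exists>B C u w. (\<Sum>p\<in>B. vec_part y $ p) = 0 \<and> (\<Sum>p\<in>C. vec_part y $ p) = 0 \<and>
        u \<in> B - C \<and> w \<in> C - B \<and> touched (vec_part y) u \<and> touched (vec_part y) w)})"
    (is "negligible (snd ` ?S)")
proof -
  \<comment> \<open>Fixing \<open>T\<close> as the exact set of untouched rows keeps the system the
    same on a whole piece; there are finitely many triples.\<close>
  define S where "S T B C = {y. F y = 0 \<and> time_part y \<noteq> 1 \<and> T = {p. \<not> touched (vec_part y) p} \<and>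
    (\<Sum>p\<in>B. vec_part y $ p) = 0 \<and> (\<Sum>p\<in>C. vec_part y $ p) = 0 \<and>
    (\<exists>u w. u \<in> B - C - T \<and> w \<in> C - B - T)}" for T B C
  have "negligible (snd ` S T B C)" for T B C
  proof (rule parametric_transversality[of "degenerate_system T B C" "degenerate_system' T B C"])
    show "(degenerate_system T B C has_derivative degenerate_system' T B C y) (at y)" for y
      by (rule has_derivative_degenerate_system)
    show "continuous_on UNIV (\<lambda>y. degenerate_system' T B C y v)" for v
      by (rule continuous_on_degenerate_system')
    fix y assume y: "y \<in> S T B C"
    show "degenerate_system T B C y = 0"
      using y untouched_zero
      by (auto simp: S_def degenerate_system_def zero_prod_def Finite_Cartesian_Product.vec_eq_iff)
    show "surj (degenerate_system' T B C y)"
    proof -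
      obtain u w where "u \<in> B - C - T" "w \<in> C - B - T" using y by (auto simp: S_def)
      then show ?thesis
        using y untouched_zero by (intro surj_degenerate_system'[of y T B C u w]) (auto simp: S_def)
    qed
    \<comment> \<open>A dimension count: the system has one equation more than there are unknowns
      besides \<open>K\<close>.\<close>
    show "\<not> surj (\<lambda>v. degenerate_system' T B C y (v, 0))"
    proof
      assume s: "surj (\<lambda>v. degenerate_system' T B C y (v, 0))"
      have "linear (degenerate_system' T B C y)"
        using has_derivative_linear[OF has_derivative_degenerate_system] .
      then have "linear (\<lambda>v. degenerate_system' T B C y (v, 0))"
        using linear_compose[of "\<lambda>v. (v, 0)" "degenerate_system' T B C y"]
        by (auto simp: o_def linear_iff)
      from dim_kernel_surj[OF this s] show False by simp
    qed
  qed simp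
  then have "negligible (\<Union>(T, B, C)\<in>UNIV. snd ` S T B C)"
    by (intro negligible_Union) auto
  moreover have "snd ` ?S \<subseteq> (\<Union>(T, B, C)\<in>UNIV. snd ` S T B C)"
  proof
    fix K assume "K \<in> snd ` ?S"
    then obtain y where y: "K = snd y" "y \<in> ?S" by blast
    from y(2) obtain B C u w where "F y = 0" "time_part y \<noteq> 1"
      "(\<Sum>p\<in>B. vec_part y $ p) = 0" "(\<Sum>p\<in>C. vec_part y $ p) = 0"
      "u \<in> B - C" "w \<in> C - B" "touched (vec_part y) u" "touched (vec_part y) w" by auto
    then have "y \<in> S {p. \<not> touched (vec_part y) p} B C" by (auto simp: S_def)
    then show "K \<in> (\<Union>(T, B, C)\<in>UNIV. snd ` S T B C)" using y(1) by blast
  qed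
  ultimately show ?thesis by (rule negligible_subset)
qed

text \<open>Where no component of \<open>\<phi>\<close> vanishes, the equations determine the diagonal of \<open>A K\<close>.  After this
  elimination and the substitution \<open>\<phi>' = \<phi> y\<close> (componentwise) the Jacobian in \<open>\<phi>\<close>, multiplied by
  \<open>\<phi>\<close>, becomes \<open>reduced_jacobian\<close>; off the diagonal its entries are those of a weighted
  graph Laplacian.  The map is critical only if it is singular modulo the vector of squares,
  which is a polynomial condition in the remaining parameters.\<close>

definition pencil :: "real \<Rightarrow> 'e \<Rightarrow> real ^ 'p ^ 'p" where
  "pencil t K = (1 - t) *\<^sub>R A K + D"

definition reduced_jacobian :: "real ^ 'p \<Rightarrow> real \<Rightarrow> 'e \<Rightarrow> real ^ 'p ^ 'p" where
  "reduced_jacobian \<phi> t K = (\<chi> p q. if p = q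
     then 2 * t * \<beta> * (\<phi> $ p) ^ 4 - (\<Sum>r\<in>- {p}. \<phi> $ p * \<phi> $ r * pencil t K $ p $ r)
     else \<phi> $ p * \<phi> $ q * pencil t K $ p $ q)"

text \<open>After the substitution this vector is, up to sign, both the gradient of the norm
  constraint and the column belonging to the eigenvalue.\<close>

definition squares :: "real ^ 'p \<Rightarrow> real ^ 'p" where
  "squares \<phi> = (\<chi> p. (\<phi> $ p)\<^sup>2)"

definition outer :: "real ^ 'p \<Rightarrow> real ^ 'p ^ 'p" where
  "outer v = (\<chi> p q. v $ p * v $ q)"

text \<open>The orthogonal projection onto the complement of \<open>v\<close>, multiplied by
  \<open>v \<bullet> v\<close> to keep its entries polynomial.\<close>

definition scaled_proj :: "real ^ 'p \<Rightarrow> real ^ 'p ^ 'p" where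
  "scaled_proj v = (\<chi> p q. (if p = q then v \<bullet> v else 0) - v $ p * v $ q)"

text \<open>A bordered determinant in square form: for nonzero \<open>s = squares \<phi>\<close> the
  matrix is singular exactly if some nonzero x orthogonal to \<open>s\<close> is mapped by
  \<open>reduced_jacobian\<close> to a multiple of \<open>s\<close>.\<close>

definition critical_poly :: "((real ^ 'p) \<times> real \<times> real) \<times> 'e \<Rightarrow> real" where
  "critical_poly y = Determinants.det
     (scaled_proj (squares (vec_part y)) ** reduced_jacobian (vec_part y) (time_part y) (snd y)
       ** scaled_proj (squares (vec_part y)) + outer (squares (vec_part y)))"

lemma outer_mult: "outer v *v x = (v \<bullet> x) *\<^sub>R v"
  by (simp add: outer_def Finite_Cartesian_Product.vec_eq_iff matrix_vector_mult_def inner_vec_def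
      sum_distrib_left mult_ac)

lemma scaled_proj_mult: "scaled_proj v *v x = (v \<bullet> v) *\<^sub>R x - (v \<bullet> x) *\<^sub>R v"
proof -
  have "(scaled_proj v *v x) $ p = ((v \<bullet> v) *\<^sub>R x - (v \<bullet> x) *\<^sub>R v) $ p" for p
  proof -
    have "(scaled_proj v *v x) $ p = (\<Sum>q\<in>UNIV. (if p = q then (v \<bullet> v) * x $ q else 0) - v $ p * (v $ q * x $ q))"
      unfolding matrix_vector_mult_def vec_lambda_beta
      by (intro sum.cong) (simp_all add: scaled_proj_def left_diff_distrib)
    also have "\<dots> = (v \<bullet> v) * x $ p - v $ p * (v \<bullet> x)"
      by (simp add: sum_subtractf sum.delta inner_vec_def sum_distrib_left[symmetric])
    finally show ?thesis by simp
  qed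
  then show ?thesis by (simp add: Finite_Cartesian_Product.vec_eq_iff)
qed

text \<open>In terms of differences of \<open>x\<close> the diagonal of \<open>pencil\<close> drops
  out. The coefficient 2 is the 3 from differentiating the cube minus the 1 from eliminating the
  diagonal.\<close>

lemma reduced_jacobian_mult:
  "(reduced_jacobian \<phi> t K *v x) $ p =
     (\<Sum>q\<in>UNIV. \<phi> $ p * \<phi> $ q * pencil t K $ p $ q * (x $ q - x $ p)) + 2 * t * \<beta> * (\<phi> $ p) ^ 4 * x $ p"
proof -
  have "(reduced_jacobian \<phi> t K *v x) $ p = (\<Sum>q\<in>UNIV. reduced_jacobian \<phi> t K $ p $ q * x $ q)"
    by (simp add: matrix_vector_mult_def)
  also have "\<dots> = reduced_jacobian \<phi> t K $ p $ p * x $ p + (\<Sum>q\<in>UNIV - {p}. reduced_jacobian \<phi> t K $ p $ q * x $ q)"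
    by (rule sum.remove) auto
  also have "(\<Sum>q\<in>UNIV - {p}. reduced_jacobian \<phi> t K $ p $ q * x $ q) =
      (\<Sum>q\<in>UNIV - {p}. \<phi> $ p * \<phi> $ q * pencil t K $ p $ q * x $ q)"
    by (intro sum.cong) (auto simp: reduced_jacobian_def)
  also have "reduced_jacobian \<phi> t K $ p $ p * x $ p = 2 * t * \<beta> * (\<phi> $ p) ^ 4 * x $ p
      - (\<Sum>q\<in>UNIV - {p}. \<phi> $ p * \<phi> $ q * pencil t K $ p $ q * x $ p)"
    by (simp add: reduced_jacobian_def Compl_eq_Diff_UNIV sum_distrib_right left_diff_distrib)
  finally have "(reduced_jacobian \<phi> t K *v x) $ p =
      (\<Sum>q\<in>UNIV - {p}. \<phi> $ p * \<phi> $ q * pencil t K $ p $ q * (x $ q - x $ p)) + 2 * t * \<beta> * (\<phi> $ p) ^ 4 * x $ p"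
    by (simp add: right_diff_distrib sum_subtractf)
  also have "(\<Sum>q\<in>UNIV - {p}. \<phi> $ p * \<phi> $ q * pencil t K $ p $ q * (x $ q - x $ p)) =
      (\<Sum>q\<in>UNIV. \<phi> $ p * \<phi> $ q * pencil t K $ p $ q * (x $ q - x $ p))"
    by (simp add: sum.remove[of UNIV p])
  finally show ?thesis .
qed

lemma det_eq_0_iff_kernel:
  fixes M :: "real ^ 'p ^ 'p"
  shows "Determinants.det M = 0 \<longleftrightarrow> (\<exists>x. x \<noteq> 0 \<and> M *v x = 0)"
  using invertible_det_nz[of M] invertible_left_inverse[of M] matrix_left_invertible_ker[of M] by blast

lemma polynomial_map_critical_poly: "polynomial_map critical_poly"
proof -
  have c: "polynomial_map (\<lambda>y. vec_part y $ p)" for p :: 'p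
    by (rule polynomial_map_linear) (auto intro!: linearI)
  have t: "polynomial_map (\<lambda>y :: ((real ^ 'p) \<times> real \<times> real) \<times> 'e. time_part y)"
    by (rule polynomial_map_linear) (auto intro!: linearI)
  have a: "polynomial_map (\<lambda>y :: ((real ^ 'p) \<times> real \<times> real) \<times> 'e. A (snd y) $ p $ q)" for p q
    by (rule polynomial_map_linear)
       (auto intro!: linearI simp: linear_add[OF linear_A] linear_scale[OF linear_A])
  have pen: "polynomial_map (\<lambda>y :: ((real ^ 'p) \<times> real \<times> real) \<times> 'e. pencil (time_part y) (snd y) $ p $ q)" for p q
    by (auto simp: pencil_def intro!: polynomial_map_intros a t)
  have sq: "polynomial_map (\<lambda>y :: ((real ^ 'p) \<times> real \<times> real) \<times> 'e. squares (vec_part y) $ p)" for p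
    by (auto simp: squares_def intro!: polynomial_map_intros c)
  have ou: "polynomial_map (\<lambda>y :: ((real ^ 'p) \<times> real \<times> real) \<times> 'e. outer (squares (vec_part y)) $ p $ q)" for p q
    by (auto simp: outer_def intro!: polynomial_map_intros sq)
  have sp: "polynomial_map (\<lambda>y :: ((real ^ 'p) \<times> real \<times> real) \<times> 'e. scaled_proj (squares (vec_part y)) $ p $ q)" for p q
    by (cases "p = q") (auto simp: scaled_proj_def inner_vec_def intro!: polynomial_map_intros sq)
  have rj: "polynomial_map (\<lambda>y :: ((real ^ 'p) \<times> real \<times> real) \<times> 'e.
      reduced_jacobian (vec_part y) (time_part y) (snd y) $ p $ q)" for p q
    by (cases "p = q") (auto simp: reduced_jacobian_def intro!: polynomial_map_intros c t pen)
  show ?thesis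
    unfolding critical_poly_def[abs_def]
    by (rule polynomial_map_det)
       (simp add: matrix_matrix_mult_def, intro polynomial_map_intros sp rj ou)
qed

lemma critical_poly_diagonal_shift:
  assumes "\<And>p q. p \<noteq> q \<Longrightarrow> A K $ p $ q = 0"
  shows "critical_poly (y + (0, K)) = critical_poly y"
proof -
  have "pencil t (L + K) $ p $ q = pencil t L $ p $ q" if "p \<noteq> q" for t L p q
    using assms[OF that] by (simp add: pencil_def linear_add[OF linear_A])
  then have "reduced_jacobian \<phi> t (L + K) = reduced_jacobian \<phi> t L" for \<phi> t L
    unfolding reduced_jacobian_def Finite_Cartesian_Product.vec_eq_iff
    by (auto intro!: sum.cong)
  then show ?thesis by (simp add: critical_poly_def)
qed

lemma critical_poly_eq_0:
  assumes F: "F y = 0" and nz: "\<And>p. vec_part y $ p \<noteq> 0"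
    and crit: "\<not> surj (\<lambda>v. F' y (v, 0))"
  shows "critical_poly y = 0"
proof -
  obtain \<phi> \<mu> t K where y: "y = ((\<phi>, \<mu>, t), K)" by (metis prod.collapse)
  \<comment> \<open>Leaving out the direction of t gives a map between spaces of equal dimension, so
    non-surjectivity produces a kernel vector.\<close>
  define G where "G = (\<lambda>(v, s). F' y ((v, s, 0), 0))"
  have linG: "linear G"
    using linear_compose[of "\<lambda>(v, s). ((v, s, 0), 0)" "F' y"] linear_F'[of y]
    by (auto simp: G_def o_def linear_iff split_beta)
  have "\<not> surj G"
  proof
    assume s: "surj G"
    have "surj (\<lambda>v. F' y (v, 0))"
      unfolding surj_def
    proof
      fix w
      obtain x where "w = G x" using surjD[OF s] by blast
      then show "\<exists>v. w = F' y (v, 0)" by (auto simp: G_def split_beta)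
    qed
    then show False using crit by simp
  qed
  then have "\<not> inj G"
    using linear_injective_imp_surjective[OF linG] by blast
  then obtain x where "x \<noteq> 0" "G x = 0"
    using linear_injective_0[OF linG] by blast
  then obtain v s where vs: "(v, s) \<noteq> 0" "F' y ((v, s, 0), 0) = 0" by (cases x) (auto simp: G_def)
  have nz: "\<phi> $ p \<noteq> 0" for p using nz by (simp add: y)
  have eq: "(pencil t K *v v) $ p + t * \<beta> * 3 * (\<phi> $ p)\<^sup>2 * v $ p - \<mu> * v $ p = s * \<phi> $ p" for p
    using arg_cong[OF vs(2), of "\<lambda>w. fst w $ p"]
    by (simp add: F'_def y pencil_def cube_deriv_def matrix_vector_mult_add_rdistrib
        scaleR_matrix_vector_assoc[symmetric] linear_0[OF linear_A])
  have eq0: "(pencil t K *v \<phi>) $ p + t * \<beta> * (\<phi> $ p) ^ 3 = \<mu> * \<phi> $ p" for p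
    using arg_cong[OF F, of "\<lambda>w. fst w $ p"]
    by (simp add: F_def y pencil_def cube_def matrix_vector_mult_add_rdistrib
        scaleR_matrix_vector_assoc[symmetric])
  have orth: "\<phi> \<bullet> v = 0"
    using arg_cong[OF vs(2), of snd] by (simp add: F'_def y)
  have "v \<noteq> 0"
  proof
    assume "v = 0"
    then have "s * \<phi> $ p = 0" for p using eq[of p] by simp
    then show False using nz vs(1) \<open>v = 0\<close> by (auto simp: zero_prod_def)
  qed
  define x :: "real ^ 'p" where "x = (\<chi> p. v $ p / \<phi> $ p)"
  have vx: "v $ p = \<phi> $ p * x $ p" for p using nz by (simp add: x_def)
  have "x \<noteq> 0"
    using \<open>v \<noteq> 0\<close> vx by (auto simp: Finite_Cartesian_Product.vec_eq_iff)
  \<comment> \<open>Row \<open>p\<close> of the linearized equation is multiplied by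
    \<open>\<phi> $ p\<close>; subtracting a multiple of \<open>eq0\<close> removes the diagonal
    entry of \<open>pencil\<close> together with the eigenvalue.\<close>
  have rj: "reduced_jacobian \<phi> t K *v x = s *\<^sub>R squares \<phi>"
    unfolding Finite_Cartesian_Product.vec_eq_iff
  proof
    fix p
    have "(\<Sum>q\<in>UNIV. \<phi> $ p * \<phi> $ q * pencil t K $ p $ q * (x $ q - x $ p)) =
        \<phi> $ p * ((pencil t K *v v) $ p - x $ p * (pencil t K *v \<phi>) $ p)"
    proof -
      have "\<phi> $ p * ((pencil t K *v v) $ p - x $ p * (pencil t K *v \<phi>) $ p) =
          (\<Sum>q\<in>UNIV. \<phi> $ p * (pencil t K $ p $ q * (\<phi> $ q * x $ q)) - \<phi> $ p * (x $ p * (pencil t K $ p $ q * \<phi> $ q)))"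
        by (simp add: matrix_vector_mult_def vx sum_distrib_left sum_subtractf right_diff_distrib)
      also have "\<dots> = (\<Sum>q\<in>UNIV. \<phi> $ p * \<phi> $ q * pencil t K $ p $ q * (x $ q - x $ p))"
        by (intro sum.cong) (simp_all add: algebra_simps)
      finally show ?thesis by simp
    qed
    also have "\<dots> = \<phi> $ p * (s * \<phi> $ p - t * \<beta> * 3 * (\<phi> $ p)\<^sup>2 * v $ p + \<mu> * v $ p
        - x $ p * (\<mu> * \<phi> $ p - t * \<beta> * (\<phi> $ p) ^ 3))"
    proof -
      have "(pencil t K *v v) $ p = s * \<phi> $ p - t * \<beta> * 3 * (\<phi> $ p)\<^sup>2 * v $ p + \<mu> * v $ p"
        "(pencil t K *v \<phi>) $ p = \<mu> * \<phi> $ p - t * \<beta> * (\<phi> $ p) ^ 3"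
        using eq[of p] eq0[of p] by linarith+
      then show ?thesis by simp
    qed
    finally show "(reduced_jacobian \<phi> t K *v x) $ p = (s *\<^sub>R squares \<phi>) $ p"
      by (simp add: reduced_jacobian_mult squares_def vx algebra_simps power2_eq_square power3_eq_cube power4_eq_xxxx)
  qed
  have orth': "squares \<phi> \<bullet> x = 0"
    using orth by (simp add: inner_vec_def squares_def vx power2_eq_square mult_ac)
  have "scaled_proj (squares \<phi>) *v squares \<phi> = 0" by (simp add: scaled_proj_mult)
  then have "(scaled_proj (squares \<phi>) ** reduced_jacobian \<phi> t K ** scaled_proj (squares \<phi>)
      + outer (squares \<phi>)) *v x = 0"
    using rj orth'
    by (simp add: matrix_vector_mult_add_rdistrib matrix_vector_mul_assoc[symmetric] outer_mult
        scaled_proj_mult[of _ x] matrix_vector_mult_scaleR)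
  then show ?thesis
    using \<open>x \<noteq> 0\<close> by (auto simp: critical_poly_def y det_eq_0_iff_kernel)
qed

text \<open>For symmetric weights the entries of \<open>?R *v x\<close> sum to zero, whereas
  \<open>squares \<phi>\<close> has positive sum. A multiple of the latter in the image must
  therefore be zero; then \<open>conn\<close> makes \<open>x\<close> constant, and orthogonality to
  \<open>squares \<phi>\<close> makes it zero.\<close>

lemma critical_poly_nontrivial:
  assumes nz: "\<And>p. \<phi> $ p \<noteq> 0"
    and sym: "\<And>p q. pencil 0 K $ p $ q = pencil 0 K $ q $ p"
    and conn: "\<And>x :: real ^ 'p. (\<And>p. (\<Sum>q\<in>UNIV. \<phi> $ p * \<phi> $ q * pencil 0 K $ p $ q * (x $ q - x $ p)) = 0) \<Longrightarrow>
        (\<And>p q. x $ p = x $ q)"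
  shows "critical_poly ((\<phi>, \<mu>, 0), K) \<noteq> 0"
proof
  let ?s = "squares \<phi>" and ?R = "reduced_jacobian \<phi> 0 K"
  have pos: "?s $ p > 0" for p using nz by (simp add: squares_def)
  then have sum_pos: "(\<Sum>p\<in>UNIV. ?s $ p) > 0" by (intro sum_pos) auto
  have "?s \<noteq> 0" using pos by (metis less_irrefl zero_index)
  then have ss: "?s \<bullet> ?s \<noteq> 0" by simp
  assume "critical_poly ((\<phi>, \<mu>, 0), K) = 0"
  then obtain x where x: "x \<noteq> 0" "(scaled_proj ?s ** ?R ** scaled_proj ?s + outer ?s) *v x = 0"
    by (auto simp: critical_poly_def det_eq_0_iff_kernel)
  then have eq: "scaled_proj ?s *v (?R *v (scaled_proj ?s *v x)) + (?s \<bullet> x) *\<^sub>R ?s = 0"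
    by (simp add: matrix_vector_mult_add_rdistrib matrix_vector_mul_assoc[symmetric] outer_mult)
  have "?s \<bullet> (scaled_proj ?s *v z) = 0" for z
    by (simp add: scaled_proj_mult inner_diff_right)
  then have "(?s \<bullet> x) * (?s \<bullet> ?s) = 0"
    using arg_cong[OF eq, of "\<lambda>z. ?s \<bullet> z"] by (simp add: inner_add_right)
  then have sx: "?s \<bullet> x = 0" using ss by simp
  have "(?s \<bullet> ?s) *\<^sub>R (scaled_proj ?s *v (?R *v x)) = 0"
    using eq sx by (simp add: scaled_proj_mult[of _ x] matrix_vector_mult_scaleR)
  then have "scaled_proj ?s *v (?R *v x) = 0" using ss by simp
  then have Rx: "(?s \<bullet> ?s) *\<^sub>R (?R *v x) = (?s \<bullet> (?R *v x)) *\<^sub>R ?s"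
    by (simp add: scaled_proj_mult)
  define w where "w p q = \<phi> $ p * \<phi> $ q * pencil 0 K $ p $ q" for p q
  have R: "(?R *v x) $ p = (\<Sum>q\<in>UNIV. w p q * (x $ q - x $ p))" for p
    by (simp add: reduced_jacobian_mult w_def)
  have "(\<Sum>p\<in>UNIV. (?R *v x) $ p) = (\<Sum>p\<in>UNIV. \<Sum>q\<in>UNIV. w p q * x $ q) - (\<Sum>p\<in>UNIV. \<Sum>q\<in>UNIV. w p q * x $ p)"
    by (simp add: R right_diff_distrib sum_subtractf)
  also have "(\<Sum>p\<in>UNIV. \<Sum>q\<in>UNIV. w p q * x $ q) = (\<Sum>q\<in>UNIV. \<Sum>p\<in>UNIV. w p q * x $ q)"
    by (rule sum.swap)
  also have "\<dots> = (\<Sum>p\<in>UNIV. \<Sum>q\<in>UNIV. w p q * x $ p)"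
    using sym by (intro sum.cong) (auto simp: w_def mult_ac)
  finally have sum0: "(\<Sum>p\<in>UNIV. (?R *v x) $ p) = 0" by simp
  have "(?s \<bullet> ?s) * (?R *v x) $ p = (?s \<bullet> (?R *v x)) * ?s $ p" for p
    using arg_cong[OF Rx, of "\<lambda>z. z $ p"] by simp
  then have "(?s \<bullet> ?s) * (\<Sum>p\<in>UNIV. (?R *v x) $ p) = (?s \<bullet> (?R *v x)) * (\<Sum>p\<in>UNIV. ?s $ p)"
    by (simp only: sum_distrib_left)
  then have "?s \<bullet> (?R *v x) = 0" using sum0 sum_pos by simp
  then have "?R *v x = 0" using Rx ss by simp
  then have const: "x $ p = x $ q" for p q
    using R by (intro conn) (simp add: w_def)
  then obtain c where c: "\<And>p. x $ p = c" by metis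
  have "?s \<bullet> x = (\<Sum>p\<in>UNIV. ?s $ p) * c"
    by (simp add: inner_vec_def sum_distrib_right c)
  then have "c = 0" using sx sum_pos by simp
  then have "x = 0" by (simp add: Finite_Cartesian_Product.vec_eq_iff c)
  then show False using x(1) by simp
qed

text \<open>The polynomials of the cover are differentiated only in directions of \<open>B\<close>,
  which fix \<phi> and so are tangent to the sphere; they are invariant under the diagonal parameter
  directions in \<open>W\<close>, which therefore remain free to correct the rows. Both are what
  \<open>negligible_piece\<close> asks for.\<close>

lemma negligible_critical_nonvanishing:
  assumes K0: "\<And>\<phi>. (\<And>p. \<phi> $ p \<noteq> 0) \<Longrightarrow> \<exists>K. critical_poly ((\<phi>, 0, 0), K) \<noteq> 0"
  shows "negligible (snd ` {y. F y = 0 \<and> time_part y \<noteq> 1 \<and> (\<forall>p. vec_part y $ p \<noteq> 0) \<and>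
    \<not> surj (\<lambda>v. F' y (v, 0))})" (is "negligible (snd ` ?S)")
proof -
  define W where "W = {(0 :: (real ^ 'p) \<times> real \<times> real, K) |K. \<forall>p q. p \<noteq> q \<longrightarrow> A K $ p $ q = 0}"
  define B where "B = {b :: ((real ^ 'p) \<times> real \<times> real) \<times> 'e. b \<in> Basis \<and> vec_part b = 0}"
  have spanB: "v \<in> span B" if "vec_part v = 0" for v
  proof -
    have "v = (\<Sum>b\<in>Basis. (v \<bullet> b) *\<^sub>R b)" by (simp add: euclidean_representation)
    also have "\<dots> = (\<Sum>b\<in>B. (v \<bullet> b) *\<^sub>R b)"
    proof (rule sum.mono_neutral_right)
      show "\<forall>b\<in>Basis - B. (v \<bullet> b) *\<^sub>R b = 0"
      proof
        fix b assume b: "b \<in> Basis - B"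
        then have "snd b = 0" "snd (fst b) = 0" by (auto simp: B_def Basis_prod_def)
        then show "(v \<bullet> b) *\<^sub>R b = 0" using that by (simp add: inner_prod_def)
      qed
    qed (auto simp: B_def)
    also have "\<dots> \<in> span B" by (intro span_sum span_scale span_base)
    finally show ?thesis .
  qed
  have BB: "B \<subseteq> Basis" by (auto simp: B_def)
  have inv: "critical_poly (y + w) = critical_poly y" if "w \<in> W" for y w
    using that by (auto simp: W_def intro!: critical_poly_diagonal_shift)
  from polynomial_zero_set_cover[OF polynomial_map_critical_poly inv BB]
  obtain G where G0: "finite G \<and> (\<forall>g\<in>G. polynomial_map g \<and> (\<forall>w\<in>W. \<forall>y. g (y + w) = g y)) \<and>
    (\<forall>y z. critical_poly y = 0 \<and> critical_poly z \<noteq> 0 \<and> z - y \<in> span B \<longrightarrow>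
       (\<exists>g\<in>G. g y = 0 \<and> (\<exists>b\<in>B. frechet_derivative g (at y) b \<noteq> 0)))" ..
  have G: "finite G" "\<And>g. g \<in> G \<Longrightarrow> polynomial_map g"
    "\<And>g w y. g \<in> G \<Longrightarrow> w \<in> W \<Longrightarrow> g (y + w) = g y"
    using conjunct1[OF G0] conjunct1[OF conjunct2[OF G0]] by blast+
  have cover: "\<exists>g\<in>G. g y = 0 \<and> (\<exists>b\<in>B. frechet_derivative g (at y) b \<noteq> 0)"
    if "critical_poly y = 0" "critical_poly z \<noteq> 0" "z - y \<in> span B" for y z
    using conjunct2[OF conjunct2[OF G0]] that by blast
  define S where "S g = {y \<in> ?S. g y = 0 \<and> (\<exists>b\<in>B. frechet_derivative g (at y) b \<noteq> 0)}"
    for g :: "((real ^ 'p) \<times> real \<times> real) \<times> 'e \<Rightarrow> real"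
  have "negligible (snd ` S g)" if g: "g \<in> G" for g
  proof (rule negligible_piece[of g "\<lambda>y. frechet_derivative g (at y)"])
    show "(g has_derivative frechet_derivative g (at y)) (at y)" for y
      by (rule polynomial_map_C1(1)[OF G(2)[OF g]])
    show "continuous_on UNIV (\<lambda>y. frechet_derivative g (at y) v)" for v
      by (rule polynomial_map_C1(2)[OF G(2)[OF g]])
    fix y assume y: "y \<in> S g"
    show "F y = 0 \<and> g y = 0 \<and> time_part y \<noteq> 1" using y by (auto simp: S_def)
    show "\<exists>v. vec_part y \<bullet> vec_part v = 0 \<and> frechet_derivative g (at y) v \<noteq> 0"
      using y by (auto simp: S_def B_def)
    show "\<not> surj (\<lambda>v. (F' y (v, 0), frechet_derivative g (at y) (v, 0)))"
    proof
      assume s: "surj (\<lambda>v. (F' y (v, 0), frechet_derivative g (at y) (v, 0)))"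
      have "\<exists>v. w = F' y (v, 0)" for w
        using surjD[OF s, of "(w, 0)"] by auto
      then have "surj (\<lambda>v. F' y (v, 0))" unfolding surj_def by blast
      then show False using y unfolding S_def by blast
    qed
    fix p
    obtain K where K: "A K *v vec_part y = axis p 1" "\<And>i j. i \<noteq> j \<Longrightarrow> A K $ i $ j = 0"
      using unit_diag[of "vec_part y" p] y by (auto simp: S_def)
    have W: "s *\<^sub>R (0, K) \<in> W" for s
      using K(2) by (auto simp: W_def linear_scale[OF linear_A])
    have "((\<lambda>s :: real. y + s *\<^sub>R w) has_derivative (\<lambda>s. s *\<^sub>R w)) (at 0)" for w
      using has_derivative_add[OF has_derivative_const bounded_linear.has_derivative[OF bounded_linear_scaleR_left has_derivative_ident]]
      by simp
    from has_derivative_compose[OF this[of "(0, K)"] polynomial_map_C1(1)[OF G(2)[OF g]]]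
    have "((\<lambda>s. g (y + s *\<^sub>R (0, K))) has_derivative (\<lambda>s. frechet_derivative g (at y) (s *\<^sub>R (0, K)))) (at 0)"
      by (simp only: scaleR_zero_left add_0_right)
    moreover have "(\<lambda>s. g (y + s *\<^sub>R (0, K))) = (\<lambda>s. g y)"
      using G(3)[OF g W] by blast
    ultimately have "(\<lambda>s. frechet_derivative g (at y) (s *\<^sub>R (0, K))) = (\<lambda>s. 0)"
      using has_derivative_unique has_derivative_const by metis
    then have "frechet_derivative g (at y) (1 *\<^sub>R (0, K)) = 0" by meson
    then show "\<exists>K. A K *v vec_part y = axis p 1 \<and> frechet_derivative g (at y) (0, K) = 0"
      using K(1) by auto
  qed
  then have "negligible (\<Union>g\<in>G. snd ` S g)"
    using G(1) by (intro negligible_Union) auto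
  moreover have "snd ` ?S \<subseteq> (\<Union>g\<in>G. snd ` S g)"
  proof
    fix K assume "K \<in> snd ` ?S"
    then obtain y where y: "K = snd y" "y \<in> ?S" by blast
    \<comment> \<open>The comparison point keeps \<phi> and moves to t = 0, where nontriviality is
      known. As \<open>B\<close> cannot move \<phi>, such a point is needed for each \<phi>
      separately.\<close>
    obtain L where L: "critical_poly ((vec_part y, 0, 0), L) \<noteq> 0" using K0[of "vec_part y"] y(2) by auto
    have sp: "((vec_part y, 0, 0), L) - y \<in> span B" by (rule spanB) simp
    have "F y = 0" "\<And>p. vec_part y $ p \<noteq> 0" "\<not> surj (\<lambda>v. F' y (v, 0))" using y(2) by blast+
    from cover[OF critical_poly_eq_0[OF this] L sp]
    obtain g where "g \<in> G" "y \<in> S g"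
      using y(2) unfolding S_def by blast
    then show "K \<in> (\<Union>g\<in>G. snd ` S g)" using y(1) by blast
  qed
  ultimately show ?thesis by (rule negligible_subset)
qed

text \<open>Besides the nonregular parameters the exceptional set contains those with a tangency to
  the slice t = 0, so that its complement also provides the transversality required for the
  curves.\<close>

theorem negligible_nonregular:
  assumes deg: "\<And>y p. F y = 0 \<Longrightarrow> time_part y \<noteq> 1 \<Longrightarrow> \<not> touched (vec_part y) p \<Longrightarrow>
      \<exists>B C u w. (\<Sum>p\<in>B. vec_part y $ p) = 0 \<and> (\<Sum>p\<in>C. vec_part y $ p) = 0 \<and>
        u \<in> B - C \<and> w \<in> C - B \<and> touched (vec_part y) u \<and> touched (vec_part y) w"
    and K0: "\<And>\<phi>. (\<And>p. \<phi> $ p \<noteq> 0) \<Longrightarrow> \<exists>K. critical_poly ((\<phi>, 0, 0), K) \<noteq> 0"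
  shows "negligible {K. \<exists>x. F (x, K) = 0 \<and> snd (snd x) \<noteq> 1 \<and>
    (\<not> surj (\<lambda>v. F' (x, K) (v, 0)) \<or>
     snd (snd x) = 0 \<and> (\<exists>v. v \<noteq> 0 \<and> snd (snd v) = 0 \<and> F' (x, K) (v, 0) = 0))}"
    (is "negligible ?N")
proof -
  define S1 where "S1 = {y. F y = 0 \<and> time_part y \<noteq> 1 \<and>
     (\<exists>B C u w. (\<Sum>p\<in>B. vec_part y $ p) = 0 \<and> (\<Sum>p\<in>C. vec_part y $ p) = 0 \<and>
        u \<in> B - C \<and> w \<in> C - B \<and> touched (vec_part y) u \<and> touched (vec_part y) w)}"
  define S2 where "S2 = {y. F y = 0 \<and> time_part y = 0 \<and> (\<forall>p. touched (vec_part y) p) \<and>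
     \<not> surj (\<lambda>v. (F' y (v, 0), snd (snd v)))}"
  define S3 where "S3 p = {y. F y = 0 \<and> time_part y \<noteq> 1 \<and> (\<forall>p. touched (vec_part y) p) \<and>
     vec_part y $ p = 0 \<and> \<not> surj (\<lambda>v. F' y (v, 0))}" for p
  define S4 where "S4 = {y. F y = 0 \<and> time_part y \<noteq> 1 \<and> (\<forall>p. vec_part y $ p \<noteq> 0) \<and>
    \<not> surj (\<lambda>v. F' y (v, 0))}"
  have "negligible (snd ` S1)" "negligible (snd ` S2)" "\<And>p. negligible (snd ` S3 p)" "negligible (snd ` S4)"
    unfolding S1_def S2_def S3_def S4_def
    by (rule negligible_degenerate negligible_time_critical negligible_vanishing_component
          negligible_critical_nonvanishing[OF K0], assumption?)+
  then have "negligible (snd ` S1 \<union> snd ` S2 \<union> (\<Union>p. snd ` S3 p) \<union> snd ` S4)"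
    by (intro negligible_Un negligible_Union finite_imageI) auto
  moreover have "?N \<subseteq> snd ` S1 \<union> snd ` S2 \<union> (\<Union>p. snd ` S3 p) \<union> snd ` S4"
  proof
    fix K assume "K \<in> ?N"
    from CollectD[OF this] obtain x where x0: "F (x, K) = 0 \<and> snd (snd x) \<noteq> 1 \<and>
      (\<not> surj (\<lambda>v. F' (x, K) (v, 0)) \<or>
        snd (snd x) = 0 \<and> (\<exists>v. v \<noteq> 0 \<and> snd (snd v) = 0 \<and> F' (x, K) (v, 0) = 0))" ..
    note x = x0[THEN conjunct1] x0[THEN conjunct2, THEN conjunct1] x0[THEN conjunct2, THEN conjunct2]
    let ?y = "(x, K)"
    have "?y \<in> S1 \<union> S2 \<union> (\<Union>p. S3 p) \<union> S4"
    proof (cases "\<forall>p. touched (vec_part ?y) p")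
      case False
      then obtain p where "\<not> touched (vec_part ?y) p" by blast
      from deg[OF x(1) _ this] have "?y \<in> S1" using x(1,2) by (simp add: S1_def)
      then show ?thesis by blast
    next
      case touched: True
      show ?thesis
      proof (cases "surj (\<lambda>v. F' (x, K) (v, 0))")
        case False
        then show ?thesis
          using x(1,2) touched by (cases "\<forall>p. vec_part ?y $ p \<noteq> 0") (auto simp: S3_def S4_def)
      next
        case True
        then obtain v where v: "snd (snd x) = 0" "v \<noteq> 0" "snd (snd v) = 0" "F' (x, K) (v, 0) = 0"
          using x(3) by blast
        \<comment> \<open>Adjoining the time component makes the map equidimensional; a tangent
          vector inside the slice lies in its kernel.\<close>
        define G where "G = (\<lambda>v. (F' ?y (v, 0), snd (snd v)))"
        have linG: "linear G"
          using linear_F'[of ?y] linear_compose[of "\<lambda>v. (v, 0)" "F' ?y"]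
          by (auto simp: G_def o_def linear_iff)
        have "G v = 0" using v(3,4) by (simp add: G_def prod_eq_iff)
        then have "\<not> inj G" using v(2) linear_injective_0[OF linG] by blast
        then have "\<not> surj G"
          using linear_surjective_imp_injective[OF linG] by auto
        then have "?y \<in> S2" using x(1) v(1) touched by (simp add: S2_def G_def)
        then show ?thesis by blast
      qed
    qed
    then have "snd ?y \<in> snd ` (S1 \<union> S2 \<union> (\<Union>p. S3 p) \<union> S4)" by (rule imageI)
    then show "K \<in> snd ` S1 \<union> snd ` S2 \<union> (\<Union>p. snd ` S3 p) \<union> snd ` S4"
      by (simp only: image_Un image_UN snd_conv)
  qed
  ultimately show ?thesis by (rule negligible_subset)
qed

section \<open>The zero set for a fixed parameter\<close>

definition slice :: "'e \<Rightarrow> (real ^ 'p) \<times> real \<times> real \<Rightarrow> (real ^ 'p) \<times> real" where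
  "slice K x = F (x, K)"

definition slice' :: "'e \<Rightarrow> (real ^ 'p) \<times> real \<times> real \<Rightarrow> (real ^ 'p) \<times> real \<times> real \<Rightarrow> (real ^ 'p) \<times> real" where
  "slice' K x v = F' (x, K) (v, 0)"

lemma has_derivative_slice: "(slice K has_derivative slice' K x) (at x)"
  unfolding slice_def[abs_def] slice'_def[abs_def]
  by (rule has_derivative_compose[OF has_derivative_Pair[OF has_derivative_ident has_derivative_const] has_derivative_F])

lemma continuous_on_slice': "continuous_on UNIV (\<lambda>x. slice' K x v)"
  unfolding slice'_def
  by (rule continuous_on_compose2[OF continuous_on_F']) (auto intro!: continuous_intros)

lemma bounded_slice_zeros: "bounded {x \<in> homotopy_dom. slice K x = 0}"
proof -
  \<comment> \<open>Pairing the first equation with \<phi> expresses the eigenvalue as a Rayleigh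
    quotient with denominator \<rho>. Including t = 1 makes the domain compact.\<close>
  define g where "g = (\<lambda>(\<phi> :: real ^ 'p, t). (\<phi>, (\<phi> \<bullet> ((1 - t) *\<^sub>R (A K *v \<phi>) + D *v \<phi> + (t * \<beta>) *\<^sub>R cube \<phi>)) / \<rho>, t))"
  have "compact ((sphere 0 (sqrt \<rho>) :: (real ^ 'p) set) \<times> {0..1::real})"
    by (intro compact_Times) auto
  moreover have "continuous_on (sphere 0 (sqrt \<rho>) \<times> {0..1}) g"
    unfolding g_def split_beta
    by (intro continuous_intros continuous_on_compose2[OF linear_continuous_on[OF matrix_vector_mul_bounded_linear]])
       (use \<rho>_pos in auto)
  ultimately have "bounded (g ` (sphere 0 (sqrt \<rho>) \<times> {0..1}))"
    using compact_continuous_image compact_imp_bounded by blast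
  moreover have "{x \<in> homotopy_dom. slice K x = 0} \<subseteq> g ` (sphere 0 (sqrt \<rho>) \<times> {0..1})"
  proof
    fix x assume x: "x \<in> {x \<in> homotopy_dom. slice K x = 0}"
    obtain \<phi> \<mu> t where xe: "x = (\<phi>, \<mu>, t)" by (cases x)
    have F0: "F (x, K) = 0" using x by (simp add: slice_def)
    have \<phi>: "\<phi> \<bullet> \<phi> = \<rho>" using zero_norm[OF F0] by (simp add: xe)
    have "(1 - t) *\<^sub>R (A K *v \<phi>) + D *v \<phi> + (t * \<beta>) *\<^sub>R cube \<phi> = \<mu> *\<^sub>R \<phi>"
      using arg_cong[OF F0, of fst] by (simp add: F_def xe)
    then have "g (\<phi>, t) = x" using \<phi> \<rho>_pos by (simp add: g_def xe)
    moreover have "\<phi> \<in> sphere 0 (sqrt \<rho>)" using \<phi> by (simp add: norm_eq_sqrt_inner)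
    moreover have "t \<in> {0..1}" using x by (auto simp: homotopy_dom_def xe)
    ultimately show "x \<in> g ` (sphere 0 (sqrt \<rho>) \<times> {0..1})" by blast
  qed
  ultimately show ?thesis using bounded_subset by blast
qed

end

subsection \<open>The grid\<close>

lemma pos_less: "i < j \<Longrightarrow> pos i < pos j"
  unfolding pos_def by (rule psubset_card_mono) (auto simp: less_le_not_le)

lemma pos_eq_iff [simp]: "pos i = pos j \<longleftrightarrow> i = j"
  using pos_less by (metis linorder_neqE less_irrefl)

lemma bij_betw_pos: "bij_betw pos (UNIV :: 'a::{finite,linorder} set) {1..CARD('a)}"
proof -
  have "pos i \<in> {1..CARD('a)}" for i :: 'a
    unfolding pos_def by (auto simp: card_gt_0_iff Suc_le_eq intro!: card_mono)
  then have "pos ` (UNIV :: 'a set) \<subseteq> {1..CARD('a)}" by blast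
  moreover have "card (pos ` (UNIV :: 'a set)) = CARD('a)"
    by (rule card_image) (simp add: inj_on_def)
  ultimately have "pos ` (UNIV :: 'a set) = {1..CARD('a)}"
    using card_subset_eq[of "{1..CARD('a)}" "pos ` (UNIV :: 'a set)"] by simp
  then show ?thesis by (simp add: bij_betw_def inj_on_def)
qed

lemma pos_bounds: fixes i :: "'a::{finite,linorder}" shows "1 \<le> pos i" "pos i \<le> CARD('a)"
  using bij_betwE[OF bij_betw_pos[where 'a = 'a]] by auto

lemma obtain_pos:
  assumes "1 \<le> r" "r \<le> CARD('a)"
  obtains i :: "'a::{finite,linorder}" where "pos i = r"
  using assms bij_betw_pos[where 'a = 'a] unfolding bij_betw_def
  by (metis atLeastAtMost_iff imageE)

definition adjacent :: "'a::{finite,linorder} \<Rightarrow> 'a \<Rightarrow> bool" where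
  "adjacent i j \<longleftrightarrow> pos j = pos i + 1 \<or> pos i = pos j + 1"

lemma adjacent_sym: "adjacent i j \<longleftrightarrow> adjacent j i"
  by (auto simp: adjacent_def)

lemma adjacent_irrefl [simp]: "\<not> adjacent i i"
  by (auto simp: adjacent_def)

lemma adjacent_induct:
  fixes i j :: "'a::{finite,linorder}"
  assumes "P i" and step: "\<And>i j. P i \<Longrightarrow> adjacent i j \<Longrightarrow> P j"
  shows "P j"
proof -
  have up: "pos k = pos i + d \<Longrightarrow> P k" for d k
  proof (induction d arbitrary: k)
    case (Suc d)
    obtain l :: 'a where l: "pos l = pos i + d"
      by (rule obtain_pos[of "pos i + d"]) (use pos_bounds[of i] pos_bounds[of k] Suc.prems in auto)
    then show ?case using Suc step[of l k] by (auto simp: adjacent_def)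
  qed (use assms in simp)
  have down: "pos i = pos k + d \<Longrightarrow> P k" for d k
  proof (induction d arbitrary: k)
    case (Suc d)
    obtain l :: 'a where l: "pos l = pos k + 1"
      by (rule obtain_pos[of "pos k + 1"]) (use pos_bounds[of i] Suc.prems in auto)
    then show ?case using Suc step[of l k] by (auto simp: adjacent_def)
  qed (use assms in simp)
  show ?thesis
    using up[of j "pos j - pos i"] down[of j "pos i - pos j"] by linarith
qed

lemma adjacent_exists:
  fixes i :: "'a::{finite,linorder}"
  assumes "CARD('a) \<ge> 2"
  obtains j where "adjacent i j"
proof (cases "pos i = 1")
  case True
  obtain j :: 'a where "pos j = 2" by (rule obtain_pos[of 2]) (use assms in auto)
  then have "adjacent i j" using True by (simp add: adjacent_def)
  then show ?thesis by (rule that)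
next
  case False
  obtain j :: 'a where "pos j = pos i - 1"
    by (rule obtain_pos[of "pos i - 1"]) (use False pos_bounds[of i] in auto)
  then have "adjacent i j" using False pos_bounds[of i] by (auto simp: adjacent_def)
  then show ?thesis by (rule that)
qed

lemma sum_single:
  fixes f :: "'a::finite \<Rightarrow> 'b::comm_monoid_add"
  assumes "\<And>q. q \<noteq> q0 \<Longrightarrow> f q = 0"
  shows "sum f UNIV = f q0"
  using assms by (subst sum.remove[of _ q0]) auto

section \<open>Entries of the block matrices\<close>

lemma K_entry_axis:
  "pos r0 = r \<Longrightarrow> K_entry K i r = K $ i $ r0"
  by (auto simp: K_entry_def)

lemma K_entry_linear:
  "K_entry (K + L) i r = K_entry K i r + K_entry L i r"
  "K_entry (s *\<^sub>R K) i r = s * K_entry K i r"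
  by (simp_all add: K_entry_def)

lemma linear_A_matrix: "linear A_matrix"
  by (rule linearI)
     (auto simp: A_matrix_def Finite_Cartesian_Product.vec_eq_iff K_entry_linear split: prod.splits)

lemma A_matrix_entry:
  "A_matrix K $ (i, j) $ (k, l) = (if k = i then
     (if l = j then K_entry K i (2 * pos j - 1)
      else if pos l = pos j + 1 then K_entry K i (2 * pos j)
      else if pos j = pos l + 1 then K_entry K i (2 * pos l) else 0) else 0)"
  by (simp add: A_matrix_def)

lemma A_matrix_unit:
  fixes i0 :: "'m::{finite,linorder}" and j0 :: "'n::{finite,linorder}" and r0 :: "'k::{finite,linorder}"
  assumes "CARD('k) = 2 * CARD('n) - 1"
  shows "A_matrix (axis i0 (axis r0 1) :: real ^ 'k::{finite,linorder} ^ 'm::{finite,linorder}) $ (i, j :: 'n) $ (k, l) =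
    (if k = i \<and> i = i0 \<and> (l = j \<and> pos r0 = 2 * pos j - 1 \<or> pos l = pos j + 1 \<and> pos r0 = 2 * pos j \<or>
       pos j = pos l + 1 \<and> pos r0 = 2 * pos l) then 1 else 0)"
proof -
  \<comment> \<open>The range is essential: outside \<open>{1..CARD('k)}\<close> no place exists and
    the description in \<open>K_entry\<close> is arbitrary.\<close>
  have e: "K_entry (axis i0 (axis r0 1) :: real ^ 'k::{finite,linorder} ^ 'm::{finite,linorder}) i r = (if i = i0 \<and> pos r0 = r then 1 else 0)"
    if r: "1 \<le> r" "r \<le> CARD('k)" for r
  proof -
    obtain r1 :: 'k where r1: "pos r1 = r" using obtain_pos[OF r] .
    then show ?thesis by (simp add: K_entry_axis[OF r1] axis_def) (metis pos_eq_iff)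
  qed
  have b: "1 \<le> pos j" "1 \<le> pos l" "pos j \<le> CARD('n)" "pos l \<le> CARD('n)"
    by (rule pos_bounds)+
  consider "k \<noteq> i" | "k = i" "l = j" | "k = i" "pos l = pos j + 1" | "k = i" "pos j = pos l + 1"
    | "k = i" "l \<noteq> j" "pos l \<noteq> pos j + 1" "pos j \<noteq> pos l + 1" by blast
  then show ?thesis
  proof cases
    case 2
    moreover have "1 \<le> 2 * pos j - 1" "2 * pos j - 1 \<le> CARD('k)" using b assms by linarith+
    ultimately show ?thesis by (simp add: A_matrix_entry e)
  next
    case 3
    moreover have "1 \<le> 2 * pos j" "2 * pos j \<le> CARD('k)" "l \<noteq> j" using b assms 3 by auto
    ultimately show ?thesis by (simp add: A_matrix_entry e)
  next
    case 4
    moreover have "1 \<le> 2 * pos l" "2 * pos l \<le> CARD('k)" "l \<noteq> j" using b assms 4 by auto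
    ultimately show ?thesis by (simp add: A_matrix_entry e)
  qed (simp_all add: A_matrix_entry)
qed

lemma mesh_pos: "lo < hi \<Longrightarrow> mesh N lo hi > 0"
  by (simp add: mesh_def)

lemma eigen_homotopy_grid:
  assumes "a < b" "c < d" "CARD('k::{finite,linorder}) = 2 * CARD('n::{finite,linorder}) - 1"
  shows "eigen_homotopy (A_matrix :: real ^ 'k::{finite,linorder} ^ 'm::{finite,linorder} \<Rightarrow>
      real ^ ('m \<times> 'n::{finite,linorder}) ^ ('m \<times> 'n))
    (1 / (mesh CARD('m) a b * mesh CARD('n) c d))"
proof (rule eigen_homotopy.intro)
  show "linear (A_matrix :: real ^ 'k::{finite,linorder} ^ 'm::{finite,linorder} \<Rightarrow>
      real ^ ('m \<times> 'n::{finite,linorder}) ^ ('m \<times> 'n))"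
    by (rule linear_A_matrix)
  show "0 < 1 / (mesh CARD('m) a b * mesh CARD('n) c d)"
    using assms mesh_pos by (simp add: mesh_pos)
  fix p :: "'m \<times> 'n"
  obtain i0 j0 where p: "p = (i0, j0)" by (cases p)
  have "1 \<le> 2 * pos j0 - 1" "2 * pos j0 - 1 \<le> CARD('k)"
    using pos_bounds[of j0] assms(3) by linarith+
  then obtain r0 :: 'k where r0: "pos r0 = 2 * pos j0 - 1" by (rule obtain_pos)
  have "A_matrix (axis i0 (axis r0 1) :: real ^ 'k::{finite,linorder} ^ 'm::{finite,linorder}) $ (i, j) $ (k, l) =
      (if (i, j) = p \<and> (k, l) = p then 1 else 0)" for i k and j l :: 'n
  proof -
    have "2 * pos j0 - 1 = 2 * pos j - 1 \<longleftrightarrow> pos j0 = pos j" for j :: 'n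
      using pos_bounds(1)[of j0] pos_bounds(1)[of j] by linarith
    then have "2 * pos j0 - 1 = 2 * pos j - 1 \<longleftrightarrow> j0 = j" for j by simp
    moreover have "2 * pos j0 - 1 \<noteq> 2 * r" for r using pos_bounds[of j0] by presburger
    ultimately show ?thesis by (auto simp: A_matrix_unit[OF assms(3)] r0 p)
  qed
  then show "\<exists>K :: real ^ 'k::{finite,linorder} ^ 'm::{finite,linorder}. \<forall>i j. A_matrix K $ i $ j = (if i = p \<and> j = p then 1 else 0)"
    by (intro exI[of _ "axis i0 (axis r0 1)"]) auto
qed

lemma D_matrix_entry:
  "D_matrix a b c d $ (i :: 'm::{finite,linorder}, j :: 'n::{finite,linorder}) $ (k, l) =
    (if k = i then
       (if l = j then 1 / (mesh CARD('m) a b)\<^sup>2 + 1 / (mesh CARD('n) c d)\<^sup>2 + v_grid a b c d i j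
        else if adjacent j l then - (1 / (2 * (mesh CARD('n) c d)\<^sup>2)) else 0)
     else if adjacent i k \<and> l = j then - (1 / (2 * (mesh CARD('m) a b)\<^sup>2)) else 0)"
  by (auto simp: D_matrix_def Let_def adjacent_def field_simps)

lemma A_matrix_sym:
  "A_matrix K $ p $ q = A_matrix K $ q $ (p :: 'm::{finite,linorder} \<times> 'n::{finite,linorder})"
  by (cases p; cases q) (auto simp: A_matrix_entry)

lemma D_matrix_sym:
  "D_matrix a b c d $ p $ q = D_matrix a b c d $ q $ (p :: 'm::{finite,linorder} \<times> 'n::{finite,linorder})"
  by (cases p; cases q) (auto simp: D_matrix_entry adjacent_sym)

lemma A_matrix_offdiag_zero:
  "A_matrix K $ (i, j) $ (k, l) \<noteq> 0 \<Longrightarrow> k = i \<and> (l = j \<or> adjacent j l)"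
  by (auto simp: A_matrix_entry adjacent_def split: if_splits)

text \<open>The parameter at place \<open>2 * min (pos j) (pos l)\<close> fills the symmetric pair
  of entries coupling \<open>j\<close> and \<open>l\<close>. Applied to \<phi> it would move both
  rows, but row \<open>l\<close> receives the factor \<open>\<phi> $ (i, j) = 0\<close>.\<close>

lemma A_matrix_reach:
  fixes \<phi> :: "real ^ ('m::{finite,linorder} \<times> 'n::{finite,linorder})"
  assumes card: "CARD('k::{finite,linorder}) = 2 * CARD('n) - 1"
    and adj: "adjacent j l" and \<phi>: "\<phi> $ (i, j) = 0" "\<phi> $ (i, l) \<noteq> 0"
  shows "\<exists>K :: real ^ 'k::{finite,linorder} ^ 'm::{finite,linorder}. A_matrix K *v \<phi> = axis (i, j) 1"
proof -
  have "1 \<le> 2 * min (pos j) (pos l)" "2 * min (pos j) (pos l) \<le> CARD('k)"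
    using adj pos_bounds[of j] pos_bounds[of l] card by (auto simp: adjacent_def)
  then obtain r0 :: 'k where r0: "pos r0 = 2 * min (pos j) (pos l)" by (rule obtain_pos)
  define L :: "real ^ 'k::{finite,linorder} ^ 'm::{finite,linorder}" where "L = axis i (axis r0 1)"
  have entry: "A_matrix L $ (i', j') $ (k, l') =
      (if i' = i \<and> k = i \<and> (j' = j \<and> l' = l \<or> j' = l \<and> l' = j) then 1 else 0)" for i' k j' l'
  proof -
    have odd: "pos r0 \<noteq> 2 * pos j' - 1" using r0 pos_bounds[of j'] by presburger
    have "pos l = pos j + 1 \<and> pos r0 = 2 * pos j \<or> pos j = pos l + 1 \<and> pos r0 = 2 * pos l"
      using adj r0 by (auto simp: adjacent_def)
    then have "(pos l' = pos j' + 1 \<and> pos r0 = 2 * pos j' \<or> pos j' = pos l' + 1 \<and> pos r0 = 2 * pos l') \<longleftrightarrow>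
        (pos j' = pos j \<and> pos l' = pos l \<or> pos j' = pos l \<and> pos l' = pos j)"
      by presburger
    then have pat: "(l' = j' \<and> pos r0 = 2 * pos j' - 1 \<or> pos l' = pos j' + 1 \<and> pos r0 = 2 * pos j' \<or>
        pos j' = pos l' + 1 \<and> pos r0 = 2 * pos l') \<longleftrightarrow> (j' = j \<and> l' = l \<or> j' = l \<and> l' = j)"
      using odd unfolding pos_eq_iff by blast
    show ?thesis
      unfolding L_def A_matrix_unit[OF card] pat by auto
  qed
  have "(A_matrix ((1 / \<phi> $ (i, l)) *\<^sub>R L) *v \<phi>) $ p = axis (i, j) 1 $ p" for p
  proof -
    obtain i' j' where p: "p = (i', j')" by (cases p)
    have jl: "j \<noteq> l" using adj by auto
    have "(A_matrix L *v \<phi>) $ p = (\<Sum>q\<in>UNIV. A_matrix L $ p $ q * \<phi> $ q)"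
      by (simp add: matrix_vector_mult_def)
    also have "\<dots> = A_matrix L $ p $ (i, l) * \<phi> $ (i, l)"
    proof (rule sum_single)
      fix q assume q: "q \<noteq> (i, l)"
      obtain k l' where "q = (k, l')" by (cases q)
      then show "A_matrix L $ p $ q * \<phi> $ q = 0"
        using q \<phi> by (auto simp: p entry)
    qed
    also have "\<dots> = (if p = (i, j) then \<phi> $ (i, l) else 0)"
      using jl by (simp add: p entry)
    finally show ?thesis
      using \<phi>(2) by (simp add: linear_scale[OF linear_A_matrix] scaleR_matrix_vector_assoc[symmetric] axis_def)
  qed
  then have "A_matrix ((1 / \<phi> $ (i, l)) *\<^sub>R L) *v \<phi> = axis (i, j) 1"
    unfolding Finite_Cartesian_Product.vec_eq_iff by blast
  then show ?thesis by blast
qed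

lemma A_matrix_row_zero:
  fixes \<phi> :: "real ^ ('m::{finite,linorder} \<times> 'n::{finite,linorder})"
  assumes "\<phi> $ (i, j) = 0" "\<And>l. adjacent j l \<Longrightarrow> \<phi> $ (i, l) = 0"
  shows "(A_matrix K *v \<phi>) $ (i, j) = 0"
proof -
  have "A_matrix K $ (i, j) $ q * \<phi> $ q = 0" for q
    using A_matrix_offdiag_zero[of K i j "fst q" "snd q"] assms by (cases q) auto
  then show ?thesis
    unfolding matrix_vector_mult_def vec_lambda_beta by (intro sum.neutral) blast
qed

text \<open>The potential, the diagonal and the coupling inside the block meet only zeros of \<phi>;
  the links to the adjacent blocks all have the same coefficient.\<close>

lemma D_matrix_row_sum:
  fixes \<phi> :: "real ^ ('m::{finite,linorder} \<times> 'n::{finite,linorder})"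
  assumes "\<phi> $ (i, j) = 0" "\<And>l. adjacent j l \<Longrightarrow> \<phi> $ (i, l) = 0"
  shows "(D_matrix a b c d *v \<phi>) $ (i, j) =
    - (1 / (2 * (mesh CARD('m) a b)\<^sup>2)) * (\<Sum>k | adjacent i k. \<phi> $ (k, j))"
proof -
  let ?N = "(\<lambda>k. (k, j)) ` {k. adjacent i k}"
  have "(D_matrix a b c d *v \<phi>) $ (i, j) = (\<Sum>q\<in>UNIV. D_matrix a b c d $ (i, j) $ q * \<phi> $ q)"
    by (simp add: matrix_vector_mult_def)
  also have "\<dots> = (\<Sum>q\<in>?N. D_matrix a b c d $ (i, j) $ q * \<phi> $ q)"
  proof (rule sum.mono_neutral_right)
    show "\<forall>q\<in>UNIV - ?N. D_matrix a b c d $ (i, j) $ q * \<phi> $ q = 0"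
    proof
      fix q assume q: "q \<in> UNIV - ?N"
      obtain k l where kl: "q = (k, l)" by (cases q)
      then have "\<not> (adjacent i k \<and> l = j)" using q by auto
      then show "D_matrix a b c d $ (i, j) $ q * \<phi> $ q = 0"
        using assms by (auto simp: kl D_matrix_entry)
    qed
  qed auto
  also have "\<dots> = (\<Sum>k | adjacent i k. D_matrix a b c d $ (i, j) $ (k, j) * \<phi> $ (k, j))"
    by (subst sum.reindex) (auto simp: inj_on_def)
  also have "\<dots> = (\<Sum>k | adjacent i k. - (1 / (2 * (mesh CARD('m) a b)\<^sup>2)) * \<phi> $ (k, j))"
    by (intro sum.cong) (auto simp: D_matrix_entry)
  finally show ?thesis by (simp add: sum_distrib_left)
qed

section \<open>Zero patterns of eigenvectors on the grid\<close>

text \<open>Here \<open>t\<close> abstracts \<open>touched\<close>. Two kinds of equations are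
  available: single touched zeros, and sums over \<open>E i j\<close>, valid where
  \<open>U i j\<close> holds. A nonzero summand is touched and can serve as the private element of
  its sum. The search starts at an untouched point and depends on whether its block is entirely
  zero.\<close>

lemma grid_degenerate:
  fixes \<phi> :: "real ^ ('m::{finite,linorder} \<times> 'n::{finite,linorder})"
  assumes m: "CARD('m) \<ge> 2" and n: "CARD('n) \<ge> 2" and nz: "\<phi> \<noteq> 0"
    and reach: "\<And>p. \<phi> $ p \<noteq> 0 \<Longrightarrow> t p" "\<And>i j l. adjacent j l \<Longrightarrow> \<phi> $ (i, l) \<noteq> 0 \<Longrightarrow> t (i, j)"
    and row: "\<And>i j. \<phi> $ (i, j) = 0 \<Longrightarrow> (\<And>l. adjacent j l \<Longrightarrow> \<phi> $ (i, l) = 0) \<Longrightarrow>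
      (\<Sum>k | adjacent i k. \<phi> $ (k, j)) = 0"
    and ex: "\<not> t p0"
  shows "\<exists>B C u w. (\<Sum>p\<in>B. \<phi> $ p) = 0 \<and> (\<Sum>p\<in>C. \<phi> $ p) = 0 \<and> u \<in> B - C \<and> w \<in> C - B \<and> t u \<and> t w"
proof -
  define E where "E i j = (\<lambda>k. (k, j)) ` {k. adjacent i k}" for i :: 'm and j :: 'n
  define U where "U i j \<longleftrightarrow> \<phi> $ (i, j) = 0 \<and> (\<forall>l. adjacent j l \<longrightarrow> \<phi> $ (i, l) = 0)" for i j
  have sumE: "(\<Sum>p\<in>E i j. \<phi> $ p) = 0" if "U i j" for i j
    unfolding E_def using row[of i j] that by (subst sum.reindex) (auto simp: inj_on_def U_def)
  \<comment> \<open>An index has at most two neighbours, so a nonzero summand must be cancelled by a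
    second one. Hence a zero of \<phi> never lies in such a sum, which keeps the conditions
    independent in \<open>point_edge\<close>.\<close>
  have edge: "\<phi> $ (k', j) \<noteq> 0" if "U i j" "adjacent i k" "\<phi> $ (k, j) \<noteq> 0" "adjacent i k'" for i j k k'
  proof
    assume 0: "\<phi> $ (k', j) = 0"
    have "k'' = k \<or> k'' = k'" if "adjacent i k''" for k''
    proof -
      have "k \<noteq> k'" using 0 \<open>\<phi> $ (k, j) \<noteq> 0\<close> by auto
      then have "pos k \<noteq> pos k'" by simp
      then have "pos k'' = pos k \<or> pos k'' = pos k'"
        using that \<open>adjacent i k\<close> \<open>adjacent i k'\<close> unfolding adjacent_def by linarith
      then show ?thesis by simp
    qed
    then have "(\<Sum>k | adjacent i k. \<phi> $ (k, j)) = (\<Sum>k\<in>{k}. \<phi> $ (k, j))"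
      using 0 that(2) by (intro sum.mono_neutral_right) auto
    then show False using row[of i j] that(1,3) by (simp add: U_def)
  qed
  have point_point: ?thesis if "\<phi> $ p = 0" "t p" "\<phi> $ q = 0" "t q" "p \<noteq> q" for p q
    using that by (intro exI[of _ "{p}"] exI[of _ "{q}"] exI[of _ p] exI[of _ q]) auto
  have point_edge: ?thesis if "\<phi> $ p = 0" "t p" "U i j" "adjacent i k" "\<phi> $ (k, j) \<noteq> 0" for p i j k
  proof -
    have "p \<notin> E i j" using edge[OF that(3-5)] that(1) by (auto simp: E_def)
    moreover have "(k, j) \<in> E i j - {p}" using that by (auto simp: E_def)
    ultimately show ?thesis
      using that sumE[OF that(3)] reach(1)[OF that(5)]
      by (intro exI[of _ "{p}"] exI[of _ "E i j"] exI[of _ p] exI[of _ "(k, j)"]) auto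
  qed
  \<comment> \<open>On the way from a zero to a nonzero entry of the same block, the last zero is
    next to a nonzero entry and hence touched.\<close>
  have border: "\<exists>j'. \<phi> $ (i, j') = 0 \<and> t (i, j')" if "\<phi> $ (i, j) = 0" "\<phi> $ (i, l) \<noteq> 0" for i j l
  proof (rule ccontr)
    assume no: "\<not> ?thesis"
    have "\<phi> $ (i, l) = 0"
      using that(1)
    proof (rule adjacent_induct[of "\<lambda>j. \<phi> $ (i, j) = 0"])
      fix j l assume "\<phi> $ (i, j) = 0" "adjacent j l"
      then show "\<phi> $ (i, l) = 0" using no reach(2)[of j l i] by blast
    qed
    then show False using that(2) by simp
  qed
  obtain i0 j0 where p0: "p0 = (i0, j0)" by (cases p0)
  have U0: "U i0 j0" using ex reach unfolding U_def p0 by blast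
  show ?thesis
  proof (cases "\<forall>l. \<phi> $ (i0, l) = 0")
    case False
    then obtain l0 where l0: "\<phi> $ (i0, l0) \<noteq> 0" by blast
    then obtain j' where p: "\<phi> $ (i0, j') = 0" "t (i0, j')" using border[of i0 j0 l0] U0 l0 by (auto simp: U_def)
    obtain k where k: "adjacent i0 k" using adjacent_exists[OF m] .
    show ?thesis
    proof (cases "\<phi> $ (k, j0) = 0")
      case False
      then show ?thesis by (rule point_edge[OF p U0 k])
    next
      case True
      show ?thesis
      proof (cases "\<forall>l. \<phi> $ (k, l) = 0")
        case True
        \<comment> \<open>In a zero block every position carries a sum equation; the one facing the
          nonzero entry \<open>(i0, l0)\<close> has a nonzero summand.\<close>
        then have "U k l0" by (simp add: U_def)
        moreover have "adjacent k i0" using k adjacent_sym by blast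
        ultimately show ?thesis by (rule point_edge[OF p _ _ l0])
      next
        case False
        then obtain j'' where "\<phi> $ (k, j'') = 0" "t (k, j'')" using border True by blast
        moreover have "(i0, j') \<noteq> (k, j'')" using k by auto
        ultimately show ?thesis by (rule point_point[OF p])
      qed
    qed
  next
    case full: True
    have "\<exists>r r'. adjacent r r' \<and> (\<forall>l. \<phi> $ (r, l) = 0) \<and> \<not> (\<forall>l. \<phi> $ (r', l) = 0)"
    proof (rule ccontr)
      assume no: "\<not> ?thesis"
      have "\<forall>l. \<phi> $ (r, l) = 0" for r
      proof (rule adjacent_induct[of "\<lambda>r. \<forall>l. \<phi> $ (r, l) = 0"])
        show "\<forall>l. \<phi> $ (i0, l) = 0" by (rule full)
        fix r r' assume "\<forall>l. \<phi> $ (r, l) = 0" "adjacent r r'"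
        then show "\<forall>l. \<phi> $ (r', l) = 0" using no by blast
      qed
      then show False using nz by (auto simp: Finite_Cartesian_Product.vec_eq_iff)
    qed
    then obtain r r' l where r: "adjacent r r'" "\<And>l. \<phi> $ (r, l) = 0" "\<phi> $ (r', l) \<noteq> 0" by blast
    have U: "U r l'" for l' using r(2) by (simp add: U_def)
    obtain l' where l': "adjacent l l'" using adjacent_exists[OF n] .
    show ?thesis
    proof (cases "\<phi> $ (r', l') = 0")
      case True
      then obtain j' where "\<phi> $ (r', j') = 0" "t (r', j')" using border r(3) by blast
      then show ?thesis by (rule point_edge[OF _ _ U r(1) r(3)])
    next
      case False
      \<comment> \<open>The two sums run over different second indices, so their supports are
        disjoint.\<close>
      have "l \<noteq> l'" using l' by auto
      then have "(r', l) \<in> E r l - E r l'" "(r', l') \<in> E r l' - E r l" using r(1) by (auto simp: E_def)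
      then show ?thesis
        using sumE[OF U, of l] sumE[OF U, of l'] reach(1)[OF r(3)] reach(1)[OF False]
        by (intro exI[of _ "E r l"] exI[of _ "E r l'"] exI[of _ "(r', l)"] exI[of _ "(r', l')"] conjI)
    qed
  qed
qed

section \<open>The comb-shaped spanning tree\<close>

text \<open>The graph of \<open>M\<close> is a comb: all links between adjacent blocks and, in the
  first block only, the links inside it. Where all neighbours but one already agree with a vertex,
  its equation forces the last to agree, whatever the signs of the weights; this strips the teeth
  from their free ends and then the spine from one end.\<close>

lemma grid_connected:
  fixes \<phi> x :: "real ^ ('m::{finite,linorder} \<times> 'n::{finite,linorder})"
  assumes nz: "\<And>p. \<phi> $ p \<noteq> 0"
    and eq: "\<And>p. (\<Sum>q\<in>UNIV. \<phi> $ p * \<phi> $ q * M $ p $ q * (x $ q - x $ p)) = 0"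
    and M0: "\<And>i j k l. M $ (i, j) $ (k, l) \<noteq> 0 \<Longrightarrow> (i, j) \<noteq> (k, l) \<Longrightarrow>
        adjacent i k \<and> j = l \<or> i = k \<and> adjacent j l \<and> pos i = 1"
    and M1: "\<And>i k j. adjacent i k \<Longrightarrow> M $ (i, j) $ (k, j) \<noteq> 0"
    and M2: "\<And>i j l. pos i = 1 \<Longrightarrow> adjacent j l \<Longrightarrow> M $ (i, j) $ (i, l) \<noteq> 0"
  shows "x $ p = x $ q"
proof -
  have single: "x $ q0 = x $ p" if "M $ p $ q0 \<noteq> 0" "\<And>q. q \<noteq> q0 \<Longrightarrow> M $ p $ q \<noteq> 0 \<Longrightarrow> x $ q = x $ p" for p q0
  proof -
    have "(\<Sum>q\<in>UNIV. \<phi> $ p * \<phi> $ q * M $ p $ q * (x $ q - x $ p)) =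
        \<phi> $ p * \<phi> $ q0 * M $ p $ q0 * (x $ q0 - x $ p)"
      by (rule sum_single) (use that(2) in auto)
    then show ?thesis using eq[of p] nz that(1) by simp
  qed
  \<comment> \<open>The equation is read at \<open>i\<close>, which lies beyond the first block and
    so has no link inside its block; the induction starts at the last block.\<close>
  have vertical: "x $ (k, j) = x $ (i, j)" if "pos i = pos k + 1" for i k j
    using that
  proof (induction "CARD('m) - pos i" arbitrary: i k rule: less_induct)
    case less
    show ?case
    proof (rule single)
      show "M $ (i, j) $ (k, j) \<noteq> 0" using less.prems by (intro M1) (simp add: adjacent_def)
      fix q assume q: "q \<noteq> (k, j)" "M $ (i, j) $ q \<noteq> 0"
      obtain k' l' where q': "q = (k', l')" by (cases q)
      show "x $ q = x $ (i, j)"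
      proof (cases "q = (i, j)")
        case False
        then have kl: "adjacent i k'" "l' = j"
          using M0[of i j k' l'] q(2) less.prems pos_bounds[of k] by (auto simp: q')
        have "pos k' \<noteq> pos k" using q(1) kl(2) by (auto simp: q')
        then have k': "pos k' = pos i + 1" using kl(1) less.prems by (auto simp: adjacent_def)
        have "CARD('m) - pos k' < CARD('m) - pos i" using k' pos_bounds[of k'] by linarith
        then show ?thesis using less.hyps[of k' i] k' by (simp add: q' kl(2))
      qed simp
    qed
  qed
  then have vert: "x $ (k, j) = x $ (i, j)" if "adjacent i k" for i k j
    using that unfolding adjacent_def by metis
  have column: "x $ (k, j) = x $ (i, j)" for i k j
    by (rule adjacent_induct[of "\<lambda>k. x $ (k, j) = x $ (i, j)" i]) (use vert in auto)
  obtain i1 :: 'm where i1: "pos i1 = 1"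
    by (rule obtain_pos[of 1]) (auto simp: Suc_le_eq)
  have horizontal: "x $ (i1, l) = x $ (i1, j)" if "pos l = pos j + 1" for j l
    using that
  proof (induction "pos j" arbitrary: j l rule: less_induct)
    case less
    show ?case
    proof (rule single)
      show "M $ (i1, j) $ (i1, l) \<noteq> 0" using less.prems by (intro M2 i1) (simp add: adjacent_def)
      fix q assume q: "q \<noteq> (i1, l)" "M $ (i1, j) $ q \<noteq> 0"
      obtain k' l' where q': "q = (k', l')" by (cases q)
      show "x $ q = x $ (i1, j)"
      proof (cases "q = (i1, j)")
        case False
        then consider "l' = j" | "k' = i1" "adjacent j l'"
          using M0[of i1 j k' l'] q(2) by (auto simp: q')
        then show ?thesis
        proof cases
          case 1
          then show ?thesis using column[of k' j i1] by (simp add: q')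
        next
          case 2
          have "pos l' \<noteq> pos l" using q(1) 2(1) by (auto simp: q')
          then have l': "pos j = pos l' + 1" using 2(2) less.prems by (auto simp: adjacent_def)
          then have "x $ (i1, j) = x $ (i1, l')" using less.hyps[of l' j] by simp
          then show ?thesis using 2(1) by (simp add: q')
        qed
      qed simp
    qed
  qed
  have "x $ (i1, l) = x $ (i1, j)" for j l
  proof (rule adjacent_induct[of "\<lambda>l. x $ (i1, l) = x $ (i1, j)" j])
    fix j' l' assume "x $ (i1, j') = x $ (i1, j)" "adjacent j' l'"
    then show "x $ (i1, l') = x $ (i1, j)"
      using horizontal unfolding adjacent_def by metis
  qed simp
  then show ?thesis
    using column by (cases p; cases q) metis
qed

text \<open>The value \<open>1 / (2 * h2^2)\<close> cancels the coupling of \<open>D_matrix\<close>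
  inside a block; 0 in the first block keeps that coupling as the spine of the comb. Equal values at
  the diagonal places are harmless, since the difference of \<open>x\<close> vanishes there.\<close>

lemma grid_nontrivial_parameter:
  fixes \<phi> x :: "real ^ ('m::{finite,linorder} \<times> 'n::{finite,linorder})"
    and K :: "real ^ 'k::{finite,linorder} ^ 'm::{finite,linorder}"
  assumes ab: "a < b" and cd: "c < d" and nz: "\<And>p. \<phi> $ p \<noteq> 0"
    and K: "K = (\<chi> i r. if pos i = 1 then 0 else 1 / (2 * (mesh CARD('n) c d)\<^sup>2))"
    and eq: "\<And>p. (\<Sum>q\<in>UNIV. \<phi> $ p * \<phi> $ q * (A_matrix K + D_matrix a b c d) $ p $ q * (x $ q - x $ p)) = 0"
  shows "x $ p = x $ q"
proof (rule grid_connected[of \<phi> "A_matrix K + D_matrix a b c d" x, OF nz eq])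
  have h: "mesh CARD('m) a b \<noteq> 0" "mesh CARD('n) c d \<noteq> 0"
    using mesh_pos[OF ab] mesh_pos[OF cd] by (metis less_irrefl)+
  have e: "K_entry K i r = (if pos i = 1 then 0 else 1 / (2 * (mesh CARD('n) c d)\<^sup>2))" for i r
    by (simp add: K_entry_def K)
  fix i k :: 'm and j l :: 'n
  show "adjacent i k \<and> j = l \<or> i = k \<and> adjacent j l \<and> pos i = 1"
    if "(A_matrix K + D_matrix a b c d) $ (i, j) $ (k, l) \<noteq> 0" "(i, j) \<noteq> (k, l)"
    using that by (auto simp: A_matrix_entry D_matrix_entry e adjacent_def split: if_splits)
  show "(A_matrix K + D_matrix a b c d) $ (i, j) $ (k, j) \<noteq> 0" if "adjacent i k"
    using that h by (auto simp: A_matrix_entry D_matrix_entry)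
  show "(A_matrix K + D_matrix a b c d) $ (i, j) $ (i, l) \<noteq> 0" if "pos i = 1" "adjacent j l"
    using that h by (auto simp: A_matrix_entry D_matrix_entry e)
qed

theorem theorem3p15:
  fixes a b c d \<beta> :: real
  assumes "a < b" and "c < d"
    and "CARD('n::{finite,linorder}) \<ge> 6"
    and "CARD('m::{finite,linorder}) \<ge> CARD('n)"
    and "CARD('k::{finite,linorder}) = 2 * CARD('n) - 1"
  shows "AE K :: real ^ 'k::{finite,linorder} ^ 'm::{finite,linorder} in lborel. K \<notin> U1 TYPE('n) a b c d \<union> U2 \<longrightarrow>
    (let H = homotopy a b c d \<beta> K ::
               (real ^ ('m \<times> 'n)) \<times> real \<times> real \<Rightarrow> (real ^ ('m \<times> 'n)) \<times> real;
         Z = zero_set a b c d \<beta> K :: ((real ^ ('m \<times> 'n)) \<times> real \<times> real) set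
     in regular_value H homotopy_dom 0 \<and>
        (\<forall>p q I J \<gamma> \<delta>.
           initial_point a b c d K p \<and> initial_point a b c d K q \<and> p \<noteq> q \<and>
           path_from Z p I \<gamma> \<and> path_from Z q J \<delta> \<longrightarrow>
           \<gamma> ` I \<inter> \<delta> ` J = {} \<or> \<gamma> ` I = \<delta> ` J) \<and>
        (\<forall>p I \<gamma>. initial_point a b c d K p \<and> path_from Z p I \<gamma> \<longrightarrow> bounded (\<gamma> ` I)))"
proof -
  define A :: "real ^ 'k::{finite,linorder} ^ 'm::{finite,linorder} \<Rightarrow>
      real ^ ('m \<times> 'n::{finite,linorder}) ^ ('m \<times> 'n)" where "A = A_matrix"
  define D :: "real ^ ('m::{finite,linorder} \<times> 'n::{finite,linorder}) ^ ('m \<times> 'n)"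
    where "D = D_matrix a b c d"
  define \<rho> where "\<rho> = 1 / (mesh CARD('m) a b * mesh CARD('n) c d)"
  interpret E: eigen_homotopy A D \<beta> \<rho>
    unfolding A_def \<rho>_def by (rule eigen_homotopy_grid[OF assms(1,2,5)])
  have h: "mesh CARD('m) a b \<noteq> 0"
    using mesh_pos[OF assms(1)] by (metis less_irrefl)
  have deg: "\<exists>B C u w. (\<Sum>p\<in>B. fst (fst y) $ p) = 0 \<and> (\<Sum>p\<in>C. fst (fst y) $ p) = 0 \<and>
        u \<in> B - C \<and> w \<in> C - B \<and> E.touched (fst (fst y)) u \<and> E.touched (fst (fst y)) w"
    if y: "E.F y = 0" "snd (snd (fst y)) \<noteq> 1" "\<not> E.touched (fst (fst y)) p" for y p
  proof (rule grid_degenerate[where ?p0.0 = p])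
    let ?\<phi> = "fst (fst y)"
    show "CARD('m) \<ge> 2" "CARD('n) \<ge> 2" using assms(3,4) by auto
    show "?\<phi> \<noteq> 0" by (rule E.vec_nonzero[OF y(1)])
    show touched: "E.touched ?\<phi> p" if "?\<phi> $ p \<noteq> 0" for p
      using E.untouched_zero that by blast
    show "E.touched ?\<phi> (i, j)" if "adjacent j l" "?\<phi> $ (i, l) \<noteq> 0" for i j l
    proof (cases "?\<phi> $ (i, j) = 0")
      case True
      then show ?thesis
        using A_matrix_reach[OF assms(5) that(1) True that(2)] by (simp add: E.touched_def) (simp add: A_def)
    qed (rule touched)
    show "\<not> E.touched ?\<phi> p" by (rule y(3))
    show "(\<Sum>k | adjacent i k. ?\<phi> $ (k, j)) = 0"
      if z: "?\<phi> $ (i, j) = 0" "\<And>l. adjacent j l \<Longrightarrow> ?\<phi> $ (i, l) = 0" for i j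
    proof -
      \<comment> \<open>At such a point the terms with \<open>A\<close>, the cube and the eigenvalue
        all vanish, so the row of \<open>D\<close> alone must be zero.\<close>
      have "fst (E.F y) $ (i, j) = 0" using y(1) by simp
      moreover have "(A (snd y) *v ?\<phi>) $ (i, j) = 0"
        unfolding A_def by (rule A_matrix_row_zero[OF z])
      ultimately have "(D *v ?\<phi>) $ (i, j) = 0"
        using z(1) by (simp add: E.F_def cube_def)
      then show ?thesis
        using D_matrix_row_sum[OF z, of a b c d] h by (simp add: D_def)
    qed
  qed
  have K0: "\<exists>K. E.critical_poly ((\<phi>, 0, 0), K) \<noteq> 0" if nz: "\<And>p. \<phi> $ p \<noteq> 0" for \<phi>
  proof -
    \<comment> \<open>One parameter serves every nonvanishing \<phi>, because the tree argument uses
      only that the weights are nonzero.\<close>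
    define K :: "real ^ 'k::{finite,linorder} ^ 'm::{finite,linorder}"
      where "K = (\<chi> i r. if pos i = 1 then 0 else 1 / (2 * (mesh CARD('n) c d)\<^sup>2))"
    have pencil: "E.pencil 0 K = A_matrix K + D_matrix a b c d"
      by (simp add: E.pencil_def) (simp add: A_def D_def)
    have "E.critical_poly ((\<phi>, 0, 0), K) \<noteq> 0"
    proof (rule E.critical_poly_nontrivial[OF nz])
      show "E.pencil 0 K $ p $ q = E.pencil 0 K $ q $ p" for p q
        by (simp add: pencil A_matrix_sym[of K p q] D_matrix_sym[of a b c d p q])
      show "x $ p = x $ q"
        if "\<And>p. (\<Sum>q\<in>UNIV. \<phi> $ p * \<phi> $ q * E.pencil 0 K $ p $ q * (x $ q - x $ p)) = 0" for x p q
        by (rule grid_nontrivial_parameter[OF assms(1,2) nz K_def]) (use that pencil in simp)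
    qed
    then show ?thesis ..
  qed
  define N where "N = {K. \<exists>x. E.F (x, K) = 0 \<and> snd (snd x) \<noteq> 1 \<and>
    (\<not> surj (\<lambda>v. E.F' (x, K) (v, 0)) \<or>
     snd (snd x) = 0 \<and> (\<exists>v. v \<noteq> 0 \<and> snd (snd v) = 0 \<and> E.F' (x, K) (v, 0) = 0))}"
  have "negligible N"
    unfolding N_def by (rule E.negligible_nonregular[OF deg K0])
  then have "AE K in lborel. K \<notin> N" by (rule AE_lborel_not_in_negligible)
  then show ?thesis
  proof (rule AE_mp, intro AE_I2 impI)
    fix K assume "K \<notin> N"
    then have reg: "\<And>x. E.slice K x = 0 \<Longrightarrow> snd (snd x) \<noteq> 1 \<Longrightarrow> surj (E.slice' K x)"
      and trans: "\<And>x v. E.slice K x = 0 \<Longrightarrow> snd (snd x) = 0 \<Longrightarrow> snd (snd v) = 0 \<Longrightarrow> E.slice' K x v = 0 \<Longrightarrow> v = 0"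
      unfolding N_def E.slice_def E.slice'_def by force+
    have H: "homotopy a b c d \<beta> K = E.slice K"
      unfolding fun_eq_iff E.slice_def E.F_def unfolding homotopy_def A_def D_def \<rho>_def
      by (simp add: split_beta)
    define Z where "Z = {x \<in> homotopy_dom. E.slice K x = 0}"
    have Z: "zero_set a b c d \<beta> K = Z"
      by (simp add: zero_set_def H Z_def)
    have t: "0 \<le> snd (snd x)" "snd (snd x) < 1" if "x \<in> homotopy_dom" for x :: "(real ^ ('m \<times> 'n)) \<times> real \<times> real"
      using that by (auto simp: homotopy_dom_def)
    \<comment> \<open>On \<open>Z\<close> the bound t < 1 makes \<open>reg\<close> applicable, and t
      \<ge> 0 is the one-sidedness on which the curve argument rests.\<close>
    interpret T: transversal_level_set "E.slice K" "E.slice' K" Z "\<lambda>x. snd (snd x)"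
    proof (rule transversal_level_set.intro)
      show "(E.slice K has_derivative E.slice' K x) (at x)" for x by (rule E.has_derivative_slice)
      show "continuous_on UNIV (\<lambda>x. E.slice' K x v)" for v by (rule E.continuous_on_slice')
      show "surj (E.slice' K x)" if "x \<in> Z" for x
        using that t[of x] by (intro reg) (auto simp: Z_def)
      show "linear (\<lambda>x :: (real ^ ('m \<times> 'n)) \<times> real \<times> real. snd (snd x))"
        by (auto intro!: linearI)
      show "v = 0" if "x \<in> Z" "snd (snd x) = 0" "E.slice' K x v = 0" "snd (snd v) = 0" for x v
        using that by (intro trans[of x v]) (auto simp: Z_def)
    qed (use t in \<open>auto simp: Z_def\<close>)
    have regular: "regular_value (E.slice K) homotopy_dom 0"
      unfolding regular_value_def
    proof (intro ballI impI)
      fix x :: "(real ^ ('m \<times> 'n)) \<times> real \<times> real" assume x: "x \<in> homotopy_dom" "E.slice K x = 0"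
      have "(E.slice K has_derivative E.slice' K x) (at x within homotopy_dom)"
        by (rule has_derivative_at_withinI[OF E.has_derivative_slice])
      moreover have "surj (E.slice' K x)" using x t[OF x(1)] by (intro reg) auto
      ultimately show "\<exists>f'. (E.slice K has_derivative f') (at x within homotopy_dom) \<and> surj f'" by blast
    qed
    have start: "snd (snd p) = 0" if "initial_point a b c d K p" for p :: "(real ^ ('m \<times> 'n)) \<times> real \<times> real"
      using that by (auto simp: initial_point_def)
    have paths: "\<gamma> ` I \<inter> \<delta> ` J = {} \<or> \<gamma> ` I = \<delta> ` J"
      if "initial_point a b c d K p \<and> initial_point a b c d K q \<and> p \<noteq> q \<and> path_from Z p I \<gamma> \<and> path_from Z q J \<delta>"
      for p q I J \<gamma> \<delta>
      using that by (intro T.paths_disjoint_or_equal[of p I \<gamma> q J \<delta>] start) auto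
    have bounded: "bounded (\<gamma> ` I)" if "initial_point a b c d K p \<and> path_from Z p I \<gamma>" for p I \<gamma>
      by (rule bounded_subset[OF E.bounded_slice_zeros[of K]])
         (use that in \<open>auto simp: path_from_def solution_curve_def Z_def\<close>)
    show "let H = homotopy a b c d \<beta> K ::
               (real ^ ('m \<times> 'n)) \<times> real \<times> real \<Rightarrow> (real ^ ('m \<times> 'n)) \<times> real;
         Z = zero_set a b c d \<beta> K :: ((real ^ ('m \<times> 'n)) \<times> real \<times> real) set
     in regular_value H homotopy_dom 0 \<and>
        (\<forall>p q I J \<gamma> \<delta>.
           initial_point a b c d K p \<and> initial_point a b c d K q \<and> p \<noteq> q \<and>
           path_from Z p I \<gamma> \<and> path_from Z q J \<delta> \<longrightarrow>
           \<gamma> ` I \<inter> \<delta> ` J = {} \<or> \<gamma> ` I = \<delta> ` J) \<and>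
        (\<forall>p I \<gamma>. initial_point a b c d K p \<and> path_from Z p I \<gamma> \<longrightarrow> bounded (\<gamma> ` I))"
      unfolding Let_def H Z by (intro conjI allI impI regular) (erule paths, erule bounded)
  qed
qed

end
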